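(* Let $p\in[1,\infty)$ and let $q\in(1,\infty]$ be its dual exponent, $p^{-1}+q^{-1}=1$. Let $N\ge1$ be a real number and let $X$ be a compact metric space with $\mathcal{H}^N(X)<\infty$. Let $E,F$ be two disjoint continua in $X$. Suppose $u\in N^{1,p}(X)$ satisfies $u=1$ on $F$ and $u=0$ on $E$. Then there exists a sequence of Lipschitz functions $u_i\in N^{1,p}(X)$ with $u_i=1$ on $F$ and $u_i=0$ on $E$, such that for every non-negative Borel function $\rho\in L^q(X)$, $$\limsup_{i\to\infty}\int_0^1\int_{\partial\{u_i<t\}}\rho\,d\mathcal{H}^{N-1}\,dt\ \le\ \frac{2v_{N-1}}{v_N}\int_X\rho\,|\nabla u|_p\,d\mathcal{H}^N.$$
   Context: A continuum is a nonempty, compact, connected set. $\partial\{u_i<t\}$ is the topological boundary in $X$ of $\{x\in X:u_i(x)<t\}$. Constants: $v_k:=\dfrac{\pi^{k/2}}{\Gamma_{\mathrm{Eul}}(\frac k2+1)}$ for real $k\ge0$, where $\Gamma_{\mathrm{Eul}}$ is the Gamma function. Hausdorff measure: for real $s\ge 0$, $\mathcal{H}^s(A):=\lim_{\delta\to0}\mathcal{H}^s_\delta(A)$, where $\mathcal{H}^s_\delta(A):=\frac{v_s}{2^s}\inf\{\sum_i\operatorname{diam}(A_i)^s:A\subset\bigcup_iA_i,\ \operatorname{diam}(A_i)<\delta\}$ over countable covers; for $s=0$ the usual convention makes $\mathcal{H}^0$ the counting measure. $X$ is equipped with $\mathcal{H}^N$, and $L^p(X)$, $L^q(X)$ and "almost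 everywhere" refer to it. Curves are continuous maps $\gamma$ from compact nonempty intervals into $X$. For a family $\Gamma$ of curves, $\operatorname{Mod}_p(\Gamma)$ is the infimum of $\int_X\rho^p\,d\mathcal{H}^N$ over Borel $\rho:X\to[0,\infty]$ with $\int_\gamma\rho\,ds\ge1$ for each rectifiable $\gamma\in\Gamma$. A property holds for $p$-almost every curve if the family of curves for which it fails has $p$-modulus zero. Upper gradients and Newtonian space: for measurable $f:X\to[-\infty,\infty]$, a Borel function $g:X\to[0,\infty]$ is an upper gradient of $f$ if $\int_\gamma g\,ds\ge|f(\gamma(0))-f(\gamma(1))|$ for every rectifiable curve $\gamma:[0,1]\to X$ (with $|\infty-\infty|=\infty$). $N^{1,p}(X)$ is the set of $f\in L^p(X)$ (everywhere-defined functions) having an upper gradient $g\in L^p(X)$. For $f\in N^{1,p}(X)$, $|\nabla f|_p$ denotes the minimal $p$-weak upper gradient: the ($\mathcal{H}^N$-a.e. unique) function for which the upper gradient inequality holds for $p$-almost every curve and which satisfies $|\nabla f|_p\le g$ $\mathcal{H}^N$-a.e. for each upper gradient $g\in L^p(X)$ of $f$. *)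

theory Defs
  imports "HOL-Analysis.Analysis"
begin

section \<open>Hausdorff measure\<close>

text \<open>
  Pitfalls: \<^term>\<open>0 powr 0 = (0::real)\<close> in HOL, whereas \<open>\<H>\<^sup>0\<close> must be the counting measure, so
  the gauge of a nonempty set for \<open>s = 0\<close> is set to 1; and \<^const>\<open>diameter\<close> is meaningless on
  unbounded sets, so covering sets are required to be bounded.  Finite covers are countable
  covers padded with the empty set, which has gauge 0 for every \<open>s\<close>.  The constant
  \<open>v\<^sub>k\<close> is the library's \<^const>\<open>unit_ball_vol\<close> (real argument).
\<close>

definition hausdorff_gauge :: "real \<Rightarrow> 'a::metric_space set \<Rightarrow> ennreal" where
  "hausdorff_gauge s A =
     (if A = {} then 0 else if s = 0 then 1 else ennreal (diameter A powr s))"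

definition hausdorff_covers :: "real \<Rightarrow> 'a::metric_space set \<Rightarrow> (nat \<Rightarrow> 'a set) set" where
  "hausdorff_covers \<delta> A = {C. A \<subseteq> (\<Union>i. C i) \<and> (\<forall>i. bounded (C i) \<and> diameter (C i) < \<delta>)}"

definition hausdorff_pre :: "real \<Rightarrow> real \<Rightarrow> 'a::metric_space set \<Rightarrow> ennreal" where
  "hausdorff_pre s \<delta> A =
     ennreal (unit_ball_vol s / 2 powr s) *
     (INF C \<in> hausdorff_covers \<delta> A. \<Sum>i. hausdorff_gauge s (C i))"

text \<open>The limit \<open>\<delta> \<rightarrow> 0\<close> is monotone, hence a supremum (\<open>hausdorff_outer_tendsto\<close> below).\<close>

definition hausdorff_outer :: "real \<Rightarrow> 'a::metric_space set \<Rightarrow> ennreal" where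
  "hausdorff_outer s A = (SUP \<delta>\<in>{0<..}. hausdorff_pre s \<delta> A)"

text \<open>The measure lives on the Caratheodory-measurable sets of the outer measure.\<close>

definition hausdorff :: "real \<Rightarrow> 'a::metric_space measure" where
  "hausdorff s =
     measure_of UNIV (lambda_system UNIV (Pow UNIV) (hausdorff_outer s)) (hausdorff_outer s)"

lemma hausdorff_pre_antimono:
  assumes "\<delta> \<le> \<delta>'"
  shows "hausdorff_pre s \<delta>' A \<le> hausdorff_pre s \<delta> A"
  unfolding hausdorff_pre_def hausdorff_covers_def
  using assms by (intro mult_left_mono INF_superset_mono) (auto intro: less_le_trans)

lemma hausdorff_outer_tendsto:
  "((\<lambda>\<delta>. hausdorff_pre s \<delta> A) \<longlongrightarrow> hausdorff_outer s A) (at_right 0)"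
proof (rule order_tendstoI)
  fix a assume "a < hausdorff_outer s A"
  then obtain d where d: "d > 0" "a < hausdorff_pre s d A"
    by (auto simp: hausdorff_outer_def less_SUP_iff)
  have "eventually (\<lambda>\<delta>. \<delta> \<in> {0<..<d}) (at_right 0)"
    using d(1) by (rule eventually_at_right_real)
  then show "eventually (\<lambda>\<delta>. a < hausdorff_pre s \<delta> A) (at_right 0)"
    by eventually_elim
       (rule less_le_trans[OF d(2) hausdorff_pre_antimono], auto intro: less_imp_le)
next
  fix a assume a: "hausdorff_outer s A < a"
  have "eventually (\<lambda>\<delta>::real. \<delta> > 0) (at_right 0)"
    by (rule eventually_at_right_less)
  then show "eventually (\<lambda>\<delta>. hausdorff_pre s \<delta> A < a) (at_right 0)"
    by eventually_elim (rule le_less_trans[OF _ a], auto simp: hausdorff_outer_def intro: SUP_upper)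
qed

lemma hausdorff_pre_countably_subadditive:
  fixes A :: "nat \<Rightarrow> 'a::metric_space set"
  shows "hausdorff_pre s \<delta> (\<Union>i. A i) \<le> (\<Sum>i. hausdorff_pre s \<delta> (A i))"
proof -
  define I where "I = (\<lambda>B::'a set. INF C \<in> hausdorff_covers \<delta> B. \<Sum>i. hausdorff_gauge s (C i))"
  have "I (\<Union>i. A i) \<le> (\<Sum>i. I (A i))"
  proof (rule ennreal_le_epsilon)
    fix e :: real
    assume fin: "(\<Sum>i. I (A i)) < top" and e: "0 < e"
    have "\<exists>C\<in>hausdorff_covers \<delta> (A n).
            (\<Sum>i. hausdorff_gauge s (C i)) < I (A n) + ennreal (e * (1/2) ^ Suc n)" for n
    proof -
      have "I (A n) < top"
        using fin ennreal_suminf_lessD by blast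
      then have "I (A n) < I (A n) + ennreal (e * (1/2) ^ Suc n)"
        using e by (simp add: ennreal_zero_less_mult_iff)
      then show ?thesis
        by (subst (asm) I_def) (auto simp: INF_less_iff)
    qed
    then obtain C where C: "\<And>n. C n \<in> hausdorff_covers \<delta> (A n)"
      and Cs: "\<And>n. (\<Sum>i. hausdorff_gauge s (C n i)) < I (A n) + ennreal (e * (1/2) ^ Suc n)"
      by metis
    define D where "D = (\<lambda>k. case prod_decode k of (n, i) \<Rightarrow> C n i)"
    have "D \<in> hausdorff_covers \<delta> (\<Union>i. A i)"
    proof -
      have "x \<in> (\<Union>k. D k)" if x: "x \<in> A n" for x n
      proof -
        obtain i where "x \<in> C n i"
          using C[of n] x unfolding hausdorff_covers_def by blast
        then have "x \<in> D (prod_encode (n, i))" by (simp add: D_def)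
        then show ?thesis by blast
      qed
      then show ?thesis
        using C by (auto simp: hausdorff_covers_def D_def split: prod.split)
    qed
    then have "I (\<Union>i. A i) \<le> (\<Sum>k. hausdorff_gauge s (D k))"
      unfolding I_def by (rule INF_lower)
    also have "\<dots> = (\<Sum>n. \<Sum>i. hausdorff_gauge s (C n i))"
      using suminf_ennreal_2dimen[of "\<lambda>n. \<Sum>i. hausdorff_gauge s (C n i)"
          "\<lambda>(n, i). hausdorff_gauge s (C n i)"]
      by (simp add: D_def comp_def case_prod_unfold)
    also have "\<dots> \<le> (\<Sum>n. I (A n) + ennreal (e * (1/2) ^ Suc n))"
      using Cs by (intro suminf_le) (auto intro: less_imp_le)
    also have "\<dots> = (\<Sum>n. I (A n)) + (\<Sum>n. ennreal (e * (1/2) ^ Suc n))"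
      by (subst suminf_add) auto
    also have "(\<Sum>n. ennreal (e * (1/2) ^ Suc n)) = ennreal e"
    proof (rule suminf_ennreal_eq)
      show "(\<lambda>n. e * (1/2) ^ Suc n) sums e"
        using sums_mult[OF power_half_series, of e] by simp
    qed (use e in auto)
    finally show "I (\<Union>i. A i) \<le> (\<Sum>i. I (A i)) + ennreal e" .
  qed
  then show ?thesis
    unfolding hausdorff_pre_def ennreal_suminf_cmult I_def
    by (rule mult_left_mono) simp
qed

lemma outer_measure_space_hausdorff:
  "outer_measure_space (Pow UNIV) (hausdorff_outer s :: 'a::metric_space set \<Rightarrow> ennreal)"
proof -
  have "hausdorff_pre s \<delta> ({}::'a set) = 0" if "\<delta> > 0" for \<delta>
  proof -
    have "(\<lambda>_. {}) \<in> hausdorff_covers \<delta> ({}::'a set)"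
      using that by (simp add: hausdorff_covers_def)
    then have "(INF C \<in> hausdorff_covers \<delta> ({}::'a set). \<Sum>i. hausdorff_gauge s (C i))
        \<le> (\<Sum>i::nat. hausdorff_gauge s ({}::'a set))"
      by (rule INF_lower)
    then show ?thesis by (simp add: hausdorff_pre_def hausdorff_gauge_def)
  qed
  then have "positive (Pow UNIV) (hausdorff_outer s :: 'a set \<Rightarrow> ennreal)"
    by (auto simp: positive_def hausdorff_outer_def intro!: SUP_eq_const[where x=0, simplified])
  moreover have "increasing (Pow UNIV) (hausdorff_outer s :: 'a set \<Rightarrow> ennreal)"
    unfolding increasing_def hausdorff_outer_def hausdorff_pre_def hausdorff_covers_def
    by (intro ballI impI SUP_mono' mult_left_mono INF_superset_mono) auto
  moreover have "countably_subadditive (Pow UNIV) (hausdorff_outer s :: 'a set \<Rightarrow> ennreal)"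
    unfolding countably_subadditive_def
  proof safe
    fix A :: "nat \<Rightarrow> 'a set"
    show "hausdorff_outer s (\<Union>i. A i) \<le> (\<Sum>i. hausdorff_outer s (A i))"
      unfolding hausdorff_outer_def
      by (rule SUP_least, rule order_trans[OF hausdorff_pre_countably_subadditive])
         (auto intro!: suminf_le SUP_upper)
  qed
  ultimately show ?thesis by (simp add: outer_measure_space_def)
qed

lemma measure_space_hausdorff:
  "measure_space UNIV (lambda_system UNIV (Pow UNIV) (hausdorff_outer s)) (hausdorff_outer s)"
  by (rule sigma_algebra.caratheodory_lemma[OF sigma_algebra_Pow outer_measure_space_hausdorff])

lemma space_hausdorff [simp]: "space (hausdorff s) = UNIV"
  by (simp add: hausdorff_def space_measure_of_conv)

lemma sets_hausdorff: "sets (hausdorff s) = lambda_system UNIV (Pow UNIV) (hausdorff_outer s)"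
  unfolding hausdorff_def
  by (rule sigma_algebra.sets_measure_of_eq[OF
        measure_space_hausdorff[unfolded measure_space_def, THEN conjunct1]])

lemma emeasure_hausdorff:
  assumes "A \<in> sets (hausdorff s)"
  shows "emeasure (hausdorff s) A = hausdorff_outer s A"
proof -
  note ms = measure_space_hausdorff[unfolded measure_space_def]
  show ?thesis
    unfolding hausdorff_def using assms[unfolded sets_hausdorff]
    by (rule emeasure_measure_of_sigma[OF ms[THEN conjunct1]
          ms[THEN conjunct2, THEN conjunct1] ms[THEN conjunct2, THEN conjunct2]])
qed


section \<open>Curves, line integrals and modulus\<close>

text \<open>A curve \<open>(\<gamma>, a, b)\<close> is the restriction of \<open>\<gamma>\<close> to \<open>[a, b]\<close>.\<close>

type_synonym 'a curve = "(real \<Rightarrow> 'a) \<times> real \<times> real"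

definition is_curve :: "'a::metric_space curve \<Rightarrow> bool" where
  "is_curve = (\<lambda>(\<gamma>, a, b). a \<le> b \<and> continuous_on {a..b} \<gamma>)"

definition curve_length :: "'a::metric_space curve \<Rightarrow> ennreal" where
  "curve_length = (\<lambda>(\<gamma>, a, b).
     SUP (n, t) \<in> {(n::nat, t::nat \<Rightarrow> real). t 0 = a \<and> t n = b \<and> mono_on {..n} t}.
       \<Sum>i<n. ennreal (dist (\<gamma> (t i)) (\<gamma> (t (Suc i)))))"

definition rectifiable :: "'a::metric_space curve \<Rightarrow> bool" where
  "rectifiable c \<longleftrightarrow> is_curve c \<and> curve_length c < \<infinity>"

text \<open>
  Arc-length parametrization: the value at \<open>s \<in> [0, length]\<close> is \<open>\<gamma> t\<close> for any \<open>t\<close> such that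
  \<open>\<gamma>\<close> has length \<open>s\<close> on \<open>[a, t]\<close>; it does not depend on the choice of \<open>t\<close>.
\<close>

definition arclength_param :: "'a::metric_space curve \<Rightarrow> real \<Rightarrow> 'a" where
  "arclength_param = (\<lambda>(\<gamma>, a, b) s.
     \<gamma> (SOME t. t \<in> {a..b} \<and> curve_length (\<gamma>, a, t) = ennreal s))"

definition line_integral :: "('a::metric_space \<Rightarrow> ennreal) \<Rightarrow> 'a curve \<Rightarrow> ennreal" where
  "line_integral \<rho> c =
     (\<integral>\<^sup>+ s \<in> {0..enn2real (curve_length c)}. \<rho> (arclength_param c s) \<partial>lborel)"

text \<open>Power of an extended nonnegative number, used for exponents \<open>r > 0\<close> only.\<close>

definition ennpow :: "ennreal \<Rightarrow> real \<Rightarrow> ennreal" where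
  "ennpow x r = (if x = \<infinity> then \<infinity> else ennreal (enn2real x powr r))"

definition modulus ::
    "real \<Rightarrow> 'a::metric_space measure \<Rightarrow> 'a curve set \<Rightarrow> ennreal" where
  "modulus p M \<Gamma> =
     (INF \<rho> \<in> {\<rho> \<in> borel_measurable borel. \<forall>c\<in>\<Gamma>. rectifiable c \<longrightarrow> line_integral \<rho> c \<ge> 1}.
        \<integral>\<^sup>+ x. ennpow (\<rho> x) p \<partial>M)"

definition almost_every_curve ::
    "real \<Rightarrow> 'a::metric_space measure \<Rightarrow> ('a curve \<Rightarrow> bool) \<Rightarrow> bool" where
  "almost_every_curve p M P \<longleftrightarrow> modulus p M {c. is_curve c \<and> \<not> P c} = 0"


section \<open>Newtonian space\<close>

text \<open>Exponents range over \<open>(0, \<infinity>]\<close>; functions are extended-real valued, defined everywhere.\<close>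

definition Lp_space :: "ennreal \<Rightarrow> 'a measure \<Rightarrow> ('a \<Rightarrow> ereal) set" where
  "Lp_space r M = {f \<in> borel_measurable M.
     if r = \<infinity> then \<exists>C::real. AE x in M. \<bar>f x\<bar> \<le> ereal C
     else (\<integral>\<^sup>+ x. ennpow (e2ennreal \<bar>f x\<bar>) (enn2real r) \<partial>M) < \<infinity>}"

text \<open>
  In \<^typ>\<open>ereal\<close> one has \<open>\<infinity> - \<infinity> = -\<infinity> - (-\<infinity>) = \<infinity>\<close>, so the convention
  \<open>\<bar>\<infinity> - \<infinity>\<bar> = \<infinity>\<close> holds automatically.
\<close>

definition upper_gradient_ineq ::
    "('a::metric_space \<Rightarrow> ereal) \<Rightarrow> ('a \<Rightarrow> ennreal) \<Rightarrow> 'a curve \<Rightarrow> bool" where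
  "upper_gradient_ineq f g = (\<lambda>(\<gamma>, a, b).
     rectifiable (\<gamma>, a, b) \<longrightarrow> line_integral g (\<gamma>, a, b) \<ge> e2ennreal \<bar>f (\<gamma> a) - f (\<gamma> b)\<bar>)"

definition upper_gradient ::
    "('a::metric_space \<Rightarrow> ereal) \<Rightarrow> ('a \<Rightarrow> ennreal) \<Rightarrow> bool" where
  "upper_gradient f g \<longleftrightarrow>
     g \<in> borel_measurable borel \<and> (\<forall>\<gamma>. upper_gradient_ineq f g (\<gamma>, 0, 1))"

definition newtonian :: "real \<Rightarrow> 'a::metric_space measure \<Rightarrow> ('a \<Rightarrow> ereal) set" where
  "newtonian p M = {f \<in> Lp_space (ennreal p) M.
     \<exists>g. upper_gradient f g \<and> (\<lambda>x. enn2ereal (g x)) \<in> Lp_space (ennreal p) M}"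

text \<open>
  \<open>G\<close> is (a Borel representative of) the minimal \<open>p\<close>-weak upper gradient of \<open>f\<close>, which is unique
  up to almost everywhere equality.
\<close>

definition minimal_weak_upper_gradient ::
    "real \<Rightarrow> 'a::metric_space measure \<Rightarrow> ('a \<Rightarrow> ereal) \<Rightarrow> ('a \<Rightarrow> ennreal) \<Rightarrow> bool" where
  "minimal_weak_upper_gradient p M f G \<longleftrightarrow>
     G \<in> borel_measurable borel \<and>
     almost_every_curve p M (upper_gradient_ineq f G) \<and>
     (\<forall>g. upper_gradient f g \<and> (\<lambda>x. enn2ereal (g x)) \<in> Lp_space (ennreal p) M \<longrightarrow>
        (AE x in M. G x \<le> g x))"

definition continuum :: "'a::topological_space set \<Rightarrow> bool" where
  "continuum K \<longleftrightarrow> K \<noteq> {} \<and> compact K \<and> connected K"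

end

(*
  To a p-weak upper gradient G of u add a function of small p-norm
  that deals with the exceptional curves and a small constant, and enlarge the sum to a lower semicontinuous
  function h = sup g_n with g_n Lipschitz, g_n >= c > 0 and h - G small in L^p (Vitali-Caratheodory). Every curve
  from E to F then has h-length greater than 1. Let v_n(x) be the least cost, capped at 1, of a chain
  from E to x with steps shorter than 1/n, a step from y to z costing g_n(y) d(y,z). If v_n < 1 somewhere
  on F for every n, then the optimal chains converge (Tychonoff) to a curve from E to F of h-length at most 1,
  which is impossible; so v_n = 1 on F for some n. This v_n is Lipschitz, and at scale 1/n its Lipschitz constant
  near x is at most about g_n(x) <= h(x), so Eilenberg's inequality bounds the integral over the fibres by the
  integral of rho h, and Young's inequality shows that replacing h by G costs little.
*)

theory Submission
  imports Defs
begin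

section \<open>Hausdorff measure on Borel sets\<close>

text \<open>X need not contain a single nonconstant rectifiable curve, so the least h-length of a
  curve from E to x may be discontinuous in x. Chains avoid this: any two points closer than 1/n are
  joined by one step, which builds in the local Lipschitz bound, and curves enter only as limits of
  cheap chains. Of u there remains only that curves from E to F have G-length at least 1 outside an
  exceptional family; the competitors do not approximate u. The bound \<open>c\<close> acts twice:
  cost at most 1 forces length at most \<open>1 / c\<close>, so all chains live on one parameter
  interval, and the surplus \<open>c\<close> times the length makes the h-length exceed 1 strictly.
  The error beyond \<open>G\<close> is fixed before \<rho>, hence one sequence serves every \<rho>.
  The factor \<open>2 * v_(N-1) / v_N\<close> is the quotient of the normalizations
  \<open>v_s / 2^s\<close> at \<open>s = N - 1\<close> and \<open>s = N\<close>.\<close>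

lemma hausdorff_gauge_mono:
  assumes "A \<subseteq> B" "bounded B" "0 \<le> s"
  shows "hausdorff_gauge s A \<le> hausdorff_gauge s B"
proof -
  have "diameter A \<le> diameter B" using assms by (intro diameter_subset)
  moreover have "0 \<le> diameter A" using assms by (intro diameter_ge_0) (auto intro: bounded_subset)
  ultimately show ?thesis
    using assms unfolding hausdorff_gauge_def by (auto intro!: powr_mono2)
qed

text \<open>Shrinking the members keeps them small, so a cover may be taken inside the set it
  covers; \<open>eilenberg_set\<close> relies on this, since its Lipschitz bound holds only on
  \<open>A\<close>.\<close>

lemma hausdorff_covers_Int:
  assumes "C \<in> hausdorff_covers \<delta> A" "B \<subseteq> A"
  shows "(\<lambda>i. C i \<inter> B) \<in> hausdorff_covers \<delta> B"
proof -
  have "diameter (C i \<inter> B) \<le> diameter (C i)" for i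
    using assms by (intro diameter_subset) (auto simp: hausdorff_covers_def)
  then show ?thesis
    using assms unfolding hausdorff_covers_def by (force intro: bounded_subset le_less_trans)
qed

text \<open>A set of diameter below \<open>\<delta> \<le> r\<close> cannot meet both
  \<open>A\<close> and \<open>B\<close>, so tracing a cover of the union on \<open>A\<close> and on
  \<open>B\<close> pays for each member at most once.\<close>

lemma hausdorff_pre_separated:
  fixes A B :: "'a::metric_space set"
  assumes "\<delta> \<le> r" and sep: "\<And>x y. x \<in> A \<Longrightarrow> y \<in> B \<Longrightarrow> r \<le> dist x y" and s: "0 \<le> s"
  shows "hausdorff_pre s \<delta> A + hausdorff_pre s \<delta> B \<le> hausdorff_pre s \<delta> (A \<union> B)"
proof -
  define I where "I = (\<lambda>B::'a set. INF C \<in> hausdorff_covers \<delta> B. \<Sum>i. hausdorff_gauge s (C i))"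
  have "I A + I B \<le> (INF C \<in> hausdorff_covers \<delta> (A \<union> B). \<Sum>i. hausdorff_gauge s (C i))"
  proof (rule INF_greatest)
    fix C assume C: "C \<in> hausdorff_covers \<delta> (A \<union> B)"
    have "I A + I B \<le> (\<Sum>i. hausdorff_gauge s (C i \<inter> A)) + (\<Sum>i. hausdorff_gauge s (C i \<inter> B))"
      unfolding I_def using hausdorff_covers_Int[OF C] by (intro add_mono INF_lower) auto
    also have "\<dots> = (\<Sum>i. hausdorff_gauge s (C i \<inter> A) + hausdorff_gauge s (C i \<inter> B))"
      by (rule suminf_add) auto
    also have "\<dots> \<le> (\<Sum>i. hausdorff_gauge s (C i))"
    proof (rule suminf_le)
      fix i
      have bC: "bounded (C i)" and dC: "diameter (C i) < \<delta>"
        using C by (auto simp: hausdorff_covers_def)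
      have "C i \<inter> A = {} \<or> C i \<inter> B = {}"
      proof (rule ccontr)
        assume "\<not> ?thesis"
        then obtain x y where "x \<in> C i" "x \<in> A" "y \<in> C i" "y \<in> B" by blast
        then have "r \<le> diameter (C i)"
          using sep diameter_bounded_bound[OF bC] order_trans by blast
        then show False using dC \<open>\<delta> \<le> r\<close> by simp
      qed
      moreover have "hausdorff_gauge s ({} :: 'a set) = 0" by (simp add: hausdorff_gauge_def)
      ultimately show "hausdorff_gauge s (C i \<inter> A) + hausdorff_gauge s (C i \<inter> B) \<le> hausdorff_gauge s (C i)"
        using hausdorff_gauge_mono[OF _ bC s, of "C i \<inter> A"] hausdorff_gauge_mono[OF _ bC s, of "C i \<inter> B"]
        by auto
    qed auto
    finally show "I A + I B \<le> (\<Sum>i. hausdorff_gauge s (C i))" .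
  qed
  then show ?thesis
    unfolding hausdorff_pre_def I_def by (simp add: distrib_left[symmetric] mult_left_mono)
qed

text \<open>Additivity at positive distance survives the limit \<delta> \<rightarrow> 0; it is the
  hypothesis of Caratheodory's criterion for metric outer measures.\<close>

lemma hausdorff_outer_separated:
  assumes "0 < r" and sep: "\<And>x y. x \<in> A \<Longrightarrow> y \<in> B \<Longrightarrow> r \<le> dist x y" and s: "0 \<le> s"
  shows "hausdorff_outer s A + hausdorff_outer s B \<le> hausdorff_outer s (A \<union> B)"
proof (rule tendsto_le)
  show "((\<lambda>\<delta>. hausdorff_pre s \<delta> A + hausdorff_pre s \<delta> B) \<longlongrightarrow> hausdorff_outer s A + hausdorff_outer s B) (at_right 0)"
    by (intro tendsto_add hausdorff_outer_tendsto)
  show "((\<lambda>\<delta>. hausdorff_pre s \<delta> (A \<union> B)) \<longlongrightarrow> hausdorff_outer s (A \<union> B)) (at_right 0)"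
    by (rule hausdorff_outer_tendsto)
  have "eventually (\<lambda>\<delta>. \<delta> \<in> {0<..<r}) (at_right 0)"
    using assms(1) by (rule eventually_at_right_real)
  then show "\<forall>\<^sub>F \<delta> in at_right 0. hausdorff_pre s \<delta> A + hausdorff_pre s \<delta> B \<le> hausdorff_pre s \<delta> (A \<union> B)"
    by eventually_elim (rule hausdorff_pre_separated[OF _ sep s], auto)
qed auto

lemma hausdorff_outer_mono: "A \<subseteq> B \<Longrightarrow> hausdorff_outer s A \<le> hausdorff_outer s B"
  using outer_measure_space_hausdorff[of s]
  by (auto simp: outer_measure_space_def increasing_def)

lemma hausdorff_outer_empty [simp]: "hausdorff_outer s {} = 0"
  using outer_measure_space_hausdorff[of s]
  by (auto simp: outer_measure_space_def positive_def)

lemma hausdorff_outer_UN: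
  fixes A :: "nat \<Rightarrow> 'a::metric_space set"
  shows "hausdorff_outer s (\<Union>i. A i) \<le> (\<Sum>i. hausdorff_outer s (A i))"
  unfolding hausdorff_outer_def
  by (rule SUP_least, rule order_trans[OF hausdorff_pre_countably_subadditive])
     (auto intro!: suminf_le SUP_upper)

lemma hausdorff_outer_Un: "hausdorff_outer s (A \<union> B) \<le> hausdorff_outer s A + hausdorff_outer s B"
proof -
  have "hausdorff_outer s (A \<union> B) \<le> hausdorff_outer s (\<Union>i. if i = (0::nat) then A else if i = 1 then B else {})"
    by (rule hausdorff_outer_mono) (auto split: if_splits intro: exI[of _ 0] exI[of _ 1])
  also have "\<dots> \<le> (\<Sum>i. hausdorff_outer s (if i = (0::nat) then A else if i = 1 then B else {}))"
    by (rule hausdorff_outer_UN)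
  also have "\<dots> = (\<Sum>i\<in>{0,1}. hausdorff_outer s (if i = (0::nat) then A else if i = 1 then B else {}))"
    by (rule suminf_finite) auto
  finally show ?thesis by simp
qed

text \<open>Caratheodory's criterion: the annuli of even, respectively odd, index around \<open>C\<close> are
  separated from each other, so the total measure of all annuli is finite and their tail vanishes.\<close>

lemma closed_in_sets_hausdorff:
  fixes C :: "'a::metric_space set"
  assumes C: "closed C" and s: "0 \<le> s"
  shows "C \<in> sets (hausdorff s)"
proof (cases "C = {}")
  case False
  let ?\<mu> = "hausdorff_outer s :: 'a set \<Rightarrow> ennreal"
  have pos: "0 < infdist x C" if "x \<notin> C" for x
    using that C False by (metis in_closed_iff_infdist_zero infdist_nonneg order_le_less)
  have infd: "infdist x C \<le> infdist y C + dist x y" for x y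
    by (metis infdist_triangle)
  have "?\<mu> (A \<inter> C) + ?\<mu> (A - C) \<le> ?\<mu> A" for A
  proof (cases "?\<mu> A = \<infinity>")
    case fin: False
    define T where "T = (\<lambda>n::nat. {x\<in>A. 1 / real (n + 1) \<le> infdist x C})"
    define R where "R = (\<lambda>n::nat. {x\<in>A. 1 / real (n + 2) \<le> infdist x C \<and> infdist x C < 1 / real (n + 1)})"
    have RA: "R n \<subseteq> A" for n by (auto simp: R_def)
    \<comment> \<open>\<open>e\<close> is the parity of the indices: neighbouring annuli may touch,
      those of equal parity are separated.\<close>
    have half: "(\<Sum>k<m. ?\<mu> (R (2 * k + e))) \<le> ?\<mu> A" for m and e :: nat
    proof -
      have "(\<Sum>k<m. ?\<mu> (R (2 * k + e))) \<le> ?\<mu> (\<Union>k<m. R (2 * k + e))"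
      proof (induction m)
        case (Suc m)
        let ?U = "\<Union>k<m. R (2 * k + e)"
        \<comment> \<open>Points of \<open>?U\<close> have distance at least
          \<open>1 / (2m + e)\<close> from \<open>C\<close>, points of the new annulus less than
          \<open>1 / (2m + e + 1)\<close>. At \<open>m = 0\<close>, \<open>e = 0\<close> the
          quotient \<open>1 / 0 = 0\<close> would make the gap negative, hence the separate
          case.\<close>
        let ?r = "1 / real (2 * m + e) - 1 / real (2 * m + e + 1)"
        show ?case
        proof (cases "m = 0")
          case False
          have "(\<Sum>k<Suc m. ?\<mu> (R (2 * k + e))) \<le> ?\<mu> ?U + ?\<mu> (R (2 * m + e))"
            using Suc.IH by (simp add: add_mono)
          also have "\<dots> \<le> ?\<mu> (?U \<union> R (2 * m + e))"
          proof (rule hausdorff_outer_separated[where r = ?r, OF _ _ s])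
            have "1 / real (2 * m + e + 1) < 1 / real (2 * m + e)"
              using False by (intro divide_strict_left_mono) auto
            then show "0 < ?r" by simp
            fix x y assume "x \<in> ?U" and y: "y \<in> R (2 * m + e)"
            then obtain k where k: "k < m" "x \<in> R (2 * k + e)" by auto
            have "1 / real (2 * m + e) \<le> 1 / real (2 * k + e + 2)"
              using k by (intro divide_left_mono) auto
            also have "\<dots> \<le> infdist x C" using k(2) by (simp add: R_def)
            finally show "?r \<le> dist x y" using y infd[of x y] by (simp add: R_def)
          qed
          also have "?U \<union> R (2 * m + e) = (\<Union>k<Suc m. R (2 * k + e))"
            by (auto simp: lessThan_Suc)
          finally show ?thesis .
        qed (simp add: lessThan_Suc)
      qed simp
      also have "\<dots> \<le> ?\<mu> A" using RA by (intro hausdorff_outer_mono) auto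
      finally show ?thesis .
    qed
    have split: "(\<Sum>k<2*m. f k) = (\<Sum>k<m. f (2*k)) + (\<Sum>k<m. f (2*k+1))" for m and f :: "nat \<Rightarrow> ennreal"
      by (induction m) (auto simp: ac_simps)
    have "(\<Sum>k<n. ?\<mu> (R k)) \<le> ?\<mu> A + ?\<mu> A" for n
    proof -
      have "(\<Sum>k<n. ?\<mu> (R k)) \<le> (\<Sum>k<2*n. ?\<mu> (R k))" by (intro sum_mono2) auto
      also have "\<dots> \<le> ?\<mu> A + ?\<mu> A"
        unfolding split using half[of 0 n] half[of 1 n] by (intro add_mono) auto
      finally show ?thesis .
    qed
    then have sumle: "(\<Sum>k. ?\<mu> (R k)) \<le> ?\<mu> A + ?\<mu> A"
      by (intro suminf_le_const) auto
    then have "(\<Sum>k. ?\<mu> (R k)) < top"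
      using fin by (metis ennreal_add_eq_top infinity_ennreal_def le_less_trans less_top)
    moreover from this have Rfin: "?\<mu> (R k) = ennreal (enn2real (?\<mu> (R k)))" for k
      using ennreal_suminf_lessD by (metis ennreal_enn2real)
    ultimately have "(\<Sum>k. ennreal (enn2real (?\<mu> (R k)))) < top" by simp
    then have summ: "summable (\<lambda>k. enn2real (?\<mu> (R k)))"
      by (intro summable_suminf_not_top) auto
    show ?thesis
    proof (rule ennreal_le_epsilon)
      fix e :: real assume "0 < e"
      from suminf_exist_split[OF this summ] obtain n
        where n: "norm (\<Sum>i. enn2real (?\<mu> (R (i + n)))) < e" by blast
      have "(\<Sum>i. ?\<mu> (R (i + n))) = (\<Sum>i. ennreal (enn2real (?\<mu> (R (i + n)))))"
        using Rfin by simp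
      also have "\<dots> = ennreal (\<Sum>i. enn2real (?\<mu> (R (i + n))))"
        using summ by (intro suminf_ennreal2) (auto intro: summable_ignore_initial_segment)
      also have "\<dots> \<le> ennreal e" using n by (intro ennreal_leI) auto
      finally have tail: "(\<Sum>i. ?\<mu> (R (i + n))) \<le> ennreal e" .
      have sub: "A - C \<subseteq> T n \<union> (\<Union>i. R (i + n))"
      proof
        fix x assume x: "x \<in> A - C"
        show "x \<in> T n \<union> (\<Union>i. R (i + n))"
        proof (cases "x \<in> T n")
          case False
          \<comment> \<open>The first threshold \<open>1 / (k + 1)\<close> not exceeding the
            distance to \<open>C\<close> locates \<open>x\<close>: it lies in the annulus just
            before, whose index is at least \<open>n\<close> because \<open>x\<close> is outside
            \<open>T n\<close>.\<close>
          define P where "P = (\<lambda>k. 1 / real (k + 1) \<le> infdist x C)"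
          have "\<exists>k. P k"
            using pos[of x] x real_arch_inverse[of "infdist x C"]
            unfolding P_def by (metis DiffD2 Suc_eq_plus1 Suc_pred' inverse_eq_divide less_imp_le neq0_conv)
          then have L: "P (LEAST k. P k)" by (rule LeastI_ex)
          define l where "l = (LEAST k. P k)"
          have "l > n"
          proof (rule ccontr)
            assume "\<not> l > n"
            then have "1 / real (n + 1) \<le> 1 / real (l + 1)" by (intro divide_left_mono) auto
            then have "P n" using L unfolding l_def P_def by linarith
            then show False using False x by (simp add: T_def P_def)
          qed
          then have "l - 1 < l" by simp
          then have "\<not> P (l - 1)" unfolding l_def by (rule not_less_Least)
          then have "x \<in> R (l - 1)"
            using L \<open>l > n\<close> x unfolding l_def[symmetric] by (simp add: R_def P_def)
          moreover have "l - 1 = (l - 1 - n) + n" using \<open>l > n\<close> by simp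
          ultimately show ?thesis by (metis UNIV_I UN_I UnI2)
        qed simp
      qed
      have "?\<mu> (A - C) \<le> ?\<mu> (T n) + ?\<mu> (\<Union>i. R (i + n))"
        by (rule order_trans[OF hausdorff_outer_mono[OF sub] hausdorff_outer_Un])
      also have "\<dots> \<le> ?\<mu> (T n) + ennreal e"
        by (intro add_left_mono order_trans[OF hausdorff_outer_UN tail])
      finally have "?\<mu> (A \<inter> C) + ?\<mu> (A - C) \<le> (?\<mu> (A \<inter> C) + ?\<mu> (T n)) + ennreal e"
        by (simp add: add.assoc add_left_mono)
      also have "?\<mu> (A \<inter> C) + ?\<mu> (T n) \<le> ?\<mu> ((A \<inter> C) \<union> T n)"
      proof (rule hausdorff_outer_separated[where r = "1 / real (n + 1)", OF _ _ s])
        fix x y assume "x \<in> A \<inter> C" "y \<in> T n"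
        then show "1 / real (n + 1) \<le> dist x y"
          using infd[of y x] by (simp add: T_def dist_commute)
      qed simp
      also have "\<dots> \<le> ?\<mu> A" by (rule hausdorff_outer_mono) (auto simp: T_def)
      finally show "?\<mu> (A \<inter> C) + ?\<mu> (A - C) \<le> ?\<mu> A + ennreal e"
        by (simp add: add_right_mono)
    qed
  qed simp
  moreover have "?\<mu> A \<le> ?\<mu> (A \<inter> C) + ?\<mu> (A - C)" for A
    using hausdorff_outer_Un[of s "A \<inter> C" "A - C"] by (simp add: Int_Diff_Un)
  ultimately show ?thesis
    unfolding sets_hausdorff
    by (subst algebra.lambda_system_eq[OF algebra_Pow]) (auto intro: antisym)
qed (metis sets.empty_sets)

lemma sets_borel_le_hausdorff:
  assumes "0 \<le> s" shows "sets borel \<subseteq> sets (hausdorff s)"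
proof -
  have "sets borel = sigma_sets UNIV (Collect closed)"
    by (simp add: borel_eq_closed)
  also have "\<dots> \<subseteq> sets (hausdorff s)"
    using sets.sigma_sets_subset[of "Collect closed" "hausdorff s"] closed_in_sets_hausdorff[OF _ assms]
    by auto
  finally show ?thesis .
qed

lemma borel_measurable_hausdorff:
  assumes "f \<in> borel_measurable borel" "0 \<le> s"
  shows "f \<in> measurable (hausdorff s) borel"
  using assms sets_borel_le_hausdorff[of s] by (auto simp: measurable_def)

section \<open>Approximation from above by Lipschitz functions\<close>

text \<open>Carrying the inner closed set and the outer open set together makes the property
  symmetric under complements, so it passes through induction over the sigma-algebra generated by
  the closed sets. \<open>M\<close> may measure more than Borel sets, as \<open>hausdorff\<close>
  does.\<close>

lemma regular_borel:
  fixes M :: "'a::metric_space measure"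
  assumes fin: "emeasure M UNIV < \<infinity>" and bor: "sets borel \<subseteq> sets M"
    and B: "B \<in> sets borel" and "0 < (e::real)"
  shows "\<exists>U C. open U \<and> closed C \<and> C \<subseteq> B \<and> B \<subseteq> U \<and> emeasure M (U - C) < ennreal e"
proof -
  have "UNIV \<in> sets M" using bor by (rule subsetD) simp
  then have sp: "space M = UNIV" using sets.sets_into_space[of UNIV M] by auto
  interpret finite_measure M
    by standard (use fin sp in auto)
  have opS [simp, intro]: "open A \<Longrightarrow> A \<in> sets M" and clS [simp, intro]: "closed A \<Longrightarrow> A \<in> sets M" for A
    using bor by auto
  have "B \<in> sigma_sets UNIV (Collect closed)"
    using B by (simp add: borel_eq_closed)
  then show ?thesis using \<open>0 < e\<close>
  proof (induction arbitrary: e)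
    case (Basic C)
    show ?case
    proof (cases "C = {}")
      case False
      have C: "closed C" using Basic by simp
      define U where "U = (\<lambda>n::nat. {x. infdist x C < 1 / real (n + 1)})"
      have opU: "open (U n)" for n
        unfolding U_def by (intro open_Collect_less continuous_intros)
      have CU: "C \<subseteq> U n" for n
        by (auto simp: U_def)
      have "(\<Inter>n. U n - C) = {}"
      proof safe
        fix x assume x: "x \<in> (\<Inter>n. U n - C)"
        then have "0 < infdist x C"
          using C False by (metis DiffD2 INT_iff UNIV_I in_closed_iff_infdist_zero infdist_nonneg order_le_less)
        then obtain n where "inverse (real (Suc n)) < infdist x C"
          using reals_Archimedean by blast
        moreover have "infdist x C < inverse (real (Suc n))"
          using x by (force simp: U_def inverse_eq_divide)
        ultimately show "x \<in> {}" by simp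
      qed
      moreover have "(\<lambda>n. emeasure M (U n - C)) \<longlonglongrightarrow> emeasure M (\<Inter>n. U n - C)"
      proof (rule Lim_emeasure_decseq)
        show "range (\<lambda>n. U n - C) \<subseteq> sets M" using opU C by auto
        have "1 / real (n + 1) \<le> 1 / real (m + 1)" if "m \<le> n" for m n
          using that by (intro divide_left_mono) auto
        then show "decseq (\<lambda>n. U n - C)"
          unfolding decseq_def U_def by (auto intro: less_le_trans)
      qed auto
      ultimately have "(\<lambda>n. emeasure M (U n - C)) \<longlonglongrightarrow> 0" by (simp only: emeasure_empty)
      then have "\<forall>\<^sub>F n in sequentially. emeasure M (U n - C) < ennreal e"
        using Basic(2) by (intro order_tendstoD(2)) auto
      then obtain n where "emeasure M (U n - C) < ennreal e"
        by (auto simp: eventually_sequentially)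
      then show ?thesis using opU CU C by blast
    qed (use Basic in \<open>auto intro!: exI[of _ "{}"]\<close>)
  next
    case Empty
    then show ?case by (auto intro!: exI[of _ "{}"])
  next
    case (Compl A)
    from Compl.IH[OF Compl.prems] obtain U C where
      *: "open U" "closed C" "C \<subseteq> A" "A \<subseteq> U" "emeasure M (U - C) < ennreal e" by blast
    have "- C - - U = U - C" by auto
    then show ?case
      using * by (intro exI[of _ "- C"] exI[of _ "- U"]) (auto simp: open_Compl closed_Compl)
  next
    case (Union A)
    \<comment> \<open>Half of the budget goes to the countable union; the other half absorbs the
      passage to the finite unions \<open>K n\<close>, which stay closed.\<close>
    have "\<exists>U C. open U \<and> closed C \<and> C \<subseteq> A i \<and> A i \<subseteq> U \<and> emeasure M (U - C) < ennreal (e / 2 * (1/2) ^ Suc i)" for i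
      by (rule Union.IH) (use Union.prems in simp)
    then obtain U C where UC: "\<And>i. open (U i)" "\<And>i. closed (C i)" "\<And>i. C i \<subseteq> A i" "\<And>i. A i \<subseteq> U i"
      and em: "\<And>i. emeasure M (U i - C i) < ennreal (e / 2 * (1/2) ^ Suc i)"
      by metis
    define V where "V = (\<Union>i. U i)"
    define K where "K = (\<lambda>n. \<Union>i<n. C i)"
    have opV: "open V" unfolding V_def using UC by auto
    have clK: "closed (K n)" for n unfolding K_def using UC by auto
    have lim: "(\<lambda>n. emeasure M (V - K n)) \<longlonglongrightarrow> emeasure M (\<Inter>n. V - K n)"
    proof (rule Lim_emeasure_decseq)
      show "range (\<lambda>n. V - K n) \<subseteq> sets M" using opV clK by auto
      show "decseq (\<lambda>n. V - K n)"
        unfolding decseq_def K_def by (intro allI impI Diff_mono UN_mono) auto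
    qed auto
    have "emeasure M (\<Inter>n. V - K n) \<le> emeasure M (\<Union>i. U i - C i)"
    proof (rule emeasure_mono)
      show "(\<Inter>n. V - K n) \<subseteq> (\<Union>i. U i - C i)"
      proof
        fix x assume x: "x \<in> (\<Inter>n. V - K n)"
        then obtain i where i: "x \<in> U i" unfolding V_def by blast
        have "x \<notin> K (Suc i)" using x by blast
        then have "x \<notin> C i" unfolding K_def by blast
        with i show "x \<in> (\<Union>i. U i - C i)" by blast
      qed
      show "(\<Union>i. U i - C i) \<in> sets M" using UC by (intro sets.countable_UN) auto
    qed
    also have "\<dots> \<le> (\<Sum>i. emeasure M (U i - C i))"
      using UC by (intro emeasure_subadditive_countably) auto
    also have "\<dots> \<le> (\<Sum>i. ennreal (e / 2 * (1/2) ^ Suc i))"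
      using em by (intro suminf_le) (auto intro: less_imp_le)
    also have "\<dots> = ennreal (e / 2)"
    proof (rule suminf_ennreal_eq)
      show "(\<lambda>n. e / 2 * (1/2) ^ Suc n) sums (e / 2)"
        using sums_mult[OF power_half_series, of "e / 2"] by simp
    qed (use Union.prems in auto)
    also have "\<dots> < ennreal e" using Union.prems by (simp add: ennreal_less_iff)
    finally have "\<forall>\<^sub>F n in sequentially. emeasure M (V - K n) < ennreal e"
      by (rule order_tendstoD(2)[OF lim])
    then obtain n where n: "emeasure M (V - K n) < ennreal e"
      by (auto simp: eventually_sequentially)
    have "K n \<subseteq> (\<Union>i. A i)" unfolding K_def using UC(3) by auto
    moreover have "(\<Union>i. A i) \<subseteq> V" unfolding V_def using UC(4) by (intro UN_mono) auto
    ultimately show ?case using n opV clK by (intro exI[of _ V] exI[of _ "K n"] conjI)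
  qed
qed

section \<open>Powers of extended nonnegative numbers\<close>

lemma ennpow_ennreal: "0 \<le> x \<Longrightarrow> ennpow (ennreal x) r = ennreal (x powr r)"
  by (simp add: ennpow_def)

lemma ennpow_top [simp]: "ennpow \<infinity> r = \<infinity>" "ennpow top r = \<infinity>"
  by (simp_all add: ennpow_def)

lemma ennpow_zero [simp]: "ennpow 0 r = 0"
  by (simp add: ennpow_def)

lemma ennpow_one [simp]: "ennpow x 1 = x"
  by (cases x) (simp_all add: ennpow_def)

lemma ennpow_mono: "x \<le> y \<Longrightarrow> 0 \<le> r \<Longrightarrow> ennpow x r \<le> ennpow y r"
  by (cases x; cases y) (auto simp: ennpow_ennreal top_unique intro!: ennreal_leI powr_mono2)

lemma ennpow_ennpow: "0 < r \<Longrightarrow> 0 < s \<Longrightarrow> ennpow (ennpow x r) s = ennpow x (r * s)"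
  by (cases x) (auto simp: ennpow_ennreal powr_powr)

lemma ennpow_mult: "0 < r \<Longrightarrow> ennpow (x * y) r = ennpow x r * ennpow y r"
proof (cases x; cases y)
  fix a assume "0 < r" "x = top" "y = ennreal a" "0 \<le> a"
  then show ?thesis
    by (cases "a = 0") (auto simp: ennpow_ennreal ennreal_top_mult)
next
  fix a assume "0 < r" "x = ennreal a" "y = top" "0 \<le> a"
  then show ?thesis
    by (cases "a = 0") (auto simp: ennpow_ennreal ennreal_mult_top)
qed (auto simp: ennpow_ennreal ennreal_mult[symmetric] powr_mult)

lemma ennpow_measurable [measurable]:
  assumes [measurable]: "f \<in> borel_measurable M"
  shows "(\<lambda>x. ennpow (f x) r) \<in> borel_measurable M"
  unfolding ennpow_def by measurable

text \<open>Substitute for Minkowski's inequality for series: if \<open>T\<close> is the right-hand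
  side, each \<open>2 ^ Suc k * a k\<close> is at most \<open>T\<close> to the power
  \<open>1 / p\<close>, and the weights \<open>(1/2) ^ Suc k\<close> sum to 1.\<close>

lemma ennpow_suminf_le:
  assumes "0 < p"
  shows "ennpow (\<Sum>k. a k) p \<le> (\<Sum>k. ennpow (2 ^ Suc k * a k) p)"
proof -
  define T where "T = (\<Sum>k. ennpow (2 ^ Suc k * a k) p)"
  have "a k \<le> ennpow T (1 / p) * ennreal ((1/2) ^ Suc k)" for k
  proof -
    have "ennpow (2 ^ Suc k * a k) p \<le> T"
      unfolding T_def using sum_le_suminf[of "\<lambda>k. ennpow (2 ^ Suc k * a k) p" "{k}"] by simp
    then have "ennpow (ennpow (2 ^ Suc k * a k) p) (1 / p) \<le> ennpow T (1 / p)"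
      using assms by (intro ennpow_mono) auto
    then have "2 ^ Suc k * a k \<le> ennpow T (1 / p)"
      using assms by (simp add: ennpow_ennpow)
    then have "2 ^ Suc k * a k * ennreal ((1/2) ^ Suc k) \<le> ennpow T (1 / p) * ennreal ((1/2) ^ Suc k)"
      by (rule mult_right_mono) simp
    moreover have "2 ^ Suc k * ennreal ((1/2) ^ Suc k) = 1"
    proof -
      have "(2::ennreal) ^ Suc k = ennreal (2 ^ Suc k)"
        by (subst ennreal_power[symmetric]) auto
      moreover have "ennreal (2 ^ Suc k * (1/2) ^ Suc k) = ennreal (2 ^ Suc k) * ennreal ((1/2) ^ Suc k)"
        by (rule ennreal_mult'') simp
      ultimately have "2 ^ Suc k * ennreal ((1/2) ^ Suc k) = ennreal (2 ^ Suc k * (1/2) ^ Suc k)"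
        by (simp only:)
      also have "2 ^ Suc k * (1/2) ^ Suc k = (1::real)"
        by (simp add: power_mult_distrib[symmetric])
      finally show ?thesis by simp
    qed
    moreover have "2 ^ Suc k * a k * ennreal ((1/2) ^ Suc k) = (2 ^ Suc k * ennreal ((1/2) ^ Suc k)) * a k"
      by (simp only: mult_ac)
    ultimately show ?thesis by (simp only: mult_1)
  qed
  then have "(\<Sum>k. a k) \<le> (\<Sum>k. ennpow T (1 / p) * ennreal ((1/2) ^ Suc k))"
    by (intro suminf_le) auto
  also have "\<dots> = ennpow T (1 / p)"
    unfolding ennreal_suminf_cmult
    by (subst suminf_ennreal_eq[OF _ power_half_series]) auto
  finally have "ennpow (\<Sum>k. a k) p \<le> ennpow (ennpow T (1 / p)) p"
    using assms by (intro ennpow_mono) auto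
  then show ?thesis using assms by (simp add: ennpow_ennpow T_def)
qed

section \<open>Staircase sums over levels\<close>

text \<open>The staircase counts the levels \<open>k * c\<close> below \<open>r\<close>, level 0
  included, so it rounds \<open>r\<close> up to a multiple of \<open>c\<close>; cutting off after
  \<open>n\<close> levels produces the minimum.\<close>

lemma level_sum_ge:
  assumes "0 < c"
  shows "min r (ennreal (real n * c)) \<le> (\<Sum>k<n. if ennreal (real k * c) < r then ennreal c else 0)"
proof (induction n)
  case (Suc n)
  let ?S = "\<Sum>k<n. if ennreal (real k * c) < r then ennreal c else 0"
  have eq: "ennreal (real (Suc n) * c) = ennreal (real n * c) + ennreal c"
    using assms by (simp add: algebra_simps flip: ennreal_plus)
  show ?case
  proof (cases "ennreal (real n * c) < r")
    case True
    then have "ennreal (real n * c) \<le> ?S" using Suc.IH by (simp add: min_def split: if_splits)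
    then have "ennreal (real n * c) + ennreal c \<le> ?S + ennreal c" by (rule add_right_mono)
    then show ?thesis using True unfolding eq by (simp add: min.coboundedI2)
  next
    case False
    then have "r \<le> ?S" using Suc.IH by (simp add: min_def not_less split: if_splits)
    then show ?thesis using False by (simp add: min.coboundedI1)
  qed
qed simp

lemma level_sum_le:
  assumes "0 < c"
  shows "(\<Sum>k<n. if ennreal (real k * c) < r then ennreal c else 0) \<le> min (ennreal (real n * c)) (r + ennreal c)"
proof (induction n)
  case (Suc n)
  let ?S = "\<Sum>k<n. if ennreal (real k * c) < r then ennreal c else 0"
  have eq: "ennreal (real (Suc n) * c) = ennreal (real n * c) + ennreal c"
    using assms by (simp add: algebra_simps flip: ennreal_plus)
  show ?case
  proof (cases "ennreal (real n * c) < r")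
    case True
    have "?S + ennreal c \<le> ennreal (real n * c) + ennreal c"
      using Suc.IH by (intro add_right_mono) simp
    moreover have "ennreal (real n * c) + ennreal c \<le> r + ennreal c"
      using True by (intro add_right_mono) simp
    ultimately show ?thesis using True unfolding eq by simp
  next
    case False
    then show ?thesis using Suc.IH unfolding eq by (simp add: add_increasing2)
  qed
qed simp

text \<open>\<^term>\<open>infdist x {}\<close> is 0, hence the separate case \<open>U = UNIV\<close>.\<close>

definition open_approx :: "'a::metric_space set \<Rightarrow> nat \<Rightarrow> 'a \<Rightarrow> real" where
  "open_approx U n x = (if U = UNIV then 1 else min 1 (real n * infdist x (- U)))"

lemma open_approx_nonneg: "0 \<le> open_approx U n x"
  by (simp add: open_approx_def infdist_nonneg)

lemma open_approx_le_indicator: "open_approx U n x \<le> indicator U x"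
  by (auto simp: open_approx_def indicator_def)

lemma open_approx_mono: "m \<le> n \<Longrightarrow> open_approx U m x \<le> open_approx U n x"
  unfolding open_approx_def
  using mult_right_mono[of "real m" "real n" "infdist x (- U)"] infdist_nonneg[of x "- U"] by auto

lemma open_approx_eventually:
  assumes "open U" "x \<in> U"
  shows "\<forall>\<^sub>F n in sequentially. open_approx U n x = 1"
proof (cases "U = UNIV")
  case False
  then have "0 < infdist x (- U)"
    using assms in_closed_iff_infdist_zero[of "- U" x] infdist_nonneg[of x "- U"]
    by (auto simp: less_le)
  then obtain n where n: "1 < real n * infdist x (- U)" using reals_Archimedean3 by blast
  have "open_approx U m x = 1" if "n \<le> m" for m
  proof -
    have "real n * infdist x (- U) \<le> real m * infdist x (- U)"
      using that by (intro mult_right_mono infdist_nonneg) auto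
    then show ?thesis using n False by (simp add: open_approx_def)
  qed
  then show ?thesis by (auto simp: eventually_sequentially)
qed (simp add: open_approx_def)

lemma open_approx_lipschitz: "(real n)-lipschitz_on UNIV (open_approx U n)"
proof (rule lipschitz_onI)
  fix x y
  have *: "\<bar>infdist x (- U) - infdist y (- U)\<bar> \<le> dist x y"
    using infdist_triangle[of x "- U" y] infdist_triangle[of y "- U" x] by (auto simp: dist_commute)
  have "\<bar>real n * infdist x (- U) - real n * infdist y (- U)\<bar> \<le> real n * dist x y"
    using mult_left_mono[OF *, of "real n"] by (simp add: right_diff_distrib[symmetric] abs_mult)
  moreover have "\<bar>min 1 a - min 1 b\<bar> \<le> \<bar>a - b\<bar>" for a b :: real
    by linarith
  ultimately show "dist (open_approx U n x) (open_approx U n y) \<le> real n * dist x y"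
    unfolding open_approx_def dist_real_def by (auto intro: order_trans)
qed simp

lemma lipschitz_on_sum:
  fixes f :: "'b \<Rightarrow> 'a::metric_space \<Rightarrow> real"
  assumes "finite I" "\<And>i. i \<in> I \<Longrightarrow> \<exists>L. L-lipschitz_on UNIV (f i)"
  shows "\<exists>L. L-lipschitz_on UNIV (\<lambda>x. \<Sum>i\<in>I. f i x)"
  using assms
proof (induction I)
  case empty
  have "0-lipschitz_on UNIV (\<lambda>x::'a. 0::real)" by (rule lipschitz_on_constant)
  then show ?case by auto
next
  case (insert i I)
  then obtain L' where "L'-lipschitz_on UNIV (\<lambda>x. \<Sum>i\<in>I. f i x)" by auto
  moreover obtain L where "L-lipschitz_on UNIV (f i)" using insert.prems[of i] by auto
  ultimately have "(L + L')-lipschitz_on UNIV (\<lambda>x. f i x + (\<Sum>i\<in>I. f i x))"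
    by (intro lipschitz_on_add)
  then show ?case using insert.hyps by auto
qed

text \<open>The superlevel sets \<open>{kc < f}\<close> are enlarged to open sets with a measure
  error so small that the sum of the errors is small in \<open>L\<^sup>p\<close>.\<close>

lemma vitali_caratheodory:
  fixes f :: "'a::metric_space \<Rightarrow> ennreal"
  assumes fin: "emeasure M UNIV < \<infinity>" and bor: "sets borel \<subseteq> sets M"
    and f [measurable]: "f \<in> borel_measurable borel" and p: "0 < p" and e: "0 < (e::real)" and c: "0 < c"
  obtains g :: "nat \<Rightarrow> 'a \<Rightarrow> real" and D :: "'a \<Rightarrow> ennreal"
  where "D \<in> borel_measurable borel" "(\<integral>\<^sup>+x. ennpow (D x) p \<partial>M) \<le> ennreal e"
    "\<And>n. \<exists>L. L-lipschitz_on UNIV (g n)" "\<And>n x. c \<le> g n x" "\<And>x. incseq (\<lambda>n. g n x)"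
    "\<And>n x. ennreal (g n x) \<le> f x + D x + ennreal (2 * c)"
    "\<And>x. f x + ennreal c \<le> (SUP n. ennreal (g n x))"
proof -
  define B where "B = (\<lambda>k::nat. {x. ennreal (real k * c) < f x})"
  have Bb [measurable]: "B k \<in> sets borel" for k
    unfolding B_def by measurable
  \<comment> \<open>\<open>ennpow_suminf_le\<close> multiplies the \<open>k\<close>-th term by
    \<open>2 ^ Suc k\<close>, and the term has height \<open>c\<close>; dividing by the
    \<open>p\<close>-th power of the product leaves \<open>e * (1/2) ^ Suc k\<close>.\<close>
  define \<eta> where "\<eta> = (\<lambda>k. e * (1/2) ^ Suc k / (2 ^ Suc k * c) powr p)"
  have \<eta>: "0 < \<eta> k" for k using e c by (simp add: \<eta>_def)
  have "\<exists>U. open U \<and> B k \<subseteq> U \<and> emeasure M (U - B k) \<le> ennreal (\<eta> k)" for k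
  proof -
    obtain U C where *: "open U" "closed C" "C \<subseteq> B k" "B k \<subseteq> U" "emeasure M (U - C) < ennreal (\<eta> k)"
      using regular_borel[OF fin bor Bb[of k] \<eta>[of k]] by blast
    have "emeasure M (U - B k) \<le> emeasure M (U - C)"
      using * by (intro emeasure_mono subsetD[OF bor]) auto
    then show ?thesis using * by (intro exI[of _ U]) auto
  qed
  then obtain U where U: "\<And>k. open (U k)" "\<And>k. B k \<subseteq> U k" "\<And>k. emeasure M (U k - B k) \<le> ennreal (\<eta> k)"
    by metis
  have Ub [measurable]: "U k \<in> sets borel" for k using U by auto
  define D where "D = (\<lambda>x. \<Sum>k. ennreal c * indicator (U k - B k) x)"
  \<comment> \<open>The separate summand \<open>c\<close> gives the lower bound \<open>c\<close> and
    the gain \<open>f + c\<close> in the supremum. The \<open>2 * c\<close> of the upper bound is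
    this \<open>c\<close> plus the rounding error of the staircase.\<close>
  define g where "g = (\<lambda>n x. c + (\<Sum>k<n. c * open_approx (U k) n x))"
  have gn: "0 \<le> (\<Sum>k<n. c * open_approx (U k) m x)" for n m x
    using c by (intro sum_nonneg mult_nonneg_nonneg open_approx_nonneg) auto
  show ?thesis
  proof
    show Dm: "D \<in> borel_measurable borel"
      unfolding D_def by measurable
    have pow_term: "ennpow (2 ^ Suc k * (ennreal c * indicator (U k - B k) x)) p
        = ennreal ((2 ^ Suc k * c) powr p) * indicator (U k - B k) x" for k x
    proof -
      have "(2::ennreal) ^ Suc k = ennreal (2 ^ Suc k)"
        by (subst ennreal_power[symmetric]) auto
      moreover have "ennreal (2 ^ Suc k * c) = ennreal (2 ^ Suc k) * ennreal c"
        using c by (intro ennreal_mult'') simp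
      ultimately have "2 ^ Suc k * ennreal c = ennreal (2 ^ Suc k * c)" by (simp only:)
      then show ?thesis using c by (auto simp: indicator_def ennpow_ennreal)
    qed
    have sM: "U k - B k \<in> sets M" for k by (rule subsetD[OF bor]) simp
    have "(\<integral>\<^sup>+x. ennpow (D x) p \<partial>M) \<le> (\<integral>\<^sup>+x. (\<Sum>k. ennreal ((2 ^ Suc k * c) powr p) * indicator (U k - B k) x) \<partial>M)"
    proof (rule nn_integral_mono)
      fix x
      show "ennpow (D x) p \<le> (\<Sum>k. ennreal ((2 ^ Suc k * c) powr p) * indicator (U k - B k) x)"
        using ennpow_suminf_le[OF p, of "\<lambda>k. ennreal c * indicator (U k - B k) x"]
        unfolding D_def pow_term .
    qed
    also have "\<dots> = (\<Sum>k. \<integral>\<^sup>+x. ennreal ((2 ^ Suc k * c) powr p) * indicator (U k - B k) x \<partial>M)"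
      using sM by (intro nn_integral_suminf) auto
    also have "\<dots> = (\<Sum>k. ennreal ((2 ^ Suc k * c) powr p) * emeasure M (U k - B k))"
      using sM by (simp add: nn_integral_cmult_indicator)
    also have "\<dots> \<le> (\<Sum>k. ennreal (e * (1/2) ^ Suc k))"
    proof (rule suminf_le)
      fix k
      have "ennreal ((2 ^ Suc k * c) powr p) * emeasure M (U k - B k) \<le> ennreal ((2 ^ Suc k * c) powr p) * ennreal (\<eta> k)"
        using U(3) by (rule mult_left_mono) simp
      also have "\<dots> = ennreal ((2 ^ Suc k * c) powr p * \<eta> k)"
        using \<eta>[of k] by (simp add: ennreal_mult'' less_imp_le)
      also have "(2 ^ Suc k * c) powr p * \<eta> k = e * (1/2) ^ Suc k"
        using c by (simp add: \<eta>_def)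
      finally show "ennreal ((2 ^ Suc k * c) powr p) * emeasure M (U k - B k) \<le> ennreal (e * (1/2) ^ Suc k)" .
    qed auto
    also have "\<dots> = ennreal e"
    proof (rule suminf_ennreal_eq)
      show "(\<lambda>n. e * (1/2) ^ Suc n) sums e"
        using sums_mult[OF power_half_series, of e] by simp
    qed (use e in auto)
    finally show "(\<integral>\<^sup>+x. ennpow (D x) p \<partial>M) \<le> ennreal e" .
    show "\<exists>L. L-lipschitz_on UNIV (g n)" for n
    proof -
      have "\<exists>L. L-lipschitz_on UNIV (\<lambda>x. \<Sum>k\<in>{..<n}. c * open_approx (U k) n x)"
        by (rule lipschitz_on_sum) (use lipschitz_on_cmult_real[OF open_approx_lipschitz] in blast)+
      then show ?thesis
        unfolding g_def using lipschitz_on_add[OF lipschitz_on_constant] by blast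
    qed
    show "c \<le> g n x" for n x using gn by (simp add: g_def)
    show "incseq (\<lambda>n. g n x)" for x
    proof (rule incseq_SucI)
      fix n
      have "(\<Sum>k<n. c * open_approx (U k) n x) \<le> (\<Sum>k<n. c * open_approx (U k) (Suc n) x)"
        using c by (intro sum_mono mult_left_mono open_approx_mono) auto
      also have "\<dots> \<le> (\<Sum>k<Suc n. c * open_approx (U k) (Suc n) x)"
        using c by (simp add: open_approx_nonneg)
      finally show "g n x \<le> g (Suc n) x" by (simp add: g_def)
    qed
    show "ennreal (g n x) \<le> f x + D x + ennreal (2 * c)" for n x
    proof -
      have "ennreal (g n x) \<le> ennreal (c + (\<Sum>k<n. c * indicator (U k) x))"
        unfolding g_def using c
        by (intro ennreal_leI add_left_mono sum_mono mult_left_mono open_approx_le_indicator) auto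
      also have "\<dots> = ennreal c + (\<Sum>k<n. ennreal (c * indicator (U k) x))"
        using c by (subst ennreal_plus) (auto simp: sum_ennreal intro!: sum_nonneg)
      also have "(\<Sum>k<n. ennreal (c * indicator (U k) x))
          = (\<Sum>k<n. (if ennreal (real k * c) < f x then ennreal c else 0) + ennreal c * indicator (U k - B k) x)"
        using U(2) by (intro sum.cong) (auto simp: B_def indicator_def)
      also have "\<dots> \<le> (f x + ennreal c) + D x"
        unfolding sum.distrib
      proof (rule add_mono)
        show "(\<Sum>k<n. if ennreal (real k * c) < f x then ennreal c else 0) \<le> f x + ennreal c"
          using level_sum_le[OF c, where n = n and r = "f x"] by simp
        show "(\<Sum>k<n. ennreal c * indicator (U k - B k) x) \<le> D x"
          unfolding D_def by (rule sum_le_suminf) auto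
      qed
      finally have "ennreal (g n x) \<le> f x + D x + (ennreal c + ennreal c)"
        by (simp add: ac_simps add_left_mono)
      also have "ennreal c + ennreal c = ennreal (2 * c)"
        using c by (simp flip: ennreal_plus)
      finally show ?thesis .
    qed
    show "f x + ennreal c \<le> (SUP n. ennreal (g n x))" for x
    proof -
      \<comment> \<open>With \<open>N\<close> levels fixed, finitely many approximations have to
        reach 1 at \<open>x\<close>, which happens for one common \<open>n\<close>; \<open>N\<close>
        tends to infinity afterwards.\<close>
      have *: "min (f x) (ennreal (real N * c)) + ennreal c \<le> (SUP n. ennreal (g n x))" for N
      proof -
        have "\<forall>\<^sub>F n in sequentially. x \<in> U k \<longrightarrow> open_approx (U k) n x = 1" for k
          using open_approx_eventually[OF U(1)] by (cases "x \<in> U k") auto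
        then have "\<forall>\<^sub>F n in sequentially. \<forall>k\<in>{..<N}. x \<in> U k \<longrightarrow> open_approx (U k) n x = 1"
          by (intro eventually_ball_finite) auto
        moreover have "\<forall>\<^sub>F n in sequentially. N \<le> n" by (rule eventually_ge_at_top)
        ultimately have "\<forall>\<^sub>F n in sequentially. N \<le> n \<and> (\<forall>k<N. x \<in> U k \<longrightarrow> open_approx (U k) n x = 1)"
          by eventually_elim auto
        then obtain n where n: "N \<le> n" "\<And>k. k < N \<Longrightarrow> x \<in> U k \<Longrightarrow> open_approx (U k) n x = 1"
          by (auto simp: eventually_sequentially)
        have "min (f x) (ennreal (real N * c)) \<le> (\<Sum>k<N. if ennreal (real k * c) < f x then ennreal c else 0)"
          by (rule level_sum_ge[OF c])
        also have "\<dots> \<le> (\<Sum>k<N. ennreal (c * open_approx (U k) n x))"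
        proof (rule sum_mono)
          fix k assume "k \<in> {..<N}"
          then show "(if ennreal (real k * c) < f x then ennreal c else 0) \<le> ennreal (c * open_approx (U k) n x)"
            using n(2)[of k] U(2)[of k] by (auto simp: B_def)
        qed
        also have "\<dots> \<le> (\<Sum>k<n. ennreal (c * open_approx (U k) n x))"
          using n by (intro sum_mono2) auto
        finally have "min (f x) (ennreal (real N * c)) + ennreal c
            \<le> (\<Sum>k<n. ennreal (c * open_approx (U k) n x)) + ennreal c"
          by (rule add_right_mono)
        also have "\<dots> = ennreal (g n x)"
          unfolding g_def using c gn
          by (subst ennreal_plus) (auto simp: sum_ennreal open_approx_nonneg add.commute)
        also have "\<dots> \<le> (SUP n. ennreal (g n x))" by (rule SUP_upper) simp
        finally show ?thesis .
      qed
      have "(\<lambda>N. min (f x) (ennreal (real N * c)) + ennreal c) \<longlonglongrightarrow> min (f x) top + ennreal c"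
      proof (intro tendsto_intros tendsto_min)
        have "filterlim (\<lambda>N. c * real N) at_top sequentially"
          by (rule filterlim_tendsto_pos_mult_at_top[OF tendsto_const c filterlim_real_sequentially])
        then have "filterlim (\<lambda>N. real N * c) at_top sequentially"
          by (simp add: mult.commute)
        then show "(\<lambda>N. ennreal (real N * c)) \<longlonglongrightarrow> top"
          by (simp only: ennreal_tendsto_top_eq_at_top)
      qed
      then have "min (f x) top + ennreal c \<le> (SUP n. ennreal (g n x))"
        by (rule LIMSEQ_le_const2) (use * in auto)
      then show ?thesis by simp
    qed
  qed
qed

section \<open>Lengths and line integrals of Lipschitz curves\<close>

lemma curve_length_ge:
  assumes "t 0 = a" "t n = b" "mono_on {..n} t"
  shows "(\<Sum>i<n. ennreal (dist (\<gamma> (t i)) (\<gamma> (t (Suc i))))) \<le> curve_length (\<gamma>, a, b)"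
  unfolding curve_length_def using assms
  by (auto intro!: SUP_upper2[of "(n, t)"])

lemma curve_length_le:
  assumes "\<And>n t. t 0 = a \<Longrightarrow> t n = b \<Longrightarrow> mono_on {..n} t \<Longrightarrow>
    (\<Sum>i<n. ennreal (dist (\<gamma> (t i)) (\<gamma> (t (Suc i))))) \<le> B"
  shows "curve_length (\<gamma>, a, b) \<le> B"
  unfolding curve_length_def using assms by (auto intro!: SUP_least)

lemma dist_le_curve_length:
  assumes "a \<le> b"
  shows "ennreal (dist (\<gamma> a) (\<gamma> b)) \<le> curve_length (\<gamma>, a, b)"
proof -
  define t where "t = (\<lambda>i::nat. if i = 0 then a else b)"
  have "mono_on {..1} t" using assms by (auto simp: t_def mono_on_def)
  then have "(\<Sum>i<1. ennreal (dist (\<gamma> (t i)) (\<gamma> (t (Suc i))))) \<le> curve_length (\<gamma>, a, b)"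
    by (intro curve_length_ge) (auto simp: t_def)
  then show ?thesis by (simp add: t_def)
qed

text \<open>Appending \<open>c\<close> to a subdivision of \<open>[a, b]\<close> adds one chord.
  Applied to the length function, this turns length increments into bounds for distances.\<close>

lemma curve_length_extend:
  assumes "a \<le> b" "b \<le> c"
  shows "curve_length (\<gamma>, a, b) + ennreal (dist (\<gamma> b) (\<gamma> c)) \<le> curve_length (\<gamma>, a, c)"
proof -
  let ?d = "ennreal (dist (\<gamma> b) (\<gamma> c))"
  have *: "(\<Sum>i<n. ennreal (dist (\<gamma> (t i)) (\<gamma> (t (Suc i))))) + ?d \<le> curve_length (\<gamma>, a, c)"
    if t: "t 0 = a" "t n = b" "mono_on {..n} t" for n and t :: "nat \<Rightarrow> real"
  proof -
    define t' where "t' = (\<lambda>i. if i \<le> n then t i else c)"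
    have tc: "t i \<le> c" if "i \<le> n" for i
      using t that \<open>b \<le> c\<close> mono_onD[OF t(3), of i n] by auto
    have "mono_on {..Suc n} t'"
      using mono_onD[OF t(3)] tc by (auto simp: t'_def mono_on_def)
    then have "(\<Sum>i<Suc n. ennreal (dist (\<gamma> (t' i)) (\<gamma> (t' (Suc i))))) \<le> curve_length (\<gamma>, a, c)"
      by (intro curve_length_ge) (use t in \<open>auto simp: t'_def\<close>)
    moreover have "(\<Sum>i<Suc n. ennreal (dist (\<gamma> (t' i)) (\<gamma> (t' (Suc i)))))
        = (\<Sum>i<n. ennreal (dist (\<gamma> (t i)) (\<gamma> (t (Suc i))))) + ?d"
      using t by (simp add: t'_def)
    ultimately show ?thesis by simp
  qed
  \<comment> \<open>Subtraction in \<open>ennreal\<close> is cut off at 0, so adding the chord back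
    requires that it be no longer than the whole curve.\<close>
  have "?d \<le> curve_length (\<gamma>, a, c)"
  proof -
    define t where "t = (\<lambda>i::nat. if i = 0 then a else b)"
    have "(\<Sum>i<1. ennreal (dist (\<gamma> (t i)) (\<gamma> (t (Suc i))))) + ?d \<le> curve_length (\<gamma>, a, c)"
      by (rule *) (use assms in \<open>auto simp: t_def mono_on_def\<close>)
    then show ?thesis by (auto intro: order_trans[rotated])
  qed
  moreover have "curve_length (\<gamma>, a, b) \<le> curve_length (\<gamma>, a, c) - ?d"
    by (rule curve_length_le) (use * in \<open>auto simp: ennreal_le_minus_iff\<close>)
  then have "curve_length (\<gamma>, a, b) + ?d \<le> curve_length (\<gamma>, a, c) - ?d + ?d"
    by (rule add_right_mono)
  ultimately show ?thesis by (simp add: diff_add_cancel_ennreal)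
qed

text \<open>Clamping the subdivision points at \<open>b\<close> from either side yields subdivisions
  of both halves; only a chord straddling \<open>b\<close> changes, and there the triangle
  inequality through \<open>\<gamma> b\<close> applies.\<close>

lemma curve_length_subadditive:
  assumes "a \<le> b" "b \<le> c"
  shows "curve_length (\<gamma>, a, c) \<le> curve_length (\<gamma>, a, b) + curve_length (\<gamma>, b, c)"
proof (rule curve_length_le)
  fix n and t :: "nat \<Rightarrow> real"
  assume t: "t 0 = a" "t n = c" "mono_on {..n} t"
  define l r where "l = (\<lambda>i. min (t i) b)" and "r = (\<lambda>i. max (t i) b)"
  have "(\<Sum>i<n. ennreal (dist (\<gamma> (t i)) (\<gamma> (t (Suc i)))))
      \<le> (\<Sum>i<n. ennreal (dist (\<gamma> (l i)) (\<gamma> (l (Suc i)))) + ennreal (dist (\<gamma> (r i)) (\<gamma> (r (Suc i)))))"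
  proof (rule sum_mono)
    fix i assume "i \<in> {..<n}"
    then have le: "t i \<le> t (Suc i)" using mono_onD[OF t(3), of i "Suc i"] by auto
    have "dist (\<gamma> (t i)) (\<gamma> (t (Suc i))) \<le> dist (\<gamma> (l i)) (\<gamma> (l (Suc i))) + dist (\<gamma> (r i)) (\<gamma> (r (Suc i)))"
      using le dist_triangle[of "\<gamma> (t i)" "\<gamma> (t (Suc i))" "\<gamma> b"]
      unfolding l_def r_def by (auto simp: min_def max_def)
    then show "ennreal (dist (\<gamma> (t i)) (\<gamma> (t (Suc i))))
        \<le> ennreal (dist (\<gamma> (l i)) (\<gamma> (l (Suc i)))) + ennreal (dist (\<gamma> (r i)) (\<gamma> (r (Suc i))))"
      by (simp flip: ennreal_plus)
  qed
  also have "\<dots> \<le> curve_length (\<gamma>, a, b) + curve_length (\<gamma>, b, c)"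
    unfolding sum.distrib
  proof (intro add_mono curve_length_ge)
    show "mono_on {..n} l"
      unfolding l_def by (intro mono_onI min.mono order_refl mono_onD[OF t(3)])
    show "mono_on {..n} r"
      unfolding r_def by (intro mono_onI max.mono order_refl mono_onD[OF t(3)])
  qed (use t assms in \<open>auto simp: l_def r_def\<close>)
  finally show "(\<Sum>i<n. ennreal (dist (\<gamma> (t i)) (\<gamma> (t (Suc i)))))
      \<le> curve_length (\<gamma>, a, b) + curve_length (\<gamma>, b, c)" .
qed

text \<open>The chords telescope against \<Phi>. With \<Phi> the cost and \<kappa> a lower bound for
  the density, this converts cost into length on a short piece.\<close>

lemma curve_length_le_increment:
  assumes "0 < \<kappa>"
    and \<Phi>: "\<And>s t. a \<le> s \<Longrightarrow> s \<le> t \<Longrightarrow> t \<le> b \<Longrightarrow> \<kappa> * dist (\<gamma> s) (\<gamma> t) \<le> \<Phi> t - \<Phi> s"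
  shows "curve_length (\<gamma>, a, b) \<le> ennreal ((\<Phi> b - \<Phi> a) / \<kappa>)"
proof (rule curve_length_le)
  fix n and t :: "nat \<Rightarrow> real"
  assume t: "t 0 = a" "t n = b" "mono_on {..n} t"
  have "(\<Sum>i<n. ennreal (dist (\<gamma> (t i)) (\<gamma> (t (Suc i))))) \<le> (\<Sum>i<n. ennreal ((\<Phi> (t (Suc i)) - \<Phi> (t i)) / \<kappa>))"
  proof (intro sum_mono ennreal_leI)
    fix i assume "i \<in> {..<n}"
    then have "a \<le> t i" "t i \<le> t (Suc i)" "t (Suc i) \<le> b"
      using t mono_onD[OF t(3), of i "Suc i"] mono_onD[OF t(3), of 0 i] mono_onD[OF t(3), of "Suc i" n] by auto
    then show "dist (\<gamma> (t i)) (\<gamma> (t (Suc i))) \<le> (\<Phi> (t (Suc i)) - \<Phi> (t i)) / \<kappa>"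
      using \<Phi>[of "t i" "t (Suc i)"] assms(1) by (simp add: field_simps)
  qed
  also have "\<dots> = ennreal (\<Sum>i<n. (\<Phi> (t (Suc i)) - \<Phi> (t i)) / \<kappa>)"
  proof (rule sum_ennreal)
    fix i assume "i \<in> {..<n}"
    then have "a \<le> t i" "t i \<le> t (Suc i)" "t (Suc i) \<le> b"
      using t mono_onD[OF t(3), of i "Suc i"] mono_onD[OF t(3), of 0 i] mono_onD[OF t(3), of "Suc i" n] by auto
    then have "0 \<le> \<Phi> (t (Suc i)) - \<Phi> (t i)"
      using \<Phi>[of "t i" "t (Suc i)"] assms(1) by (meson order_trans mult_nonneg_nonneg zero_le_dist less_imp_le)
    then show "0 \<le> (\<Phi> (t (Suc i)) - \<Phi> (t i)) / \<kappa>" using assms(1) by simp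
  qed
  also have "(\<Sum>i<n. (\<Phi> (t (Suc i)) - \<Phi> (t i)) / \<kappa>) = (\<Phi> b - \<Phi> a) / \<kappa>"
    using t sum_lessThan_telescope[of "\<lambda>i. \<Phi> (t i)" n] by (simp flip: sum_divide_distrib)
  finally show "(\<Sum>i<n. ennreal (dist (\<gamma> (t i)) (\<gamma> (t (Suc i))))) \<le> ennreal ((\<Phi> b - \<Phi> a) / \<kappa>)" .
qed

section \<open>Arc length of 1-Lipschitz curves\<close>

text \<open>The limit of the chains is parametrized by the length travelled along the chains, which
  its own length may undercut; hence only a 1-Lipschitz bound, and arc length has to be recovered
  through \<open>\<sigma>\<close>.\<close>

locale lipschitz_curve =
  fixes \<gamma> :: "real \<Rightarrow> 'a::metric_space" and \<Lambda> :: real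
  assumes \<Lambda>: "0 < \<Lambda>"
    and lip: "\<And>s t. 0 \<le> s \<Longrightarrow> s \<le> t \<Longrightarrow> t \<le> \<Lambda> \<Longrightarrow> dist (\<gamma> s) (\<gamma> t) \<le> t - s"
begin

lemma piece_length_le: "0 \<le> s \<Longrightarrow> s \<le> t \<Longrightarrow> t \<le> \<Lambda> \<Longrightarrow> curve_length (\<gamma>, s, t) \<le> ennreal (t - s)"
  using curve_length_le_increment[of 1 s t \<gamma> "\<lambda>x. x"] lip by simp

definition \<sigma> :: "real \<Rightarrow> real" where "\<sigma> t = enn2real (curve_length (\<gamma>, 0, t))"

text \<open>Verbatim the choice made in \<open>arclength_param\<close>, so the two agree by
  unfolding.\<close>

abbreviation \<tau> :: "real \<Rightarrow> real" where
  "\<tau> s \<equiv> SOME t. t \<in> {0..\<Lambda>} \<and> curve_length (\<gamma>, 0, t) = ennreal s"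

lemma length_eq_\<sigma>: "0 \<le> t \<Longrightarrow> t \<le> \<Lambda> \<Longrightarrow> curve_length (\<gamma>, 0, t) = ennreal (\<sigma> t)"
  using piece_length_le[of 0 t] unfolding \<sigma>_def
  by (metis ennreal_enn2real ennreal_less_top order_le_less_trans order_refl)

lemma \<sigma>_nonneg: "0 \<le> \<sigma> t" by (simp add: \<sigma>_def)

lemma dist_le_\<sigma>:
  assumes "0 \<le> s" "s \<le> t" "t \<le> \<Lambda>" shows "dist (\<gamma> s) (\<gamma> t) \<le> \<sigma> t - \<sigma> s"
proof -
  have "ennreal (\<sigma> s + dist (\<gamma> s) (\<gamma> t)) \<le> ennreal (\<sigma> t)"
    using curve_length_extend[of 0 s t \<gamma>] assms \<sigma>_nonneg[of s] by (simp add: length_eq_\<sigma>)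
  then show ?thesis using \<sigma>_nonneg[of t] by (simp add: ennreal_le_iff)
qed

lemma \<sigma>_mono: "0 \<le> s \<Longrightarrow> s \<le> t \<Longrightarrow> t \<le> \<Lambda> \<Longrightarrow> \<sigma> s \<le> \<sigma> t"
  using dist_le_\<sigma>[of s t] zero_le_dist[of "\<gamma> s" "\<gamma> t"] by linarith

lemma \<sigma>_increment_le:
  assumes "0 \<le> s" "s \<le> t" "t \<le> \<Lambda>" "curve_length (\<gamma>, s, t) \<le> ennreal B" "0 \<le> B"
  shows "\<sigma> t - \<sigma> s \<le> B"
proof -
  have "ennreal (\<sigma> t) \<le> curve_length (\<gamma>, 0, s) + curve_length (\<gamma>, s, t)"
    using curve_length_subadditive[of 0 s t \<gamma>] assms by (simp add: length_eq_\<sigma>)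
  also have "\<dots> \<le> ennreal (\<sigma> s) + ennreal B"
    using assms by (intro add_mono) (simp_all add: length_eq_\<sigma>)
  also have "\<dots> = ennreal (\<sigma> s + B)" using assms \<sigma>_nonneg[of s] by simp
  finally have "\<sigma> t \<le> \<sigma> s + B"
    by (rule ennreal_le_iff[THEN iffD1, rotated]) (use assms \<sigma>_nonneg[of s] in simp)
  then show ?thesis by simp
qed

lemma \<sigma>_0: "\<sigma> 0 = 0"
  using \<sigma>_increment_le[of 0 0 0] piece_length_le[of 0 0] \<Lambda> by (simp add: \<sigma>_def enn2real_eq_0_iff)

lemma continuous_on_\<sigma>: "continuous_on {0..\<Lambda>} \<sigma>"
proof -
  have "dist (\<sigma> x) (\<sigma> y) \<le> 1 * dist x y" if "x \<in> {0..\<Lambda>}" "y \<in> {0..\<Lambda>}" for x y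
  proof -
    have *: "\<sigma> t - \<sigma> s \<le> t - s \<and> 0 \<le> \<sigma> t - \<sigma> s" if "0 \<le> s" "s \<le> t" "t \<le> \<Lambda>" for s t
      using \<sigma>_increment_le[OF that piece_length_le] \<sigma>_mono[of s t] that by auto
    show ?thesis
      using *[of x y] *[of y x] that by (cases "x \<le> y") (auto simp: dist_real_def)
  qed
  then have "1-lipschitz_on {0..\<Lambda>} \<sigma>" by (intro lipschitz_onI) auto
  then show ?thesis by (rule lipschitz_on_continuous_on)
qed

text \<open>The length function is continuous, so the intermediate value theorem provides the
  parameter that the choice operator needs.\<close>

lemma \<tau>_props:
  assumes "s \<in> {0..\<sigma> \<Lambda>}"
  shows "\<tau> s \<in> {0..\<Lambda>}" "\<sigma> (\<tau> s) = s"
proof -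
  have "\<exists>t\<ge>0. t \<le> \<Lambda> \<and> \<sigma> t = s"
    using assms \<Lambda> by (intro IVT' continuous_on_\<sigma>) (auto simp: \<sigma>_0)
  then have "\<exists>t. t \<in> {0..\<Lambda>} \<and> curve_length (\<gamma>, 0, t) = ennreal s"
    by (auto simp: length_eq_\<sigma>)
  then have *: "\<tau> s \<in> {0..\<Lambda>} \<and> curve_length (\<gamma>, 0, \<tau> s) = ennreal s" by (rule someI_ex)
  then show "\<tau> s \<in> {0..\<Lambda>}" "\<sigma> (\<tau> s) = s" using assms by (auto simp: \<sigma>_def)
qed

lemma arclength_param_eq: "arclength_param (\<gamma>, 0, \<Lambda>) s = \<gamma> (\<tau> s)"
  by (simp add: arclength_param_def)

lemma continuous_on_arclength_param: "continuous_on {0..\<sigma> \<Lambda>} (arclength_param (\<gamma>, 0, \<Lambda>))"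
proof -
  have "dist (\<gamma> (\<tau> x)) (\<gamma> (\<tau> y)) \<le> 1 * dist x y" if "x \<in> {0..\<sigma> \<Lambda>}" "y \<in> {0..\<sigma> \<Lambda>}" for x y
    using dist_le_\<sigma>[of "\<tau> x" "\<tau> y"] dist_le_\<sigma>[of "\<tau> y" "\<tau> x"] \<tau>_props[OF that(1)] \<tau>_props[OF that(2)]
    by (cases "\<tau> x \<le> \<tau> y") (auto simp: dist_real_def dist_commute)
  then have "1-lipschitz_on {0..\<sigma> \<Lambda>} (arclength_param (\<gamma>, 0, \<Lambda>))"
    by (intro lipschitz_onI) (auto simp: arclength_param_eq)
  then show ?thesis by (rule lipschitz_on_continuous_on)
qed

text \<open>The line integral sees the curve only on \<open>[0, \<sigma> \<Lambda>]\<close>, where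
  the arc-length parametrization is continuous; outside, the choice operator is arbitrary, hence the
  indicator.\<close>

lemma measurable_arclength:
  fixes f :: "'a \<Rightarrow> ennreal"
  assumes "f \<in> borel_measurable borel"
  shows "(\<lambda>s. f (arclength_param (\<gamma>, 0, \<Lambda>) s) * indicator {0..\<sigma> \<Lambda>} s) \<in> borel_measurable borel"
proof -
  have "arclength_param (\<gamma>, 0, \<Lambda>) \<in> borel_measurable (restrict_space borel {0..\<sigma> \<Lambda>})"
    by (intro borel_measurable_continuous_on_restrict continuous_on_arclength_param)
  then have "(\<lambda>s. f (arclength_param (\<gamma>, 0, \<Lambda>) s)) \<in> borel_measurable (restrict_space borel {0..\<sigma> \<Lambda>})"
    using assms by (rule measurable_compose)
  then show ?thesis by (subst (asm) borel_measurable_restrict_space_iff_ennreal) auto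
qed

lemma line_integral_eq:
  "line_integral f (\<gamma>, 0, \<Lambda>) = (\<integral>\<^sup>+ s. f (arclength_param (\<gamma>, 0, \<Lambda>) s) * indicator {0..\<sigma> \<Lambda>} s \<partial>lborel)"
  by (simp add: line_integral_def \<sigma>_def)

lemma line_integral_SUP_le:
  fixes f :: "nat \<Rightarrow> 'a \<Rightarrow> ennreal"
  assumes [measurable]: "\<And>n. f n \<in> borel_measurable borel" and inc: "\<And>x. incseq (\<lambda>n. f n x)"
    and le: "\<And>n. line_integral (f n) (\<gamma>, 0, \<Lambda>) \<le> B"
  shows "line_integral (\<lambda>x. SUP n. f n x) (\<gamma>, 0, \<Lambda>) \<le> B"
proof -
  have "line_integral (\<lambda>x. SUP n. f n x) (\<gamma>, 0, \<Lambda>)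
      = (\<integral>\<^sup>+ s. (SUP n. f n (arclength_param (\<gamma>, 0, \<Lambda>) s) * indicator {0..\<sigma> \<Lambda>} s) \<partial>lborel)"
    unfolding line_integral_eq by (simp add: SUP_mult_right_ennreal)
  also have "\<dots> = (SUP n. line_integral (f n) (\<gamma>, 0, \<Lambda>))"
    unfolding line_integral_eq
  proof (rule nn_integral_monotone_convergence_SUP)
    show "incseq (\<lambda>n s. f n (arclength_param (\<gamma>, 0, \<Lambda>) s) * indicator {0..\<sigma> \<Lambda>} s)"
      using inc by (auto simp: incseq_def le_fun_def intro!: mult_right_mono)
  qed (simp add: measurable_arclength)
  also have "\<dots> \<le> B" using le by (rule SUP_least)
  finally show ?thesis .
qed

lemma line_integral_add_const:
  assumes [measurable]: "f \<in> borel_measurable borel"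
  shows "line_integral (\<lambda>x. f x + c) (\<gamma>, 0, \<Lambda>) = line_integral f (\<gamma>, 0, \<Lambda>) + c * curve_length (\<gamma>, 0, \<Lambda>)"
proof -
  have "line_integral (\<lambda>x. f x + c) (\<gamma>, 0, \<Lambda>)
      = (\<integral>\<^sup>+ s. f (arclength_param (\<gamma>, 0, \<Lambda>) s) * indicator {0..\<sigma> \<Lambda>} s + c * indicator {0..\<sigma> \<Lambda>} s \<partial>lborel)"
    unfolding line_integral_eq by (simp add: distrib_right)
  also have "\<dots> = line_integral f (\<gamma>, 0, \<Lambda>) + c * ennreal (\<sigma> \<Lambda>)"
    unfolding line_integral_eq
    by (subst nn_integral_add) (auto simp: measurable_arclength nn_integral_cmult_indicator \<sigma>_nonneg)
  finally show ?thesis using \<Lambda> by (simp add: length_eq_\<sigma>)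
qed

text \<open>Riemann sums over a subdivision into \<open>k\<close> equal pieces: on each piece \<open>g \<circ> \<gamma>\<close> oscillates by at most
  \<open>L\<Lambda>/k\<close>, and the length of the piece times a lower bound of \<open>g\<close> there is at most the increment of \<open>S\<close>.\<close>

lemma line_integral_le_increment:
  fixes g :: "'a \<Rightarrow> real"
  assumes g: "L-lipschitz_on UNIV g" and g0: "\<And>x. 0 \<le> g x"
    and S: "\<And>s t. 0 \<le> s \<Longrightarrow> s \<le> t \<Longrightarrow> t \<le> \<Lambda> \<Longrightarrow> S s \<le> S t"
    and inc: "\<And>s t. 0 \<le> s \<Longrightarrow> s \<le> t \<Longrightarrow> t \<le> \<Lambda> \<Longrightarrow> (g (\<gamma> s) - L * (t - s)) * dist (\<gamma> s) (\<gamma> t) \<le> S t - S s"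
  shows "line_integral (\<lambda>x. ennreal (g x)) (\<gamma>, 0, \<Lambda>) \<le> ennreal (S \<Lambda> - S 0)"
proof (rule ennreal_le_epsilon)
  fix e :: real assume "0 < e"
  have L: "0 \<le> L" using g by (rule lipschitz_on_nonneg)
  \<comment> \<open>The Riemann sums below exceed the increment of \<open>S\<close> by at most
    \<open>3 * \<omega>\<close> times the length, with \<omega> the oscillation bound on one piece;
    \<open>k\<close> pushes this below \<open>e\<close>.\<close>
  obtain k' :: nat where k': "3 * L * \<Lambda> * \<sigma> \<Lambda> / e < real k'" using reals_Archimedean2 by blast
  define k where "k = Suc k'"
  have k: "0 < real k" "3 * L * \<Lambda> * \<sigma> \<Lambda> / e \<le> real k" using k' by (auto simp: k_def)
  define \<omega> where "\<omega> = L * \<Lambda> / real k"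
  have \<omega>: "0 \<le> \<omega>" using L \<Lambda> by (simp add: \<omega>_def)
  have \<omega>e: "3 * \<omega> * \<sigma> \<Lambda> \<le> e" using k \<open>0 < e\<close> by (simp add: \<omega>_def field_simps)
  define T where "T = (\<lambda>j::nat. real j * \<Lambda> / real k)"
  have T0: "0 \<le> T j" and Tm: "T j \<le> T (Suc j)" and Td: "T (Suc j) - T j = \<Lambda> / real k" for j
    using \<Lambda> k by (auto simp: T_def field_simps)
  have TL: "T j \<le> \<Lambda>" if "j \<le> k" for j
    using that \<Lambda> k mult_right_mono[of "real j" "real k" \<Lambda>] by (simp add: T_def divide_le_eq mult.commute)
  have osc: "\<bar>g (\<gamma> s) - g (\<gamma> (T j))\<bar> \<le> \<omega>" if "j < k" "T j \<le> s" "s \<le> T (Suc j)" for j s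
  proof -
    have "dist (g (\<gamma> (T j))) (g (\<gamma> s)) \<le> L * dist (\<gamma> (T j)) (\<gamma> s)"
      using lipschitz_onD[OF g] by simp
    also have "\<dots> \<le> L * (\<Lambda> / real k)"
      using lip[of "T j" s] that T0[of j] TL[of "Suc j"] Td[of j] L by (intro mult_left_mono) auto
    finally show ?thesis by (simp add: \<omega>_def dist_real_def abs_minus_commute)
  qed
  have piece: "(g (\<gamma> (T j)) + \<omega>) * (\<sigma> (T (Suc j)) - \<sigma> (T j))
      \<le> (S (T (Suc j)) - S (T j)) + 3 * \<omega> * (\<sigma> (T (Suc j)) - \<sigma> (T j))" if j: "j < k" for j
  proof -
    \<comment> \<open>Of the \<open>2 * \<omega>\<close>, one \<omega> covers the oscillation of
      \<open>g\<close> along the piece, the other the term \<open>L * (t - s)\<close>. Passing from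
      \<open>+ \<omega>\<close> to \<open>- 2 * \<omega>\<close> gives the 3. A nonpositive
      \<open>?\<kappa>\<close> cannot be divided by; then monotonicity of \<open>S\<close>
      suffices.\<close>
    let ?d = "\<sigma> (T (Suc j)) - \<sigma> (T j)" and ?\<kappa> = "g (\<gamma> (T j)) - 2 * \<omega>"
    have d0: "0 \<le> ?d" using \<sigma>_mono[of "T j" "T (Suc j)"] T0 Tm TL j by simp
    have dS: "0 \<le> S (T (Suc j)) - S (T j)" using S[of "T j" "T (Suc j)"] T0 Tm TL j by simp
    have "?\<kappa> * ?d \<le> S (T (Suc j)) - S (T j)"
    proof (cases "0 < ?\<kappa>")
      case True
      have "?\<kappa> * dist (\<gamma> s) (\<gamma> t) \<le> S t - S s" if st: "T j \<le> s" "s \<le> t" "t \<le> T (Suc j)" for s t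
      proof -
        have "L * (t - s) \<le> \<omega>"
          using st Td[of j] L mult_left_mono[of "t - s" "\<Lambda> / real k" L] by (simp add: \<omega>_def)
        moreover have "g (\<gamma> (T j)) - \<omega> \<le> g (\<gamma> s)" using osc[OF j, of s] st by simp
        ultimately have "?\<kappa> \<le> g (\<gamma> s) - L * (t - s)" by simp
        then have "?\<kappa> * dist (\<gamma> s) (\<gamma> t) \<le> (g (\<gamma> s) - L * (t - s)) * dist (\<gamma> s) (\<gamma> t)"
          by (rule mult_right_mono) simp
        also have "\<dots> \<le> S t - S s" using inc[of s t] st T0[of j] TL[of "Suc j"] j by simp
        finally show ?thesis .
      qed
      then have "curve_length (\<gamma>, T j, T (Suc j)) \<le> ennreal ((S (T (Suc j)) - S (T j)) / ?\<kappa>)"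
        by (rule curve_length_le_increment[OF True])
      then have "?d \<le> (S (T (Suc j)) - S (T j)) / ?\<kappa>"
        using T0[of j] Tm[of j] TL[of "Suc j"] j True dS by (intro \<sigma>_increment_le) auto
      then show ?thesis using True by (simp add: field_simps)
    next
      case False
      then have "?\<kappa> * ?d \<le> 0" using d0 by (simp add: mult_nonpos_nonneg)
      then show ?thesis using dS by simp
    qed
    then show ?thesis by (simp add: algebra_simps)
  qed
  have "line_integral (\<lambda>x. ennreal (g x)) (\<gamma>, 0, \<Lambda>)
      \<le> (\<integral>\<^sup>+ s. (\<Sum>j<k. ennreal (g (\<gamma> (T j)) + \<omega>) * indicator {\<sigma> (T j)..\<sigma> (T (Suc j))} s) \<partial>lborel)"
    unfolding line_integral_eq
  proof (rule nn_integral_mono)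
    fix s
    show "ennreal (g (arclength_param (\<gamma>, 0, \<Lambda>) s)) * indicator {0..\<sigma> \<Lambda>} s
        \<le> (\<Sum>j<k. ennreal (g (\<gamma> (T j)) + \<omega>) * indicator {\<sigma> (T j)..\<sigma> (T (Suc j))} s)"
    proof (cases "s \<in> {0..\<sigma> \<Lambda>}")
      case True
      note ts = \<tau>_props[OF True]
      \<comment> \<open>Rounding down locates the piece except at the right end, where it would give
        the index \<open>k\<close>.\<close>
      have "\<exists>j<k. T j \<le> \<tau> s \<and> \<tau> s \<le> T (Suc j)"
      proof (cases "\<tau> s = \<Lambda>")
        case True
        have "T k = \<Lambda>" using k by (simp add: T_def)
        then show ?thesis using True Tm[of k'] by (intro exI[of _ k']) (auto simp: k_def)
      next
        case False
        define j where "j = nat \<lfloor>\<tau> s * real k / \<Lambda>\<rfloor>"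
        have nn: "0 \<le> \<tau> s * real k / \<Lambda>" using ts \<Lambda> by simp
        then have "real j = of_int \<lfloor>\<tau> s * real k / \<Lambda>\<rfloor>" unfolding j_def by simp
        then have j: "real j \<le> \<tau> s * real k / \<Lambda>" "\<tau> s * real k / \<Lambda> < real j + 1" by linarith+
        have "\<tau> s * real k / \<Lambda> < real k" using ts False \<Lambda> k by (simp add: divide_less_eq mult.commute)
        then have "j < k" using j by linarith
        moreover have "T j \<le> \<tau> s" "\<tau> s \<le> T (Suc j)"
          using j \<Lambda> k by (auto simp: T_def field_simps)
        ultimately show ?thesis by blast
      qed
      then obtain j where j: "j < k" "T j \<le> \<tau> s" "\<tau> s \<le> T (Suc j)" by blast
      have "s \<in> {\<sigma> (T j)..\<sigma> (T (Suc j))}"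
        using \<sigma>_mono[of "T j" "\<tau> s"] \<sigma>_mono[of "\<tau> s" "T (Suc j)"] ts j T0[of j] TL[of "Suc j"] by simp
      then have "ennreal (g (arclength_param (\<gamma>, 0, \<Lambda>) s)) * indicator {0..\<sigma> \<Lambda>} s
          \<le> ennreal (g (\<gamma> (T j)) + \<omega>) * indicator {\<sigma> (T j)..\<sigma> (T (Suc j))} s"
        using True osc[OF j] by (auto simp: arclength_param_eq intro!: ennreal_leI)
      also have "\<dots> \<le> (\<Sum>j<k. ennreal (g (\<gamma> (T j)) + \<omega>) * indicator {\<sigma> (T j)..\<sigma> (T (Suc j))} s)"
        using j by (intro member_le_sum) auto
      finally show ?thesis .
    qed simp
  qed
  also have "\<dots> = (\<Sum>j<k. ennreal (g (\<gamma> (T j)) + \<omega>) * emeasure lborel {\<sigma> (T j)..\<sigma> (T (Suc j))})"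
    by (subst nn_integral_sum) (auto simp: nn_integral_cmult_indicator)
  also have "\<dots> = (\<Sum>j<k. ennreal ((g (\<gamma> (T j)) + \<omega>) * (\<sigma> (T (Suc j)) - \<sigma> (T j))))"
  proof (intro sum.cong refl)
    fix j assume "j \<in> {..<k}"
    then have "\<sigma> (T j) \<le> \<sigma> (T (Suc j))" using \<sigma>_mono[of "T j" "T (Suc j)"] T0 Tm TL by simp
    then show "ennreal (g (\<gamma> (T j)) + \<omega>) * emeasure lborel {\<sigma> (T j)..\<sigma> (T (Suc j))}
        = ennreal ((g (\<gamma> (T j)) + \<omega>) * (\<sigma> (T (Suc j)) - \<sigma> (T j)))"
      using g0 \<omega> by (simp add: ennreal_mult)
  qed
  also have "\<dots> = ennreal (\<Sum>j<k. (g (\<gamma> (T j)) + \<omega>) * (\<sigma> (T (Suc j)) - \<sigma> (T j)))"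
    by (rule sum_ennreal) (use g0 \<omega> \<sigma>_mono T0 Tm TL in \<open>auto intro!: mult_nonneg_nonneg add_nonneg_nonneg\<close>)
  also have "\<dots> \<le> ennreal (\<Sum>j<k. (S (T (Suc j)) - S (T j)) + 3 * \<omega> * (\<sigma> (T (Suc j)) - \<sigma> (T j)))"
    using piece by (intro ennreal_leI sum_mono) auto
  also have "(\<Sum>j<k. (S (T (Suc j)) - S (T j)) + 3 * \<omega> * (\<sigma> (T (Suc j)) - \<sigma> (T j)))
      = (S \<Lambda> - S 0) + 3 * \<omega> * \<sigma> \<Lambda>"
  proof -
    have "T 0 = 0" "T k = \<Lambda>" using k by (auto simp: T_def)
    then show ?thesis
      using sum_lessThan_telescope[of "\<lambda>j. S (T j)" k] sum_lessThan_telescope[of "\<lambda>j. \<sigma> (T j)" k]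
      by (simp add: sum.distrib \<sigma>_0 flip: sum_distrib_left)
  qed
  also have "ennreal \<dots> \<le> ennreal ((S \<Lambda> - S 0) + e)"
    using \<omega>e by (intro ennreal_leI) simp
  also have "\<dots> = ennreal (S \<Lambda> - S 0) + ennreal e"
    using S[of 0 \<Lambda>] \<Lambda> \<open>0 < e\<close> by (intro ennreal_plus) auto
  finally show "line_integral (\<lambda>x. ennreal (g x)) (\<gamma>, 0, \<Lambda>) \<le> ennreal (S \<Lambda> - S 0) + ennreal e" .
qed

end

section \<open>Chains\<close>

text \<open>A step is priced at its starting point, so prolonging a chain leaves earlier costs
  unchanged. The length is tracked beside the cost because it becomes the parameter of the limit
  curve.\<close>

inductive chain :: "('a::metric_space \<Rightarrow> real) \<Rightarrow> real \<Rightarrow> 'a set \<Rightarrow> 'a \<Rightarrow> real \<Rightarrow> real \<Rightarrow> bool"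
  for g \<delta> E where
  start: "x \<in> E \<Longrightarrow> chain g \<delta> E x 0 0"
| step: "chain g \<delta> E x l c \<Longrightarrow> dist x y < \<delta> \<Longrightarrow> chain g \<delta> E y (l + dist x y) (c + g x * dist x y)"

lemma chain_cost_ge:
  assumes "chain g \<delta> E x l c" "\<And>z. m \<le> g z"
  shows "0 \<le> l \<and> m * l \<le> c"
  using assms(1)
proof induction
  case (step x l c y)
  then show ?case using mult_right_mono[OF assms(2)[of x], of "dist x y"] by (simp add: algebra_simps)
qed simp

text \<open>A chain is traversed by a step function \<open>\<gamma>\<close>, parametrized by the length travelled so far,
  while \<open>S\<close> records the cost paid so far.\<close>

lemma chain_step_function:
  assumes "chain g \<delta> E x l c" "0 < \<delta>" and g0: "\<And>z. 0 \<le> g z"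
  shows "\<exists>\<gamma> S. \<gamma> 0 \<in> E \<and> S 0 = 0 \<and> (\<forall>t\<ge>l. \<gamma> t = x \<and> S t = c) \<and>
    (\<forall>s t. 0 \<le> s \<and> s \<le> t \<longrightarrow> S s \<le> S t \<and> dist (\<gamma> s) (\<gamma> t) \<le> t - s + \<delta> \<and>
      (\<forall>g' L. L-lipschitz_on UNIV g' \<and> (\<forall>z. g' z \<le> g z) \<longrightarrow>
        (g' (\<gamma> s) - L * (t - s + \<delta>)) * dist (\<gamma> s) (\<gamma> t) \<le> S t - S s))"
  using assms(1)
proof induction
  case (start x)
  then show ?case using \<open>0 < \<delta>\<close> by (intro exI[of _ "\<lambda>_. x"] exI[of _ "\<lambda>_. 0"]) auto
next
  case (step x l c y)
  have l0: "0 \<le> l" using chain_cost_ge[OF step.hyps(1) g0] by simp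
  from step.IH obtain \<gamma> S where E: "\<gamma> 0 \<in> E" "S 0 = 0" and end_all: "\<forall>t\<ge>l. \<gamma> t = x \<and> S t = c"
    and all: "\<forall>s t. 0 \<le> s \<and> s \<le> t \<longrightarrow> S s \<le> S t \<and> dist (\<gamma> s) (\<gamma> t) \<le> t - s + \<delta> \<and>
      (\<forall>g' L. L-lipschitz_on UNIV g' \<and> (\<forall>z. g' z \<le> g z) \<longrightarrow>
        (g' (\<gamma> s) - L * (t - s + \<delta>)) * dist (\<gamma> s) (\<gamma> t) \<le> S t - S s)"
    by (elim exE conjE) (rule that)
  have end_x: "\<gamma> t = x" "S t = c" if "l \<le> t" for t using end_all that by auto
  have mono: "S s \<le> S t" and d: "dist (\<gamma> s) (\<gamma> t) \<le> t - s + \<delta>" if "0 \<le> s" "s \<le> t" for s t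
    using all that by auto
  have inc: "(g' (\<gamma> s) - L * (t - s + \<delta>)) * dist (\<gamma> s) (\<gamma> t) \<le> S t - S s"
    if "0 \<le> s" "s \<le> t" "L-lipschitz_on UNIV g'" "\<And>z. g' z \<le> g z" for s t g' L
    using all that by blast
  let ?d = "dist x y"
  \<comment> \<open>The walker rests at \<open>x\<close> during the last step and jumps to
    \<open>y\<close> at time \<open>l + ?d\<close>. Jumps are shorter than \<delta>, which is the
    origin of the slack \<delta> in the estimates.\<close>
  define \<gamma>' where "\<gamma>' = (\<lambda>t. if t < l + ?d then \<gamma> t else y)"
  define S' where "S' = (\<lambda>t. if t < l + ?d then S t else c + g x * ?d)"
  have gd: "0 \<le> g x * ?d" using g0 by simp
  have Sc: "S s \<le> c" if "0 \<le> s" for s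
    using mono[of s "max s l"] end_x(2)[of "max s l"] that by simp
  have start': "\<gamma>' 0 \<in> E \<and> S' 0 = 0"
  proof (cases "0 < l + ?d")
    case False
    then have "l = 0" "?d = 0" using l0 zero_le_dist[of x y] by linarith+
    then show ?thesis using E end_x[of 0] by (auto simp: \<gamma>'_def S'_def)
  qed (use E in \<open>simp add: \<gamma>'_def S'_def\<close>)
  have "S' s \<le> S' t \<and> dist (\<gamma>' s) (\<gamma>' t) \<le> t - s + \<delta> \<and>
      (\<forall>g' L. L-lipschitz_on UNIV g' \<and> (\<forall>z. g' z \<le> g z) \<longrightarrow>
        (g' (\<gamma>' s) - L * (t - s + \<delta>)) * dist (\<gamma>' s) (\<gamma>' t) \<le> S' t - S' s)"
    if st: "0 \<le> s" "s \<le> t" for s t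
  proof -
    \<comment> \<open>Both times before the last jump, both after it, separated by the whole last
      step, or \<open>s\<close> during the rest at \<open>x\<close> and \<open>t\<close> after the
      jump. Only the third case combines the induction hypothesis with the new step.\<close>
    consider "t < l + ?d" | "l + ?d \<le> s" | "s < l" "l + ?d \<le> t" | "l \<le> s" "s < l + ?d" "l + ?d \<le> t"
      by linarith
    then show ?thesis
    proof cases
      case 1
      then show ?thesis using mono[OF st] d[OF st] inc[OF st] st by (simp add: \<gamma>'_def S'_def)
    next
      case 2
      then show ?thesis using st \<open>0 < \<delta>\<close> by (simp add: \<gamma>'_def S'_def)
    next
      case 3
      then have sl: "s \<le> l" by simp
      have eq: "\<gamma>' s = \<gamma> s" "S' s = S s" "\<gamma>' t = y" "S' t = c + g x * ?d"
        using 3 by (auto simp: \<gamma>'_def S'_def intro: less_le_trans[of s l])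
      have dx: "dist (\<gamma> s) x \<le> l - s + \<delta>" using d[OF st(1) sl] end_x by simp
      have tri: "dist (\<gamma> s) y \<le> dist (\<gamma> s) x + ?d" by (rule dist_triangle)
      have "(g' (\<gamma> s) - L * (t - s + \<delta>)) * dist (\<gamma> s) y \<le> c + g x * ?d - S s"
        if g': "L-lipschitz_on UNIV g'" "\<And>z. g' z \<le> g z" for g' L
      proof -
        have L: "0 \<le> L" using g'(1) by (rule lipschitz_on_nonneg)
        let ?k = "g' (\<gamma> s) - L * (t - s + \<delta>)"
        show ?thesis
        \<comment> \<open>If \<open>?k\<close> is nonnegative, split the distance at
          \<open>x\<close>: the part up to \<open>x\<close> is paid by induction, and
          \<open>?k \<le> g' x\<close> by the Lipschitz bound, so the last step pays the rest.
          Otherwise the left side is nonpositive and \<open>S\<close> is monotone.\<close>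
        proof (cases "0 \<le> ?k")
          case True
          have lt: "L * (l - s + \<delta>) \<le> L * (t - s + \<delta>)"
            using 3 L by (intro mult_left_mono) (auto intro: order_trans[of l "l + ?d"])
          have "?k * dist (\<gamma> s) x \<le> (g' (\<gamma> s) - L * (l - s + \<delta>)) * dist (\<gamma> s) x"
            using lt by (intro mult_right_mono) auto
          also have "\<dots> \<le> c - S s" using inc[OF st(1) sl g'] end_x by simp
          finally have 1: "?k * dist (\<gamma> s) x \<le> c - S s" .
          have "dist (g' (\<gamma> s)) (g' x) \<le> L * dist (\<gamma> s) x" using lipschitz_onD[OF g'(1)] by simp
          also have "\<dots> \<le> L * (l - s + \<delta>)" using dx L by (rule mult_left_mono)
          finally have "?k \<le> g' x" using lt by (simp add: dist_real_def)
          then have "?k * ?d \<le> g x * ?d" using g'(2)[of x] by (intro mult_right_mono) auto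
          moreover have "?k * dist (\<gamma> s) y \<le> ?k * (dist (\<gamma> s) x + ?d)"
            using tri True by (rule mult_left_mono)
          ultimately show ?thesis using 1 by (simp add: distrib_left)
        next
          case False
          then have "?k * dist (\<gamma> s) y \<le> 0" by (intro mult_nonpos_nonneg) auto
          then show ?thesis using Sc[OF st(1)] gd by simp
        qed
      qed
      then show ?thesis using eq Sc[OF st(1)] gd tri dx 3 by auto
    next
      case 4
      have "(g' x - L * (t - s + \<delta>)) * ?d \<le> g x * ?d" if "L-lipschitz_on UNIV g'" "\<And>z. g' z \<le> g z" for g' L
      proof -
        have "0 \<le> L * (t - s + \<delta>)" using that(1) st \<open>0 < \<delta>\<close> by (intro mult_nonneg_nonneg) (auto dest: lipschitz_on_nonneg)
        then show ?thesis using that(2)[of x] by (intro mult_right_mono) auto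
      qed
      then show ?thesis using 4 end_x step.hyps(2) gd st by (simp add: \<gamma>'_def S'_def)
    qed
  qed
  then show ?case
    using start' by (intro exI[of _ \<gamma>'] exI[of _ S']) (auto simp: \<gamma>'_def S'_def)
qed

lemma closed_Collect_imp_const: "(P \<Longrightarrow> closed {x. Q x}) \<Longrightarrow> closed {x. P \<longrightarrow> Q x}"
  by (cases P) auto

text \<open>By Tychonoff's theorem the step functions of a sequence of finer and finer chains have a cluster
  point for pointwise convergence; all estimates pass to it, since each involves only two parameter values.\<close>

lemma chains_limit_curve:
  fixes g :: "nat \<Rightarrow> 'a::metric_space \<Rightarrow> real"
  assumes X: "compact (UNIV :: 'a set)" and E: "closed E" and F: "closed F"
    and glip: "\<And>n. \<exists>L. L-lipschitz_on UNIV (g n)" and m: "0 < m" "\<And>n x. m \<le> g n x"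
    and inc: "\<And>x. incseq (\<lambda>n. g n x)"
    and chains: "\<And>n. \<exists>x\<in>F. \<exists>l c. chain (g n) (inverse (real (Suc n))) E x l c \<and> c \<le> 1"
  obtains \<gamma> where "lipschitz_curve \<gamma> (1 / m)" "\<gamma> 0 \<in> E" "\<gamma> (1 / m) \<in> F"
    "\<And>n. line_integral (\<lambda>x. ennreal (g n x)) (\<gamma>, 0, 1 / m) \<le> 1"
proof -
  define \<Lambda> where "\<Lambda> = 1 / m"
  have \<Lambda>: "0 < \<Lambda>" using m by (simp add: \<Lambda>_def)
  obtain L where L: "\<And>n. (L n)-lipschitz_on UNIV (g n)" using glip by metis
  \<comment> \<open>Position and cost are kept together as one point of a product; costs lie in
    \<open>[0, 1]\<close>, so each factor is compact.\<close>
  define P where "P = (UNIV :: real set) \<rightarrow>\<^sub>E ((UNIV :: 'a set) \<times> {0..1::real})"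
  define \<delta> where "\<delta> = (\<lambda>n. inverse (real (Suc n)))"
  have \<delta>: "0 < \<delta> n" for n by (simp add: \<delta>_def)
  have \<delta>_mono: "\<delta> n \<le> \<delta> k" if "k \<le> n" for k n using that by (simp add: \<delta>_def)
  \<comment> \<open>Closed conditions on at most two coordinates at a time, decreasing in
    \<open>n\<close>. Only \<open>k \<le> n\<close> occurs, because the chain of stage
    \<open>n\<close> pays \<open>g n\<close>, which dominates \<open>g k\<close> for these
    \<open>k\<close>.\<close>
  define Q where "Q = (\<lambda>n f. fst (f 0) \<in> E \<and> fst (f \<Lambda>) \<in> F \<and>
     (\<forall>s t. 0 \<le> s \<and> s \<le> t \<and> t \<le> \<Lambda> \<longrightarrow> snd (f s) \<le> snd (f t) \<and>
        dist (fst (f s)) (fst (f t)) \<le> t - s + \<delta> n \<and>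
        (\<forall>k. k \<le> n \<longrightarrow> (g k (fst (f s)) - L k * (t - s + \<delta> n)) * dist (fst (f s)) (fst (f t)) \<le> snd (f t) - snd (f s))))"
  have "compactin (product_topology (\<lambda>_::real. euclidean) UNIV) P"
    unfolding P_def compactin_PiE using X by (auto intro!: compact_Times)
  then have Pc: "compact P" by (simp add: euclidean_product_topology)
  have fc: "continuous_on UNIV (\<lambda>f::real \<Rightarrow> 'a \<times> real. fst (f t))"
    and sc: "continuous_on UNIV (\<lambda>f::real \<Rightarrow> 'a \<times> real. snd (f t))" for t
    by (intro continuous_on_fst continuous_on_snd continuous_on_product_coordinates)+
  have gc: "continuous_on UNIV (\<lambda>f::real \<Rightarrow> 'a \<times> real. g k (fst (f t)))" for k t
    by (rule continuous_on_compose2[OF lipschitz_on_continuous_on[OF L] fc]) simp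
  have Qc: "closed {f. Q n f}" for n
    unfolding Q_def
  proof (intro closed_Collect_conj closed_Collect_all closed_Collect_imp_const)
    show "closed {f::real \<Rightarrow> 'a \<times> real. fst (f 0) \<in> E}" "closed {f::real \<Rightarrow> 'a \<times> real. fst (f \<Lambda>) \<in> F}"
      using closed_vimage[OF E fc[of 0]] closed_vimage[OF F fc[of \<Lambda>]] by (simp_all add: vimage_def)
    fix s t k
    show "closed {f::real \<Rightarrow> 'a \<times> real. snd (f s) \<le> snd (f t)}"
      by (rule closed_Collect_le[OF sc sc])
    show "closed {f::real \<Rightarrow> 'a \<times> real. dist (fst (f s)) (fst (f t)) \<le> t - s + \<delta> n}"
      by (rule closed_Collect_le[OF continuous_on_dist[OF fc fc] continuous_on_const])
    show "closed {f::real \<Rightarrow> 'a \<times> real. (g k (fst (f s)) - L k * (t - s + \<delta> n)) * dist (fst (f s)) (fst (f t)) \<le> snd (f t) - snd (f s)}"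
      by (intro closed_Collect_le continuous_on_mult continuous_on_diff continuous_on_dist fc sc gc continuous_on_const)
  qed
  have Q_anti: "Q k f" if "Q n f" "k \<le> n" for k n f
  proof -
    have "(g j (fst (f s)) - L j * (t - s + \<delta> k)) * dist (fst (f s)) (fst (f t)) \<le> snd (f t) - snd (f s)"
      if "0 \<le> s" "s \<le> t" "t \<le> \<Lambda>" "j \<le> k" for s t j
    proof -
      have "L j * (t - s + \<delta> n) \<le> L j * (t - s + \<delta> k)"
        using \<delta>_mono[OF \<open>k \<le> n\<close>] lipschitz_on_nonneg[OF L] by (intro mult_left_mono) auto
      then have "(g j (fst (f s)) - L j * (t - s + \<delta> k)) * dist (fst (f s)) (fst (f t))
          \<le> (g j (fst (f s)) - L j * (t - s + \<delta> n)) * dist (fst (f s)) (fst (f t))"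
        by (intro mult_right_mono) auto
      also have "\<dots> \<le> snd (f t) - snd (f s)" using \<open>Q n f\<close> that \<open>k \<le> n\<close> unfolding Q_def by auto
      finally show ?thesis .
    qed
    moreover have "dist (fst (f s)) (fst (f t)) \<le> t - s + \<delta> k" "snd (f s) \<le> snd (f t)"
      if "0 \<le> s" "s \<le> t" "t \<le> \<Lambda>" for s t
      using \<open>Q n f\<close> that \<delta>_mono[OF \<open>k \<le> n\<close>] unfolding Q_def by (meson add_left_mono order_trans)+
    ultimately show ?thesis using \<open>Q n f\<close> unfolding Q_def by blast
  qed
  have Q_ex: "\<exists>f\<in>P. Q n f" for n
  proof -
    obtain x l c where x: "x \<in> F" and ch: "chain (g n) (\<delta> n) E x l c" and c1: "c \<le> 1"
      using chains[of n] by (auto simp: \<delta>_def)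
    have l: "0 \<le> l" "m * l \<le> c" using chain_cost_ge[OF ch m(2)] by auto
    \<comment> \<open>At time \<Lambda> every chain has arrived, since cost at most 1 and density at
      least \<open>m\<close> bound its length by \<open>1 / m\<close>.\<close>
    then have l\<Lambda>: "l \<le> \<Lambda>" using c1 m(1) by (simp add: \<Lambda>_def field_simps)
    have g0: "0 \<le> g n z" for z using m(1) m(2)[of n z] by simp
    obtain \<gamma> S where \<gamma>: "\<gamma> 0 \<in> E" "S 0 = 0" and e: "\<forall>t\<ge>l. \<gamma> t = x \<and> S t = c"
      and all: "\<forall>s t. 0 \<le> s \<and> s \<le> t \<longrightarrow> S s \<le> S t \<and> dist (\<gamma> s) (\<gamma> t) \<le> t - s + \<delta> n \<and>
      (\<forall>g' L. L-lipschitz_on UNIV g' \<and> (\<forall>z. g' z \<le> g n z) \<longrightarrow>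
        (g' (\<gamma> s) - L * (t - s + \<delta> n)) * dist (\<gamma> s) (\<gamma> t) \<le> S t - S s)"
      using chain_step_function[OF ch \<delta> g0] by (elim exE conjE) (rule that)
    have mono: "S s \<le> S t" and d: "dist (\<gamma> s) (\<gamma> t) \<le> t - s + \<delta> n" if "0 \<le> s" "s \<le> t" for s t
      using all that by auto
    have i: "(g k (\<gamma> s) - L k * (t - s + \<delta> n)) * dist (\<gamma> s) (\<gamma> t) \<le> S t - S s"
      if "0 \<le> s" "s \<le> t" "k \<le> n" for s t k
    proof -
      have "\<forall>z. g k z \<le> g n z" using inc that by (simp add: incseq_def)
      then show ?thesis using all that L[of k] by blast
    qed
    \<comment> \<open>The product runs over all real times; negative ones get the value at
      0.\<close>
    define f where "f = (\<lambda>t. (\<gamma> (max 0 t), S (max 0 t)))"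
    have "0 \<le> S t \<and> S t \<le> 1" if "0 \<le> t" for t
      using mono[of 0 t] mono[of t "max t l"] e[rule_format, of "max t l"] that \<gamma>(2) c1 by auto
    then have "f t \<in> UNIV \<times> {0..1}" for t by (simp add: f_def)
    then have "f \<in> P" unfolding P_def by (intro PiE_I) auto
    moreover have "Q n f"
      unfolding Q_def
    proof (intro conjI allI impI)
      show "fst (f 0) \<in> E" "fst (f \<Lambda>) \<in> F" using \<gamma> e[rule_format, OF l\<Lambda>] x \<Lambda> by (auto simp: f_def)
      fix s t assume "0 \<le> s \<and> s \<le> t \<and> t \<le> \<Lambda>"
      then have st: "0 \<le> s" "s \<le> t" "max 0 s = s" "max 0 t = t" by auto
      show "snd (f s) \<le> snd (f t)" "dist (fst (f s)) (fst (f t)) \<le> t - s + \<delta> n"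
        using mono[OF st(1,2)] d[OF st(1,2)] by (simp_all add: f_def st)
      fix k assume "k \<le> n"
      then show "(g k (fst (f s)) - L k * (t - s + \<delta> n)) * dist (fst (f s)) (fst (f t)) \<le> snd (f t) - snd (f s)"
        using i[OF st(1,2)] by (simp add: f_def st)
    qed
    ultimately show ?thesis by blast
  qed
  have "P \<inter> (\<Inter>n. {f. Q n f}) \<noteq> {}"
  proof (rule compact_imp_fip_image[OF Pc Qc])
    fix I :: "nat set" assume "finite I"
    then obtain N where N: "\<forall>n\<in>I. n \<le> N" using finite_nat_set_iff_bounded_le by blast
    obtain f where f: "f \<in> P" "Q N f" using Q_ex by blast
    have "Q n f" if "n \<in> I" for n
      using Q_anti[OF f(2)] N that by simp
    with f have "f \<in> P \<inter> (\<Inter>n\<in>I. {f. Q n f})" by simp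
    then show "P \<inter> (\<Inter>n\<in>I. {f. Q n f}) \<noteq> {}" by (metis empty_iff)
  qed
  then obtain f where "f \<in> P \<inter> (\<Inter>n. {f. Q n f})" by (metis ex_in_conv)
  then have fP: "f \<in> P" and Q: "Q n f" for n by simp_all
  have \<delta>0: "\<delta> \<longlonglongrightarrow> 0" unfolding \<delta>_def by (rule LIMSEQ_inverse_real_of_nat)
  have dist_f: "dist (fst (f s)) (fst (f t)) \<le> t - s" if "0 \<le> s" "s \<le> t" "t \<le> \<Lambda>" for s t
  proof (rule LIMSEQ_le_const)
    show "(\<lambda>n. t - s + \<delta> n) \<longlonglongrightarrow> t - s" using tendsto_add[OF tendsto_const \<delta>0, of "t - s"] by simp
  qed (use Q that in \<open>auto simp: Q_def\<close>)
  \<comment> \<open>For fixed \<open>k\<close> the estimate is available from stage \<open>k\<close>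
    on, and \<delta> disappears in the limit; what is left is \<open>L k * (t - s)\<close>, the
    error that \<open>line_integral_le_increment\<close> tolerates.\<close>
  have cost_f: "(g k (fst (f s)) - L k * (t - s)) * dist (fst (f s)) (fst (f t)) \<le> snd (f t) - snd (f s)"
    if "0 \<le> s" "s \<le> t" "t \<le> \<Lambda>" for s t k
  proof (rule LIMSEQ_le_const2)
    show "(\<lambda>n. (g k (fst (f s)) - L k * (t - s + \<delta> n)) * dist (fst (f s)) (fst (f t)))
        \<longlonglongrightarrow> (g k (fst (f s)) - L k * (t - s)) * dist (fst (f s)) (fst (f t))"
      using \<delta>0 by (auto intro!: tendsto_eq_intros)
    show "\<exists>N. \<forall>n\<ge>N. (g k (fst (f s)) - L k * (t - s + \<delta> n)) * dist (fst (f s)) (fst (f t)) \<le> snd (f t) - snd (f s)"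
    proof (intro exI allI impI)
      fix n assume "k \<le> n"
      then show "(g k (fst (f s)) - L k * (t - s + \<delta> n)) * dist (fst (f s)) (fst (f t)) \<le> snd (f t) - snd (f s)"
        using Q[of n] that unfolding Q_def by simp
    qed
  qed
  show ?thesis
  proof (rule that[of "\<lambda>t. fst (f t)"])
    show lc: "lipschitz_curve (\<lambda>t. fst (f t)) (1 / m)"
      using dist_f \<Lambda> unfolding \<Lambda>_def by unfold_locales
    show "fst (f 0) \<in> E" "fst (f (1 / m)) \<in> F" using Q[of 0] unfolding Q_def \<Lambda>_def by simp_all
    fix n
    interpret lipschitz_curve "\<lambda>t. fst (f t)" "1 / m" by (rule lc)
    have "line_integral (\<lambda>x. ennreal (g n x)) (\<lambda>t. fst (f t), 0, 1 / m) \<le> ennreal (snd (f (1 / m)) - snd (f 0))"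
    proof (rule line_integral_le_increment[OF L])
      show "0 \<le> g n x" for x using m(1) m(2)[of n x] by simp
    qed (use Q cost_f in \<open>auto simp: Q_def \<Lambda>_def\<close>)
    also have "ennreal (snd (f (1 / m)) - snd (f 0)) \<le> ennreal 1"
    proof (rule ennreal_leI)
      have "f t \<in> UNIV \<times> {0..1}" for t using fP unfolding P_def by (rule PiE_mem) simp
      from this[of "1 / m"] this[of 0] show "snd (f (1 / m)) - snd (f 0) \<le> 1" by auto
    qed
    finally show "line_integral (\<lambda>x. ennreal (g n x)) (\<lambda>t. fst (f t), 0, 1 / m) \<le> 1" by simp
  qed
qed

section \<open>The capped chain distance\<close>

text \<open>Inserting 1 caps the value and keeps the set nonempty at points that no chain
  reaches.\<close>

definition chain_dist :: "('a::metric_space \<Rightarrow> real) \<Rightarrow> real \<Rightarrow> 'a set \<Rightarrow> 'a \<Rightarrow> real" where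
  "chain_dist g \<delta> E x = Inf (insert 1 {c. \<exists>l. chain g \<delta> E x l c})"

context
  fixes g :: "'a::metric_space \<Rightarrow> real" and \<delta> :: real and E :: "'a set"
  assumes g0: "\<And>z. 0 \<le> g z"
begin

lemma chain_costs_nonneg: "c \<in> insert 1 {c. \<exists>l. chain g \<delta> E x l c} \<Longrightarrow> 0 \<le> c"
  using chain_cost_ge[of g \<delta> E x _ c 0] g0 by auto

lemma chain_dist_le: "c \<in> insert 1 {c. \<exists>l. chain g \<delta> E x l c} \<Longrightarrow> chain_dist g \<delta> E x \<le> c"
  unfolding chain_dist_def using chain_costs_nonneg by (intro cInf_lower bdd_belowI[of _ 0]) auto

lemma chain_dist_ge: "(\<And>c. c \<in> insert 1 {c. \<exists>l. chain g \<delta> E x l c} \<Longrightarrow> b \<le> c) \<Longrightarrow> b \<le> chain_dist g \<delta> E x"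
  unfolding chain_dist_def by (intro cInf_greatest) auto

lemma chain_dist_bounds: "0 \<le> chain_dist g \<delta> E x" "chain_dist g \<delta> E x \<le> 1"
  by (auto intro!: chain_dist_ge chain_dist_le intro: chain_costs_nonneg)

lemma chain_dist_start: "x \<in> E \<Longrightarrow> chain_dist g \<delta> E x = 0"
  by (intro antisym chain_dist_bounds chain_dist_le) (auto intro: chain.start)

text \<open>Every chain to \<open>x\<close> extends by the step to \<open>y\<close>. The cap 1 need
  not be the cost of a chain and is treated apart.\<close>

lemma chain_dist_step:
  assumes "dist x y < \<delta>"
  shows "chain_dist g \<delta> E y \<le> chain_dist g \<delta> E x + g x * dist x y"
proof -
  have "chain_dist g \<delta> E y - g x * dist x y \<le> chain_dist g \<delta> E x"
  proof (rule chain_dist_ge)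
    fix c assume c: "c \<in> insert 1 {c. \<exists>l. chain g \<delta> E x l c}"
    show "chain_dist g \<delta> E y - g x * dist x y \<le> c"
    proof (cases "c = 1")
      case True
      have "0 \<le> g x * dist x y" using g0 by simp
      then show ?thesis using chain_dist_bounds(2)[of y] True by simp
    next
      case False
      then obtain l where "chain g \<delta> E x l c" using c by auto
      then have "chain_dist g \<delta> E y \<le> c + g x * dist x y"
        using chain.step[OF _ assms] by (intro chain_dist_le) blast
      then show ?thesis by simp
    qed
  qed
  then show ?thesis by simp
qed

text \<open>Going from \<open>x\<close> to \<open>y\<close> is priced by \<open>g x\<close>, going
  back by \<open>g y\<close>; hence the maximum.\<close>

lemma chain_dist_local_lipschitz:
  assumes "dist x y < \<delta>"
  shows "\<bar>chain_dist g \<delta> E x - chain_dist g \<delta> E y\<bar> \<le> max (g x) (g y) * dist x y"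
proof -
  have "g x * dist x y \<le> max (g x) (g y) * dist x y" "g y * dist x y \<le> max (g x) (g y) * dist x y"
    by (intro mult_right_mono; simp)+
  then show ?thesis
    using chain_dist_step[OF assms] chain_dist_step[of y x] assms by (auto simp: dist_commute abs_le_iff)
qed

text \<open>Points at distance at least \<delta> admit no direct step, but the values lie in
  \<open>[0, 1]\<close>, so \<open>1 / \<delta>\<close> bounds the slope between them.\<close>

lemma chain_dist_lipschitz:
  assumes "0 < \<delta>" "\<And>z. g z \<le> B"
  shows "(max B (1 / \<delta>))-lipschitz_on UNIV (chain_dist g \<delta> E)"
proof (rule lipschitz_onI)
  fix x y
  show "dist (chain_dist g \<delta> E x) (chain_dist g \<delta> E y) \<le> max B (1 / \<delta>) * dist x y"
  proof (cases "dist x y < \<delta>")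
    case True
    have "max (g x) (g y) * dist x y \<le> max B (1 / \<delta>) * dist x y"
      using assms(2)[of x] assms(2)[of y] by (intro mult_right_mono) auto
    then show ?thesis using chain_dist_local_lipschitz[OF True] by (simp add: dist_real_def)
  next
    case False
    have "1 \<le> 1 / \<delta> * dist x y" using False assms(1) by (simp add: field_simps)
    also have "\<dots> \<le> max B (1 / \<delta>) * dist x y" by (intro mult_right_mono) auto
    finally show ?thesis
      using chain_dist_bounds[of x] chain_dist_bounds[of y] by (auto simp: dist_real_def)
  qed
qed (use assms(1) in \<open>simp add: le_max_iff_disj\<close>)

lemma chain_dist_less_one:
  assumes "chain_dist g \<delta> E x < 1"
  obtains l c where "chain g \<delta> E x l c" "c \<le> 1"
proof -
  have "\<exists>c\<in>insert 1 {c. \<exists>l. chain g \<delta> E x l c}. c < 1"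
    using assms unfolding chain_dist_def
    by (intro cInf_lessD) auto
  then show ?thesis using that by force
qed

end

section \<open>Eilenberg's inequality\<close>

text \<open>This exponent shift is where the dimension drops: the missing factor
  \<open>diameter C\<close> is supplied by the length of the image of \<open>C\<close>.\<close>

lemma hausdorff_gauge_pred_mult:
  assumes N: "1 \<le> N" and "bounded C"
  shows "hausdorff_gauge (N - 1) C * ennreal (diameter C) = hausdorff_gauge N C"
proof -
  have d: "0 \<le> diameter C" using assms(2) by (rule diameter_ge_0)
  show ?thesis
  proof (cases "N = 1")
    case True
    then show ?thesis using d by (simp add: hausdorff_gauge_def)
  next
    case False
    have "diameter C powr (N - 1) * diameter C = diameter C powr N"
      using d by (cases "diameter C = 0") (simp_all add: powr_diff)
    then show ?thesis using False N d by (simp add: hausdorff_gauge_def flip: ennreal_mult)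
  qed
qed

text \<open>The fibre over \<open>t\<close> is covered by those members \<open>C\<close> of a cover of \<open>A\<close> with
  \<open>t \<in> v(C)\<close>, and \<open>v(C)\<close> has length at most \<open>L\<close> times the diameter of \<open>C\<close>. Measurability of the fibre
  measure in \<open>t\<close> is not known, hence the measurable majorant.\<close>

lemma eilenberg_set:
  fixes v :: "'a::metric_space \<Rightarrow> real" and A :: "'a set"
  assumes N: "1 \<le> N" and L: "0 \<le> L" and r: "0 < r"
    and lip: "\<And>x y. x \<in> A \<Longrightarrow> y \<in> A \<Longrightarrow> dist x y < r \<Longrightarrow> \<bar>v x - v y\<bar> \<le> L * dist x y"
    and fin: "hausdorff_outer N A < \<infinity>"
  obtains \<psi> where "\<psi> \<in> borel_measurable borel"
    "\<And>t. hausdorff_outer (N - 1) (A \<inter> {x. v x = t}) \<le> \<psi> t"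
    "(\<integral>\<^sup>+ t. \<psi> t \<partial>lborel)
      \<le> ennreal (2 * unit_ball_vol (N - 1) / unit_ball_vol N) * (ennreal L * hausdorff_outer N A)"
proof -
  define K where "K = (\<lambda>s::real. unit_ball_vol s / 2 powr s)"
  have K: "0 < K N" "0 < K (N - 1)" using N by (auto simp: K_def)
  \<comment> \<open>The 2 is \<open>2 powr N / 2 powr (N - 1)\<close>.\<close>
  have KK: "K (N - 1) / K N = 2 * unit_ball_vol (N - 1) / unit_ball_vol N"
    by (simp add: K_def powr_diff)
  \<comment> \<open>Staying at most \<open>r\<close> keeps the members small enough for the local
    Lipschitz bound.\<close>
  define \<delta> where "\<delta> = (\<lambda>k. min r (inverse (real (Suc k))))"
  have \<delta>: "0 < \<delta> k" "\<delta> k \<le> r" for k using r by (auto simp: \<delta>_def)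
  have \<delta>0: "filterlim \<delta> (at_right 0) sequentially"
  proof -
    have "\<delta> \<longlonglongrightarrow> min r 0" unfolding \<delta>_def
      by (intro tendsto_min tendsto_const LIMSEQ_inverse_real_of_nat)
    then show ?thesis using \<delta> r by (intro tendsto_imp_filterlim_at_right) auto
  qed
  have "\<exists>C\<in>hausdorff_covers (\<delta> k) A. ennreal (K N) * (\<Sum>i. hausdorff_gauge N (C i))
      < hausdorff_outer N A + ennreal (inverse (real (Suc k)))" for k
  proof -
    have "hausdorff_pre N (\<delta> k) A \<le> hausdorff_outer N A"
      using \<delta> by (auto simp: hausdorff_outer_def intro!: SUP_upper)
    also have "\<dots> < hausdorff_outer N A + ennreal (inverse (real (Suc k)))"
      using fin by simp
    finally have less: "hausdorff_pre N (\<delta> k) A < hausdorff_outer N A + ennreal (inverse (real (Suc k)))" .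
    show ?thesis
    \<comment> \<open>The infimum stands behind the positive factor \<open>K N\<close>, which is
      divided out before bounding it from below over all covers.\<close>
    proof (rule ccontr)
      let ?b = "hausdorff_outer N A + ennreal (inverse (real (Suc k)))"
      assume "\<not> ?thesis"
      then have ge: "?b \<le> ennreal (K N) * (\<Sum>i. hausdorff_gauge N (C i))" if "C \<in> hausdorff_covers (\<delta> k) A" for C
        using that by (auto simp: not_less)
      have KN: "ennreal (K N) * ennreal (inverse (K N)) = 1"
        using K by (simp flip: ennreal_mult)
      have "?b * ennreal (inverse (K N)) \<le> (\<Sum>i. hausdorff_gauge N (C i))" if "C \<in> hausdorff_covers (\<delta> k) A" for C
        using mult_right_mono[OF ge[OF that], of "ennreal (inverse (K N))"]
        by (simp add: KN mult.commute[of "ennreal (K N)" "suminf _"] mult.assoc)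
      then have "?b * ennreal (inverse (K N)) \<le> (INF C\<in>hausdorff_covers (\<delta> k) A. \<Sum>i. hausdorff_gauge N (C i))"
        by (rule INF_greatest)
      from mult_left_mono[OF this, of "ennreal (K N)"]
      have "?b \<le> ennreal (K N) * (INF C\<in>hausdorff_covers (\<delta> k) A. \<Sum>i. hausdorff_gauge N (C i))"
        by (simp add: KN mult.left_commute[of "ennreal (K N)"])
      then have "?b \<le> hausdorff_pre N (\<delta> k) A" by (simp only: hausdorff_pre_def K_def)
      with less show False by simp
    qed
  qed
  then obtain C' where C': "\<And>k. C' k \<in> hausdorff_covers (\<delta> k) A"
    and C's: "\<And>k. ennreal (K N) * (\<Sum>i. hausdorff_gauge N (C' k i)) < hausdorff_outer N A + ennreal (inverse (real (Suc k)))"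
    by metis
  define C where "C = (\<lambda>k i. C' k i \<inter> A)"
  have C: "C k \<in> hausdorff_covers (\<delta> k) A" for k
    unfolding C_def by (rule hausdorff_covers_Int[OF C']) simp
  have bC: "bounded (C k i)" and dC: "diameter (C k i) < \<delta> k" for k i
    using C[of k] by (auto simp: hausdorff_covers_def)
  have Cs: "ennreal (K N) * (\<Sum>i. hausdorff_gauge N (C k i)) \<le> hausdorff_outer N A + ennreal (inverse (real (Suc k)))" for k
  proof -
    have "hausdorff_gauge N (C k i) \<le> hausdorff_gauge N (C' k i)" for i
      using C'[of k] N unfolding C_def by (intro hausdorff_gauge_mono) (auto simp: hausdorff_covers_def)
    then have "ennreal (K N) * (\<Sum>i. hausdorff_gauge N (C k i)) \<le> ennreal (K N) * (\<Sum>i. hausdorff_gauge N (C' k i))"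
      by (intro mult_left_mono suminf_le) auto
    then show ?thesis using C's[of k] by simp
  qed
  \<comment> \<open>The interval hull of the image of \<open>C k i\<close> is Borel even if the
    image is not; \<open>Inf\<close> and \<open>Sup\<close> of the empty set carry no information,
    so that case is separate.\<close>
  define J where "J = (\<lambda>k i. if C k i = {} then {} else {Inf (v ` C k i)..Sup (v ` C k i)})"
  have vC: "v x \<le> v y + L * diameter (C k i)" if "x \<in> C k i" "y \<in> C k i" for x y k i
  proof -
    have d: "dist x y \<le> diameter (C k i)" using diameter_bounded_bound[OF bC that] .
    then have "\<bar>v x - v y\<bar> \<le> L * dist x y"
      using dC[of k i] \<delta>[of k] that by (intro lip) (auto simp: C_def)
    moreover have "L * dist x y \<le> L * diameter (C k i)" using d L by (rule mult_left_mono)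
    ultimately show ?thesis by simp
  qed
  have bdd: "bdd_above (v ` C k i)" "bdd_below (v ` C k i)" for k i
  proof -
    show "bdd_above (v ` C k i)"
    proof (cases "C k i = {}")
      case False
      then obtain y where "y \<in> C k i" by blast
      then show ?thesis using vC by (intro bdd_aboveI2[where M = "v y + L * diameter (C k i)"])
    qed simp
    show "bdd_below (v ` C k i)"
    proof (cases "C k i = {}")
      case False
      then obtain y where y: "y \<in> C k i" by blast
      show ?thesis
        using vC[OF y] by (intro bdd_belowI2[where m = "v y - L * diameter (C k i)"]) (simp add: algebra_simps)
    qed simp
  qed
  have J_mem: "v x \<in> J k i" if "x \<in> C k i" for x k i
    using that bdd[of k i] by (auto simp: J_def intro: cInf_lower cSup_upper)
  have J_len: "emeasure lborel (J k i) \<le> ennreal (L * diameter (C k i))" for k i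
  proof (cases "C k i = {}")
    case False
    have "Sup (v ` C k i) \<le> Inf (v ` C k i) + L * diameter (C k i)"
    proof (rule cSup_least)
      fix a assume "a \<in> v ` C k i"
      then obtain x where x: "x \<in> C k i" "a = v x" by blast
      have "v x - L * diameter (C k i) \<le> Inf (v ` C k i)"
        using False vC[OF x(1)] by (intro cInf_greatest) (auto simp: algebra_simps)
      then show "a \<le> Inf (v ` C k i) + L * diameter (C k i)" using x by simp
    qed (use False in simp)
    moreover have "Inf (v ` C k i) \<le> Sup (v ` C k i)"
      using False bdd by (intro cInf_le_cSup) auto
    ultimately show ?thesis using False by (simp add: J_def ennreal_leI)
  qed (simp add: J_def)
  have [measurable]: "J k i \<in> sets borel" for k i by (simp add: J_def)
  define \<phi> where "\<phi> = (\<lambda>k t. ennreal (K (N - 1)) * (\<Sum>i. hausdorff_gauge (N - 1) (C k i) * indicator (J k i) t))"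
  have [measurable]: "\<phi> k \<in> borel_measurable borel" for k
    unfolding \<phi>_def by measurable
  have pre_le: "hausdorff_pre (N - 1) (\<delta> k) (A \<inter> {x. v x = t}) \<le> \<phi> k t" for k t
  proof -
    let ?B = "A \<inter> {x. v x = t}"
    have "(\<lambda>i. C k i \<inter> ?B) \<in> hausdorff_covers (\<delta> k) ?B"
      by (rule hausdorff_covers_Int[OF C]) simp
    then have "(INF D\<in>hausdorff_covers (\<delta> k) ?B. \<Sum>i. hausdorff_gauge (N - 1) (D i))
        \<le> (\<Sum>i. hausdorff_gauge (N - 1) (C k i \<inter> ?B))"
      by (rule INF_lower)
    also have "\<dots> \<le> (\<Sum>i. hausdorff_gauge (N - 1) (C k i) * indicator (J k i) t)"
    proof (rule suminf_le)
      fix i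
      show "hausdorff_gauge (N - 1) (C k i \<inter> ?B) \<le> hausdorff_gauge (N - 1) (C k i) * indicator (J k i) t"
      proof (cases "C k i \<inter> ?B = {}")
        case False
        then have "t \<in> J k i" using J_mem by blast
        then show ?thesis using N bC by (simp add: hausdorff_gauge_mono)
      qed (simp add: hausdorff_gauge_def)
    qed auto
    finally show ?thesis
      unfolding hausdorff_pre_def \<phi>_def K_def by (rule mult_left_mono) simp
  qed
  have int_\<phi>: "(\<integral>\<^sup>+ t. \<phi> k t \<partial>lborel) \<le> ennreal (K (N - 1) / K N * L) * (hausdorff_outer N A + ennreal (inverse (real (Suc k))))" for k
  proof -
    have "(\<integral>\<^sup>+ t. \<phi> k t \<partial>lborel) = ennreal (K (N - 1)) * (\<Sum>i. hausdorff_gauge (N - 1) (C k i) * emeasure lborel (J k i))"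
      unfolding \<phi>_def by (simp add: nn_integral_cmult nn_integral_suminf nn_integral_cmult_indicator)
    also have "\<dots> \<le> ennreal (K (N - 1)) * (\<Sum>i. ennreal L * hausdorff_gauge N (C k i))"
    proof (intro mult_left_mono suminf_le)
      fix i
      have "hausdorff_gauge (N - 1) (C k i) * emeasure lborel (J k i)
          \<le> hausdorff_gauge (N - 1) (C k i) * (ennreal L * ennreal (diameter (C k i)))"
        using J_len[of k i] L diameter_ge_0[OF bC, of k i] by (intro mult_left_mono) (auto simp: ennreal_mult)
      also have "\<dots> = ennreal L * hausdorff_gauge N (C k i)"
        using hausdorff_gauge_pred_mult[OF N bC, of k i] by (simp add: mult_ac)
      finally show "hausdorff_gauge (N - 1) (C k i) * emeasure lborel (J k i) \<le> ennreal L * hausdorff_gauge N (C k i)" .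
    qed auto
    also have "\<dots> = ennreal (K (N - 1) / K N * L) * (ennreal (K N) * (\<Sum>i. hausdorff_gauge N (C k i)))"
    proof -
      have "ennreal (K (N - 1)) * ennreal L = ennreal (K (N - 1) / K N * L) * ennreal (K N)"
        using K L by (simp flip: ennreal_mult)
      then show ?thesis by (simp add: mult.assoc[symmetric])
    qed
    also have "\<dots> \<le> ennreal (K (N - 1) / K N * L) * (hausdorff_outer N A + ennreal (inverse (real (Suc k))))"
      using Cs by (rule mult_left_mono) simp
    finally show ?thesis .
  qed
  show thesis
  proof
    \<comment> \<open>Each \<open>\<phi> k\<close> belongs to a cover of mesh
      \<open>\<delta> k\<close>. The liminf dominates the limit of the premeasures of the fibre, and
      Fatou's lemma passes the integral bound on.\<close>
    show "(\<lambda>t. liminf (\<lambda>k. \<phi> k t)) \<in> borel_measurable borel" by measurable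
    fix t
    have "(\<lambda>k. hausdorff_pre (N - 1) (\<delta> k) (A \<inter> {x. v x = t})) \<longlonglongrightarrow> hausdorff_outer (N - 1) (A \<inter> {x. v x = t})"
      using filterlim_compose[OF hausdorff_outer_tendsto \<delta>0] .
    then have "hausdorff_outer (N - 1) (A \<inter> {x. v x = t}) = liminf (\<lambda>k. hausdorff_pre (N - 1) (\<delta> k) (A \<inter> {x. v x = t}))"
      by (intro lim_imp_Liminf[symmetric]) auto
    also have "\<dots> \<le> liminf (\<lambda>k. \<phi> k t)"
      by (intro Liminf_mono always_eventually allI pre_le)
    finally show "hausdorff_outer (N - 1) (A \<inter> {x. v x = t}) \<le> liminf (\<lambda>k. \<phi> k t)" .
  next
    have "(\<integral>\<^sup>+ t. liminf (\<lambda>k. \<phi> k t) \<partial>lborel) \<le> liminf (\<lambda>k. \<integral>\<^sup>+ t. \<phi> k t \<partial>lborel)"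
      by (rule nn_integral_liminf) simp
    also have "\<dots> \<le> liminf (\<lambda>k. ennreal (K (N - 1) / K N * L) * (hausdorff_outer N A + ennreal (inverse (real (Suc k)))))"
      by (intro Liminf_mono always_eventually allI int_\<phi>)
    also have "\<dots> = ennreal (K (N - 1) / K N * L) * (hausdorff_outer N A + 0)"
    proof (rule lim_imp_Liminf)
      have "(\<lambda>k. ennreal (inverse (real (Suc k)))) \<longlonglongrightarrow> ennreal 0"
        by (intro tendsto_ennrealI LIMSEQ_inverse_real_of_nat)
      then show "(\<lambda>k. ennreal (K (N - 1) / K N * L) * (hausdorff_outer N A + ennreal (inverse (real (Suc k)))))
          \<longlonglongrightarrow> ennreal (K (N - 1) / K N * L) * (hausdorff_outer N A + 0)"
        by (intro ennreal_tendsto_cmult tendsto_add tendsto_const) auto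
    qed simp
    also have "\<dots> = ennreal (2 * unit_ball_vol (N - 1) / unit_ball_vol N) * (ennreal L * hausdorff_outer N A)"
      unfolding KK by (subst ennreal_mult) (use L N in \<open>auto simp: mult.assoc\<close>)
    finally show "(\<integral>\<^sup>+ t. liminf (\<lambda>k. \<phi> k t) \<partial>lborel)
        \<le> ennreal (2 * unit_ball_vol (N - 1) / unit_ball_vol N) * (ennreal L * hausdorff_outer N A)" .
  qed
qed

section \<open>Variable Lipschitz constants and weights\<close>

context
  fixes N :: real and v g :: "'a::metric_space \<Rightarrow> real" and r \<epsilon> :: real
  assumes N: "1 \<le> N" and fin: "emeasure (hausdorff N) (UNIV :: 'a set) < \<infinity>"
    and g [measurable]: "g \<in> borel_measurable borel" and g0: "\<And>x. 0 \<le> g x" and r: "0 < r" and \<epsilon>: "0 < \<epsilon>"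
    and lip: "\<And>x y. dist x y < r \<Longrightarrow> \<bar>v x - v y\<bar> \<le> max (g x) (g y) * dist x y"
begin

private abbreviation (input) "c\<^sub>N \<equiv> ennreal (2 * unit_ball_vol (N - 1) / unit_ball_vol N)"

lemma measurable_weighted:
  fixes k :: "'a \<Rightarrow> ennreal"
  assumes [measurable]: "k \<in> borel_measurable borel"
  shows "(\<lambda>x. k x * (ennreal (g x) + ennreal \<epsilon>)) \<in> borel_measurable (hausdorff N)"
proof (rule borel_measurable_hausdorff)
  show "(\<lambda>x. k x * (ennreal (g x) + ennreal \<epsilon>)) \<in> borel_measurable borel" by measurable
qed (use N in simp)

text \<open>Slice \<open>B\<close> where \<open>g\<close> lies between consecutive multiples of
  \<epsilon>: on a slice the constant \<open>real (Suc m) * \<epsilon>\<close> is a local Lipschitz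
  bound and exceeds \<open>g\<close> by at most \<epsilon>, so summing over the slices loses only
  \<epsilon> in the weight.\<close>

lemma eilenberg_indicator:
  assumes B [measurable]: "B \<in> sets borel"
  obtains \<psi> where "\<psi> \<in> borel_measurable borel"
    "\<And>t. hausdorff_outer (N - 1) (B \<inter> {x. v x = t}) \<le> \<psi> t"
    "(\<integral>\<^sup>+ t. \<psi> t \<partial>lborel) \<le> c\<^sub>N * (\<integral>\<^sup>+ x. indicator B x * (ennreal (g x) + ennreal \<epsilon>) \<partial>hausdorff N)"
proof -
  have bor: "sets borel \<subseteq> sets (hausdorff N :: 'a measure)" using N by (intro sets_borel_le_hausdorff) simp
  define A where "A = (\<lambda>m::nat. B \<inter> {x. real m * \<epsilon> \<le> g x \<and> g x < real (Suc m) * \<epsilon>})"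
  have Ab [measurable]: "A m \<in> sets borel" for m unfolding A_def by measurable
  have A_outer: "hausdorff_outer N (A m) = emeasure (hausdorff N) (A m)" for m
    using Ab bor by (subst emeasure_hausdorff) auto
  have "\<exists>\<psi>. \<psi> \<in> borel_measurable borel \<and> (\<forall>t. hausdorff_outer (N - 1) (A m \<inter> {x. v x = t}) \<le> \<psi> t) \<and>
    (\<integral>\<^sup>+ t. \<psi> t \<partial>lborel) \<le> c\<^sub>N * (ennreal (real (Suc m) * \<epsilon>) * hausdorff_outer N (A m))" for m
  proof (rule eilenberg_set[OF N _ r, of "real (Suc m) * \<epsilon>" "A m" v])
    fix x y assume "x \<in> A m" "y \<in> A m" "dist x y < r"
    moreover from this have "max (g x) (g y) * dist x y \<le> real (Suc m) * \<epsilon> * dist x y"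
      by (intro mult_right_mono) (auto simp: A_def)
    ultimately show "\<bar>v x - v y\<bar> \<le> real (Suc m) * \<epsilon> * dist x y" using lip[of x y] by simp
  next
    show "hausdorff_outer N (A m) < \<infinity>"
      unfolding A_outer using emeasure_space[of "hausdorff N" "A m"] fin by (simp add: le_less_trans)
  qed (use \<epsilon> in auto)
  then obtain \<psi> where \<psi> [measurable]: "\<And>m. \<psi> m \<in> borel_measurable borel"
    and \<psi>_ge: "\<And>m t. hausdorff_outer (N - 1) (A m \<inter> {x. v x = t}) \<le> \<psi> m t"
    and \<psi>_int: "\<And>m. (\<integral>\<^sup>+ t. \<psi> m t \<partial>lborel) \<le> c\<^sub>N * (ennreal (real (Suc m) * \<epsilon>) * hausdorff_outer N (A m))"
    by metis
  \<comment> \<open>The slices are disjoint, the index being a rounded-down quotient; so their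
    indicators add up to that of \<open>B\<close>.\<close>
  have level: "x \<in> A m \<longleftrightarrow> x \<in> B \<and> m = nat \<lfloor>g x / \<epsilon>\<rfloor>" for x m
  proof -
    have "real m * \<epsilon> \<le> g x \<and> g x < real (Suc m) * \<epsilon> \<longleftrightarrow> real m \<le> g x / \<epsilon> \<and> g x / \<epsilon> < real m + 1"
      using \<epsilon> by (simp add: field_simps)
    also have "\<dots> \<longleftrightarrow> \<lfloor>g x / \<epsilon>\<rfloor> = int m" by (simp add: floor_eq_iff)
    also have "\<dots> \<longleftrightarrow> m = nat \<lfloor>g x / \<epsilon>\<rfloor>" using g0[of x] \<epsilon> by auto
    finally show ?thesis by (auto simp: A_def)
  qed
  have B_eq: "B = (\<Union>m. A m)" by (auto simp: level)
  show thesis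
  proof
    show "(\<lambda>t. \<Sum>m. \<psi> m t) \<in> borel_measurable borel" by measurable
    fix t
    have "B \<inter> {x. v x = t} = (\<Union>m. A m \<inter> {x. v x = t})" using B_eq by auto
    then have "hausdorff_outer (N - 1) (B \<inter> {x. v x = t}) \<le> (\<Sum>m. hausdorff_outer (N - 1) (A m \<inter> {x. v x = t}))"
      using hausdorff_outer_UN by metis
    also have "\<dots> \<le> (\<Sum>m. \<psi> m t)" using \<psi>_ge by (intro suminf_le) auto
    finally show "hausdorff_outer (N - 1) (B \<inter> {x. v x = t}) \<le> (\<Sum>m. \<psi> m t)" .
  next
    have meas: "(\<lambda>x. indicator (A m) x * (ennreal (g x) + ennreal \<epsilon>)) \<in> borel_measurable (hausdorff N)" for m
      by (intro measurable_weighted borel_measurable_indicator Ab)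
    have "(\<integral>\<^sup>+ t. (\<Sum>m. \<psi> m t) \<partial>lborel) = (\<Sum>m. \<integral>\<^sup>+ t. \<psi> m t \<partial>lborel)"
      by (rule nn_integral_suminf) simp
    also have "\<dots> \<le> (\<Sum>m. c\<^sub>N * (\<integral>\<^sup>+ x. indicator (A m) x * (ennreal (g x) + ennreal \<epsilon>) \<partial>hausdorff N))"
    proof (rule suminf_le)
      fix m
      have "ennreal (real (Suc m) * \<epsilon>) * hausdorff_outer N (A m)
          = (\<integral>\<^sup>+ x. ennreal (real (Suc m) * \<epsilon>) * indicator (A m) x \<partial>hausdorff N)"
        unfolding A_outer using Ab bor by (subst nn_integral_cmult_indicator) auto
      also have "\<dots> \<le> (\<integral>\<^sup>+ x. indicator (A m) x * (ennreal (g x) + ennreal \<epsilon>) \<partial>hausdorff N)"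
      proof (rule nn_integral_mono)
        fix x
        show "ennreal (real (Suc m) * \<epsilon>) * indicator (A m) x \<le> indicator (A m) x * (ennreal (g x) + ennreal \<epsilon>)"
        proof (cases "x \<in> A m")
          case True
          then have "real (Suc m) * \<epsilon> \<le> g x + \<epsilon>" by (simp add: A_def algebra_simps)
          then have "ennreal (real (Suc m) * \<epsilon>) \<le> ennreal (g x + \<epsilon>)" by (rule ennreal_leI)
          also have "\<dots> = ennreal (g x) + ennreal \<epsilon>" using g0[of x] \<epsilon> by (intro ennreal_plus) auto
          finally show ?thesis using True by simp
        qed simp
      qed
      finally show "(\<integral>\<^sup>+ t. \<psi> m t \<partial>lborel) \<le> c\<^sub>N * (\<integral>\<^sup>+ x. indicator (A m) x * (ennreal (g x) + ennreal \<epsilon>) \<partial>hausdorff N)"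
        by (intro order_trans[OF \<psi>_int] mult_left_mono) auto
    qed auto
    also have "\<dots> = c\<^sub>N * (\<integral>\<^sup>+ x. (\<Sum>m. indicator (A m) x * (ennreal (g x) + ennreal \<epsilon>)) \<partial>hausdorff N)"
      unfolding ennreal_suminf_cmult by (subst nn_integral_suminf[OF meas]) simp
    also have "(\<lambda>x. (\<Sum>m. indicator (A m) x * (ennreal (g x) + ennreal \<epsilon>)))
        = (\<lambda>x. indicator B x * (ennreal (g x) + ennreal \<epsilon>))"
    proof
      fix x
      have "(\<Sum>m. indicator (A m) x * (ennreal (g x) + ennreal \<epsilon>))
          = (\<Sum>m\<in>{nat \<lfloor>g x / \<epsilon>\<rfloor>}. indicator (A m) x * (ennreal (g x) + ennreal \<epsilon>))"
        by (rule suminf_finite) (auto simp: level)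
      then show "(\<Sum>m. indicator (A m) x * (ennreal (g x) + ennreal \<epsilon>)) = indicator B x * (ennreal (g x) + ennreal \<epsilon>)"
        by (simp add: indicator_def level)
    qed
    finally show "(\<integral>\<^sup>+ t. (\<Sum>m. \<psi> m t) \<partial>lborel) \<le> c\<^sub>N * (\<integral>\<^sup>+ x. indicator B x * (ennreal (g x) + ennreal \<epsilon>) \<partial>hausdorff N)" .
  qed
qed

lemma measurable_on_fibre:
  fixes k :: "'a \<Rightarrow> ennreal"
  assumes v: "continuous_on UNIV v" and [measurable]: "k \<in> borel_measurable borel"
  shows "(\<lambda>x. k x * indicator {x. v x = t} x) \<in> borel_measurable (hausdorff (N - 1))"
proof (rule borel_measurable_hausdorff)
  have [measurable]: "{x. v x = t} \<in> sets borel"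
    by (intro borel_closed closed_Collect_eq[OF v continuous_on_const])
  show "(\<lambda>x. k x * indicator {x. v x = t} x) \<in> borel_measurable borel" by measurable
qed (use N in simp)

text \<open>The majorant \<psi> is carried through the induction over indicators, sums and monotone
  limits, so that every integral over \<open>t\<close> is one of a measurable function.\<close>

lemma eilenberg_function:
  fixes \<rho> :: "'a \<Rightarrow> ennreal"
  assumes v: "continuous_on UNIV v" and \<rho>: "\<rho> \<in> borel_measurable borel"
  shows "\<exists>\<psi>. \<psi> \<in> borel_measurable borel \<and>
    (\<forall>t. (\<integral>\<^sup>+ x \<in> {x. v x = t}. \<rho> x \<partial>hausdorff (N - 1)) \<le> \<psi> t) \<and>
    (\<integral>\<^sup>+ t. \<psi> t \<partial>lborel) \<le> c\<^sub>N * (\<integral>\<^sup>+ x. \<rho> x * (ennreal (g x) + ennreal \<epsilon>) \<partial>hausdorff N)"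
  using \<rho>
proof (induction rule: borel_measurable_induct)
  case (cong f h)
  then have "f = h" by auto
  then show ?case using cong by simp
next
  case (set B)
  have bor: "sets borel \<subseteq> sets (hausdorff (N - 1) :: 'a measure)" using N by (intro sets_borel_le_hausdorff) simp
  have cl: "closed {x. v x = t}" for t
    by (rule closed_Collect_eq[OF v continuous_on_const])
  obtain \<psi> where \<psi>: "\<psi> \<in> borel_measurable borel"
    "\<And>t. hausdorff_outer (N - 1) (B \<inter> {x. v x = t}) \<le> \<psi> t"
    "(\<integral>\<^sup>+ t. \<psi> t \<partial>lborel) \<le> c\<^sub>N * (\<integral>\<^sup>+ x. indicator B x * (ennreal (g x) + ennreal \<epsilon>) \<partial>hausdorff N)"
    using eilenberg_indicator[OF set] by blast
  have "(\<integral>\<^sup>+ x \<in> {x. v x = t}. indicator B x \<partial>hausdorff (N - 1)) = hausdorff_outer (N - 1) (B \<inter> {x. v x = t})" for t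
  proof -
    have "B \<inter> {x. v x = t} \<in> sets (hausdorff (N - 1))"
      using set borel_closed[OF cl] by (intro subsetD[OF bor] sets.Int)
    moreover have "(\<integral>\<^sup>+ x \<in> {x. v x = t}. indicator B x \<partial>hausdorff (N - 1))
        = (\<integral>\<^sup>+ x. indicator (B \<inter> {x. v x = t}) x \<partial>hausdorff (N - 1))"
      by (intro nn_integral_cong) (auto simp: indicator_def)
    ultimately show ?thesis by (simp add: emeasure_hausdorff)
  qed
  then show ?case using \<psi> by (intro exI[of _ \<psi>]) auto
next
  case (mult f c)
  then obtain \<psi> where \<psi> [measurable]: "\<psi> \<in> borel_measurable borel"
    and le: "\<And>t. (\<integral>\<^sup>+ x \<in> {x. v x = t}. f x \<partial>hausdorff (N - 1)) \<le> \<psi> t"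
    and int: "(\<integral>\<^sup>+ t. \<psi> t \<partial>lborel) \<le> c\<^sub>N * (\<integral>\<^sup>+ x. f x * (ennreal (g x) + ennreal \<epsilon>) \<partial>hausdorff N)"
    by blast
  note [measurable] = mult.hyps(2)
  note m1 = measurable_on_fibre[OF v mult.hyps(2)]
  note m2 = measurable_weighted[OF mult.hyps(2)]
  show ?case
  proof (intro exI[of _ "\<lambda>t. c * \<psi> t"] conjI allI)
    show "(\<lambda>t. c * \<psi> t) \<in> borel_measurable borel" by measurable
    show "(\<integral>\<^sup>+ x \<in> {x. v x = t}. (c * f x) \<partial>hausdorff (N - 1)) \<le> c * \<psi> t" for t
      using mult_left_mono[OF le[of t], of c] by (simp add: mult.assoc nn_integral_cmult[OF m1])
    have "(\<integral>\<^sup>+ x. c * f x * (ennreal (g x) + ennreal \<epsilon>) \<partial>hausdorff N)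
        = c * (\<integral>\<^sup>+ x. f x * (ennreal (g x) + ennreal \<epsilon>) \<partial>hausdorff N)"
      by (simp add: mult.assoc nn_integral_cmult[OF m2])
    then show "(\<integral>\<^sup>+ t. c * \<psi> t \<partial>lborel) \<le> c\<^sub>N * (\<integral>\<^sup>+ x. c * f x * (ennreal (g x) + ennreal \<epsilon>) \<partial>hausdorff N)"
      using mult_left_mono[OF int, of c] by (simp add: nn_integral_cmult mult.left_commute[of c])
  qed
next
  case (add f h)
  then obtain \<psi> \<psi>' where \<psi> [measurable]: "\<psi> \<in> borel_measurable borel" "\<psi>' \<in> borel_measurable borel"
    and le: "\<And>t. (\<integral>\<^sup>+ x \<in> {x. v x = t}. f x \<partial>hausdorff (N - 1)) \<le> \<psi> t"
      "\<And>t. (\<integral>\<^sup>+ x \<in> {x. v x = t}. h x \<partial>hausdorff (N - 1)) \<le> \<psi>' t"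
    and int: "(\<integral>\<^sup>+ t. \<psi> t \<partial>lborel) \<le> c\<^sub>N * (\<integral>\<^sup>+ x. f x * (ennreal (g x) + ennreal \<epsilon>) \<partial>hausdorff N)"
      "(\<integral>\<^sup>+ t. \<psi>' t \<partial>lborel) \<le> c\<^sub>N * (\<integral>\<^sup>+ x. h x * (ennreal (g x) + ennreal \<epsilon>) \<partial>hausdorff N)"
    by blast
  note m1 = measurable_on_fibre[OF v]
  note m2 = measurable_weighted
  note fh = add.hyps(1) add.hyps(3)
  show ?case
  proof (intro exI[of _ "\<lambda>t. \<psi>' t + \<psi> t"] conjI allI)
    show "(\<lambda>t. \<psi>' t + \<psi> t) \<in> borel_measurable borel" by measurable
    show "(\<integral>\<^sup>+ x \<in> {x. v x = t}. (h x + f x) \<partial>hausdorff (N - 1)) \<le> \<psi>' t + \<psi> t" for t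
      using add_mono[OF le(2)[of t] le(1)[of t]]
      by (simp add: distrib_right nn_integral_add m1 fh)
    show "(\<integral>\<^sup>+ t. \<psi>' t + \<psi> t \<partial>lborel) \<le> c\<^sub>N * (\<integral>\<^sup>+ x. (h x + f x) * (ennreal (g x) + ennreal \<epsilon>) \<partial>hausdorff N)"
      using add_mono[OF int(2) int(1)]
      by (simp add: distrib_right nn_integral_add m2 fh distrib_left[of "c\<^sub>N"])
  qed
next
  case (seq U)
  from seq.IH have "\<forall>n. \<exists>\<psi>. \<psi> \<in> borel_measurable borel \<and>
    (\<forall>t. (\<integral>\<^sup>+ x \<in> {x. v x = t}. U n x \<partial>hausdorff (N - 1)) \<le> \<psi> t) \<and>
    (\<integral>\<^sup>+ t. \<psi> t \<partial>lborel) \<le> c\<^sub>N * (\<integral>\<^sup>+ x. U n x * (ennreal (g x) + ennreal \<epsilon>) \<partial>hausdorff N)" by simp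
  from choice[OF this] obtain \<psi> where all: "\<forall>n. \<psi> n \<in> borel_measurable borel \<and>
    (\<forall>t. (\<integral>\<^sup>+ x \<in> {x. v x = t}. U n x \<partial>hausdorff (N - 1)) \<le> \<psi> n t) \<and>
    (\<integral>\<^sup>+ t. \<psi> n t \<partial>lborel) \<le> c\<^sub>N * (\<integral>\<^sup>+ x. U n x * (ennreal (g x) + ennreal \<epsilon>) \<partial>hausdorff N)"
    by (rule exE)
  have \<psi> [measurable]: "\<psi> n \<in> borel_measurable borel"
    and le: "(\<integral>\<^sup>+ x \<in> {x. v x = t}. U n x \<partial>hausdorff (N - 1)) \<le> \<psi> n t"
    and int: "(\<integral>\<^sup>+ t. \<psi> n t \<partial>lborel) \<le> c\<^sub>N * (\<integral>\<^sup>+ x. U n x * (ennreal (g x) + ennreal \<epsilon>) \<partial>hausdorff N)" for n t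
    using all by simp_all
  have U_le: "U n x \<le> (SUP i. U i) x" for n x by (auto intro: SUP_upper)
  have Um: "U m x \<le> U n x" if "m \<le> n" for m n x
    using \<open>incseq U\<close> that by (auto simp: incseq_def le_fun_def)
  note m1 = measurable_on_fibre[OF v seq.hyps(1)]
  show ?case
  \<comment> \<open>The \<open>\<psi> n\<close> are chosen separately and need not increase with
    \<open>n\<close>, so liminf and Fatou's lemma take the place of monotone convergence.\<close>
  proof (intro exI[of _ "\<lambda>t. liminf (\<lambda>n. \<psi> n t)"] conjI allI)
    show "(\<lambda>t. liminf (\<lambda>n. \<psi> n t)) \<in> borel_measurable borel" by measurable
    show "(\<integral>\<^sup>+ x \<in> {x. v x = t}. (SUP i. U i) x \<partial>hausdorff (N - 1)) \<le> liminf (\<lambda>n. \<psi> n t)" for t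
    proof -
      let ?I = "\<lambda>n. \<integral>\<^sup>+ x \<in> {x. v x = t}. U n x \<partial>hausdorff (N - 1)"
      have "(\<integral>\<^sup>+ x \<in> {x. v x = t}. (SUP i. U i) x \<partial>hausdorff (N - 1))
          = (\<integral>\<^sup>+ x. (SUP n. U n x * indicator {x. v x = t} x) \<partial>hausdorff (N - 1))"
        by (simp add: SUP_mult_right_ennreal image_comp comp_def)
      also have "\<dots> = (SUP n. ?I n)"
      proof (rule nn_integral_monotone_convergence_SUP[OF _ m1])
        show "incseq (\<lambda>n x. U n x * indicator {x. v x = t} x)"
          using Um by (auto simp: incseq_def le_fun_def intro!: mult_right_mono)
      qed
      also have "\<dots> = liminf ?I"
      proof (rule lim_imp_Liminf[symmetric, OF _ LIMSEQ_SUP])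
        show "incseq ?I" using Um by (auto simp: incseq_def intro!: nn_integral_mono mult_right_mono)
      qed simp
      also have "\<dots> \<le> liminf (\<lambda>n. \<psi> n t)" by (intro Liminf_mono always_eventually allI le)
      finally show ?thesis .
    qed
    have "(\<integral>\<^sup>+ t. liminf (\<lambda>n. \<psi> n t) \<partial>lborel) \<le> liminf (\<lambda>n. \<integral>\<^sup>+ t. \<psi> n t \<partial>lborel)"
      by (rule nn_integral_liminf) simp
    also have "\<dots> \<le> liminf (\<lambda>n::nat. c\<^sub>N * (\<integral>\<^sup>+ x. (SUP i. U i) x * (ennreal (g x) + ennreal \<epsilon>) \<partial>hausdorff N))"
      using U_le by (intro Liminf_mono always_eventually allI order_trans[OF int] mult_left_mono nn_integral_mono mult_right_mono) auto
    also have "\<dots> = c\<^sub>N * (\<integral>\<^sup>+ x. (SUP i. U i) x * (ennreal (g x) + ennreal \<epsilon>) \<partial>hausdorff N)"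
      by (rule Liminf_const) simp
    finally show "(\<integral>\<^sup>+ t. liminf (\<lambda>n. \<psi> n t) \<partial>lborel)
        \<le> c\<^sub>N * (\<integral>\<^sup>+ x. (SUP i. U i) x * (ennreal (g x) + ennreal \<epsilon>) \<partial>hausdorff N)" .
  qed
qed

text \<open>By continuity the frontier of \<open>{v < t}\<close> lies in the fibre over
  \<open>t\<close>. Since \<open>nn_integral\<close> is monotone for arbitrary integrands, the
  comparison with \<psi> is legitimate whether or not the fibre integral is measurable in
  \<open>t\<close>.\<close>

lemma coarea_frontier_le:
  fixes \<rho> :: "'a \<Rightarrow> ennreal"
  assumes v: "continuous_on UNIV v" and \<rho>: "\<rho> \<in> borel_measurable borel"
  shows "(\<integral>\<^sup>+ t \<in> {0..1}. (\<integral>\<^sup>+ x \<in> frontier {x. v x < t}. \<rho> x \<partial>hausdorff (N - 1)) \<partial>lebesgue)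
    \<le> c\<^sub>N * (\<integral>\<^sup>+ x. \<rho> x * (ennreal (g x) + ennreal \<epsilon>) \<partial>hausdorff N)"
proof -
  obtain \<psi> where \<psi>: "\<psi> \<in> borel_measurable borel"
    "\<And>t. (\<integral>\<^sup>+ x \<in> {x. v x = t}. \<rho> x \<partial>hausdorff (N - 1)) \<le> \<psi> t"
    "(\<integral>\<^sup>+ t. \<psi> t \<partial>lborel) \<le> c\<^sub>N * (\<integral>\<^sup>+ x. \<rho> x * (ennreal (g x) + ennreal \<epsilon>) \<partial>hausdorff N)"
    using eilenberg_function[OF v \<rho>] by blast
  have fr: "frontier {x. v x < t} \<subseteq> {x. v x = t}" for t
  proof -
    have "open {x. v x < t}" by (rule open_Collect_less[OF v continuous_on_const])
    moreover have "closure {x. v x < t} \<subseteq> {x. v x \<le> t}"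
      by (rule closure_minimal) (auto intro: closed_Collect_le[OF v continuous_on_const])
    ultimately show ?thesis by (auto simp: frontier_def interior_open)
  qed
  have "(\<integral>\<^sup>+ t \<in> {0..1}. (\<integral>\<^sup>+ x \<in> frontier {x. v x < t}. \<rho> x \<partial>hausdorff (N - 1)) \<partial>lebesgue)
      \<le> (\<integral>\<^sup>+ t. \<psi> t \<partial>lebesgue)"
  proof (rule nn_integral_mono)
    fix t :: real
    have "(\<integral>\<^sup>+ x \<in> frontier {x. v x < t}. \<rho> x \<partial>hausdorff (N - 1)) \<le> \<psi> t"
      by (intro order_trans[OF _ \<psi>(2)] nn_integral_mono mult_left_mono) (use fr[of t] in \<open>auto simp: indicator_def\<close>)
    then show "(\<integral>\<^sup>+ x \<in> frontier {x. v x < t}. \<rho> x \<partial>hausdorff (N - 1)) * indicator {0..1} t \<le> \<psi> t"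
      by (auto simp: indicator_def)
  qed
  also have "\<dots> = (\<integral>\<^sup>+ t. \<psi> t \<partial>lborel)" by (rule nn_integral_completion)
  also note \<psi>(3)
  finally show ?thesis .
qed

end

section \<open>Lipschitz functions with prescribed energy\<close>

lemma ennpow_add_le:
  assumes "0 < p"
  shows "ennpow (x + y) p \<le> ennreal (2 powr p) * (ennpow x p + ennpow y p)"
proof -
  have "x + y \<le> 2 * max x y" by (simp add: mult_2 add_mono)
  then have "ennpow (x + y) p \<le> ennpow (ennreal 2 * max x y) p"
    using assms by (intro ennpow_mono) auto
  also have "\<dots> = ennreal (2 powr p) * ennpow (max x y) p"
    using assms by (simp add: ennpow_mult ennpow_ennreal del: ennreal_numeral)
  also have "\<dots> \<le> ennreal (2 powr p) * (ennpow x p + ennpow y p)"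
    by (intro mult_left_mono) (auto simp: max_def add_increasing add_increasing2)
  finally show ?thesis .
qed

text \<open>\<open>(p - 1) * (q - 1) = 1\<close> is conjugacy without fractions. If
  \<open>y \<le> \<delta> * x powr (q - 1)\<close>, the first term suffices; otherwise
  \<open>x\<close> is at most \<open>(y / \<delta>) powr (p - 1)\<close> and the second
  does.\<close>

lemma ennreal_young:
  assumes q: "1 < q" and pq: "(p - 1) * (q - 1) = 1" and \<delta>: "0 < \<delta>"
  shows "a * b \<le> ennreal \<delta> * ennpow a q + ennreal (\<delta> powr (1 - p)) * ennpow b p"
proof (cases a; cases b)
  fix x y :: real assume xy: "a = ennreal x" "0 \<le> x" "b = ennreal y" "0 \<le> y"
  have p1: "0 < p - 1" using pq q by (metis diff_gt_0_iff_gt zero_less_mult_pos2 zero_less_one)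
  have "x * y \<le> \<delta> * x powr q + \<delta> powr (1 - p) * y powr p"
  proof (cases "y \<le> \<delta> * x powr (q - 1)")
    case True
    then have "x * y \<le> x * (\<delta> * x powr (q - 1))" using xy by (intro mult_left_mono)
    also have "\<dots> = \<delta> * x powr q"
      using xy by (cases "x = 0") (simp_all add: powr_diff)
    finally show ?thesis by (simp add: add_increasing2)
  next
    case False
    then have "x powr (q - 1) \<le> y / \<delta>" using \<delta> by (simp add: field_simps)
    then have "(x powr (q - 1)) powr (p - 1) \<le> (y / \<delta>) powr (p - 1)"
      using p1 by (intro powr_mono2) auto
    moreover have "(x powr (q - 1)) powr (p - 1) = x"
      using xy pq by (simp add: powr_powr mult.commute)
    moreover have "(y / \<delta>) powr (p - 1) * y = \<delta> powr (1 - p) * y powr p"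
      using xy \<delta> by (cases "y = 0") (simp_all add: powr_divide powr_diff)
    ultimately have "x * y \<le> \<delta> powr (1 - p) * y powr p"
      using xy by (metis mult_right_mono)
    then show ?thesis using \<delta> by (simp add: add_increasing)
  qed
  then have "ennreal (x * y) \<le> ennreal (\<delta> * x powr q + \<delta> powr (1 - p) * y powr p)" by (rule ennreal_leI)
  then show ?thesis using xy \<delta> by (simp add: ennpow_ennreal ennreal_mult)
next
  fix x assume *: "a = ennreal x" "0 \<le> x" "b = top"
  show ?thesis using * \<delta> by (cases "x = 0") (simp_all add: ennreal_mult_top)
qed (use \<delta> in \<open>simp_all add: ennreal_mult_top\<close>)

text \<open>The point is the order of choices: \<open>K\<close> depends on \<rho> and \<delta>,
  never on \<open>k\<close>, so perturbations with small \<open>p\<close>-integral change the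
  weighted integral little. For \<open>q = \<infinity>\<close>, hence \<open>p = 1\<close>,
  \<open>K\<close> is an essential bound of \<rho>; otherwise Young's inequality applies with its
  parameter scaled by the \<open>q\<close>-integral of \<rho>.\<close>

lemma integral_mult_le_Lp:
  fixes \<rho> :: "'a::metric_space \<Rightarrow> ennreal"
  assumes p: "1 \<le> p" and q: "1 < q" and pq: "inverse (ennreal p) + inverse q = 1" and \<delta>: "0 < (\<delta>::real)"
    and bor: "sets borel \<subseteq> sets M" and \<rho>: "\<rho> \<in> borel_measurable borel"
    and \<rho>q: "(\<lambda>x. enn2ereal (\<rho> x)) \<in> Lp_space q M"
  obtains K :: real where "0 \<le> K" "\<And>k. k \<in> borel_measurable borel \<Longrightarrow>
    (\<integral>\<^sup>+ x. \<rho> x * k x \<partial>M) \<le> ennreal \<delta> + ennreal K * (\<integral>\<^sup>+ x. ennpow (k x) p \<partial>M)"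
proof -
  have meas: "f \<in> borel_measurable M" if "f \<in> borel_measurable borel" for f :: "'a \<Rightarrow> ennreal"
    using that bor sets_eq_imp_space_eq[of M M] sets.sets_into_space[of UNIV M] by (auto simp: measurable_def)
  have ip: "inverse (ennreal p) = ennreal (inverse p)" using p by (intro inverse_ennreal) simp
  show thesis
  proof (cases q)
    case top
    then have "ennreal (inverse p) = 1" using pq ip by simp
    then have p1: "p = 1" by simp
    obtain C where C: "AE x in M. \<bar>enn2ereal (\<rho> x)\<bar> \<le> ereal C"
      using \<rho>q top by (auto simp: Lp_space_def)
    show thesis
    proof (rule that[of "max 0 C"])
      fix k :: "'a \<Rightarrow> ennreal" assume k: "k \<in> borel_measurable borel"
      have "AE x in M. \<rho> x * k x \<le> ennreal (max 0 C) * k x"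
        using C
      proof eventually_elim
        case (elim x)
        then have "e2ennreal (enn2ereal (\<rho> x)) \<le> e2ennreal (ereal C)" by (intro e2ennreal_mono) simp
        then have "\<rho> x \<le> ennreal (max 0 C)" by (simp add: ennreal_max_0)
        then show ?case by (rule mult_right_mono) simp
      qed
      then have "(\<integral>\<^sup>+ x. \<rho> x * k x \<partial>M) \<le> (\<integral>\<^sup>+ x. ennreal (max 0 C) * k x \<partial>M)"
        by (rule nn_integral_mono_AE)
      also have "\<dots> = ennreal (max 0 C) * (\<integral>\<^sup>+ x. k x \<partial>M)"
        using meas[OF k] by (rule nn_integral_cmult)
      finally show "(\<integral>\<^sup>+ x. \<rho> x * k x \<partial>M) \<le> ennreal \<delta> + ennreal (max 0 C) * (\<integral>\<^sup>+ x. ennpow (k x) p \<partial>M)"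
        by (simp add: p1 add_increasing)
    qed simp
  next
    case (real q')
    then have q1: "1 < q'" using q by (simp flip: ennreal_1 add: ennreal_less_iff)
    then have "inverse q = ennreal (inverse q')" using real by (simp add: inverse_ennreal)
    then have "ennreal (inverse p + inverse q') = ennreal 1"
      using pq ip p q1 by simp
    then have "inverse p + inverse q' = 1" using p q1 by (subst (asm) ennreal_inj) auto
    then have pq': "(p - 1) * (q' - 1) = 1" using p q1 by (simp add: field_simps)
    define I where "I = (\<integral>\<^sup>+ x. ennpow (\<rho> x) q' \<partial>M)"
    have "I < \<infinity>" using \<rho>q real q1 by (simp add: Lp_space_def I_def)
    then obtain J where J: "I = ennreal J" "0 \<le> J" by (cases I) auto
    define \<delta>' where "\<delta>' = \<delta> / (J + 1)"
    have \<delta>': "0 < \<delta>'" "\<delta>' * J \<le> \<delta>" using \<delta> J by (auto simp: \<delta>'_def field_simps)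
    show thesis
    proof (rule that[of "\<delta>' powr (1 - p)"])
      fix k :: "'a \<Rightarrow> ennreal" assume k: "k \<in> borel_measurable borel"
      note [measurable] = meas[OF k] meas[OF \<rho>]
      have "(\<integral>\<^sup>+ x. \<rho> x * k x \<partial>M) \<le> (\<integral>\<^sup>+ x. ennreal \<delta>' * ennpow (\<rho> x) q' + ennreal (\<delta>' powr (1 - p)) * ennpow (k x) p \<partial>M)"
        by (intro nn_integral_mono ennreal_young q1 pq' \<delta>')
      also have "\<dots> = ennreal \<delta>' * I + ennreal (\<delta>' powr (1 - p)) * (\<integral>\<^sup>+ x. ennpow (k x) p \<partial>M)"
        by (simp add: nn_integral_add nn_integral_cmult I_def)
      also have "ennreal \<delta>' * I \<le> ennreal \<delta>"
        using \<delta>' J by (simp add: ennreal_leI flip: ennreal_mult)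
      finally show "(\<integral>\<^sup>+ x. \<rho> x * k x \<partial>M) \<le> ennreal \<delta> + ennreal (\<delta>' powr (1 - p)) * (\<integral>\<^sup>+ x. ennpow (k x) p \<partial>M)"
        by (simp add: add_right_mono)
    qed simp
  qed
qed

lemma line_integral_const:
  assumes "rectifiable c"
  shows "line_integral (\<lambda>_. k) c = k * curve_length c"
proof -
  have "line_integral (\<lambda>_. k) c = k * ennreal (enn2real (curve_length c))"
    unfolding line_integral_def by (subst nn_integral_cmult_indicator) auto
  then show ?thesis using assms by (simp add: rectifiable_def)
qed

text \<open>The constant \<open>L\<close> is an upper gradient because a curve is at least as long
  as its endpoints are apart; finite measure puts bounded functions into L^p.\<close>

lemma lipschitz_in_newtonian:
  fixes v :: "'a::metric_space \<Rightarrow> real"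
  assumes lip: "L-lipschitz_on UNIV v" and bd: "\<And>x. \<bar>v x\<bar> \<le> B"
    and fin: "emeasure (hausdorff N) (UNIV :: 'a set) < \<infinity>" and N: "0 \<le> N" and p: "1 \<le> p"
  shows "(\<lambda>x. ereal (v x)) \<in> newtonian p (hausdorff N)"
proof -
  have L: "0 \<le> L" using lip by (rule lipschitz_on_nonneg)
  have vb: "v \<in> borel_measurable borel"
    using lipschitz_on_continuous_on[OF lip] by (rule borel_measurable_continuous_onI)
  have bounded_Lp: "f \<in> Lp_space (ennreal p) (hausdorff N)"
    if f: "f \<in> borel_measurable borel" and b: "\<And>x. \<bar>f x\<bar> \<le> ereal C" for f :: "'a \<Rightarrow> ereal" and C
  proof -
    have "(\<integral>\<^sup>+ x. ennpow (e2ennreal \<bar>f x\<bar>) p \<partial>hausdorff N) \<le> (\<integral>\<^sup>+ x. ennpow (ennreal C) p \<partial>(hausdorff N :: 'a measure))"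
    proof (intro nn_integral_mono ennpow_mono)
      show "e2ennreal \<bar>f x\<bar> \<le> ennreal C" for x using e2ennreal_mono[OF b[of x]] by simp
    qed (use p in simp)
    also have "\<dots> = ennpow (ennreal C) p * emeasure (hausdorff N) (UNIV :: 'a set)" by simp
    also have "\<dots> < \<infinity>" using fin by (simp add: ennpow_def ennreal_mult_less_top)
    finally show ?thesis
      using borel_measurable_hausdorff[OF f N] p by (simp add: Lp_space_def)
  qed
  have "upper_gradient (\<lambda>x. ereal (v x)) (\<lambda>_. ennreal L)"
    unfolding upper_gradient_def
  proof (intro conjI allI)
    fix \<gamma> :: "real \<Rightarrow> 'a"
    show "upper_gradient_ineq (\<lambda>x. ereal (v x)) (\<lambda>_. ennreal L) (\<gamma>, 0, 1)"
      unfolding upper_gradient_ineq_def prod.case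
    proof
      assume r: "rectifiable (\<gamma>, 0, 1)"
      have "e2ennreal \<bar>ereal (v (\<gamma> 0)) - ereal (v (\<gamma> 1))\<bar> = ennreal (dist (v (\<gamma> 0)) (v (\<gamma> 1)))"
        by (simp add: dist_real_def)
      also have "\<dots> \<le> ennreal (L * dist (\<gamma> 0) (\<gamma> 1))"
        using lipschitz_onD[OF lip] by (intro ennreal_leI) simp
      also have "\<dots> \<le> ennreal L * curve_length (\<gamma>, 0, 1)"
        using L dist_le_curve_length[of 0 1 \<gamma>] by (simp add: ennreal_mult mult_left_mono)
      finally show "e2ennreal \<bar>ereal (v (\<gamma> 0)) - ereal (v (\<gamma> 1))\<bar> \<le> line_integral (\<lambda>_. ennreal L) (\<gamma>, 0, 1)"
        by (simp add: line_integral_const[OF r])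
    qed
  qed simp
  moreover have "(\<lambda>x::'a. enn2ereal (ennreal L)) \<in> Lp_space (ennreal p) (hausdorff N)"
    using L by (intro bounded_Lp[of _ L]) auto
  moreover have "(\<lambda>x. ereal (v x)) \<in> Lp_space (ennreal p) (hausdorff N)"
    using vb bd by (intro bounded_Lp[of _ B]) auto
  ultimately show ?thesis unfolding newtonian_def by blast
qed

lemma (in lipschitz_curve) rectifiable: "rectifiable (\<gamma>, 0, \<Lambda>)"
proof -
  have "1-lipschitz_on {0..\<Lambda>} \<gamma>"
  proof (rule lipschitz_onI)
    fix x y assume "x \<in> {0..\<Lambda>}" "y \<in> {0..\<Lambda>}"
    then show "dist (\<gamma> x) (\<gamma> y) \<le> 1 * dist x y"
      using lip[of x y] lip[of y x] by (cases "x \<le> y") (auto simp: dist_real_def dist_commute)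
  qed simp
  then have "continuous_on {0..\<Lambda>} \<gamma>" by (rule lipschitz_on_continuous_on)
  then show ?thesis using \<Lambda> by (simp add: rectifiable_def is_curve_def length_eq_\<sigma>)
qed

section \<open>Competitors of prescribed accuracy\<close>

text \<open>The error \<open>k\<close> gathers the density of the exceptional curves, the
  Vitali-Caratheodory excess and the constants; it is fixed before \<rho> is quantified.\<close>

lemma exists_lipschitz_competitor:
  fixes E F :: "'a::metric_space set" and u :: "'a \<Rightarrow> ereal" and G :: "'a \<Rightarrow> ennreal"
  assumes p: "1 \<le> p" and N: "1 \<le> N" and X: "compact (UNIV :: 'a set)"
    and fin: "emeasure (hausdorff N) (UNIV :: 'a set) < \<infinity>"
    and E: "closed E" "E \<noteq> {}" and F: "closed F" and EF: "E \<inter> F = {}"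
    and u: "\<And>x. x \<in> F \<Longrightarrow> u x = 1" "\<And>x. x \<in> E \<Longrightarrow> u x = 0"
    and G: "G \<in> borel_measurable borel" "almost_every_curve p (hausdorff N) (upper_gradient_ineq u G)"
    and \<eta>: "0 < (\<eta>::real)"
  shows "\<exists>(v :: 'a \<Rightarrow> real) (k :: 'a \<Rightarrow> ennreal) L. L-lipschitz_on UNIV v \<and> (\<forall>x. \<bar>v x\<bar> \<le> 1) \<and> (\<forall>x\<in>F. v x = 1) \<and> (\<forall>x\<in>E. v x = 0) \<and>
    k \<in> borel_measurable borel \<and> (\<integral>\<^sup>+ x. ennpow (k x) p \<partial>hausdorff N) \<le> ennreal \<eta> \<and>
    (\<forall>\<rho> :: 'a \<Rightarrow> ennreal. \<rho> \<in> borel_measurable borel \<longrightarrow>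
      (\<integral>\<^sup>+ t \<in> {0..1}. (\<integral>\<^sup>+ x \<in> frontier {x. v x < t}. \<rho> x \<partial>hausdorff (N - 1)) \<partial>lebesgue)
      \<le> ennreal (2 * unit_ball_vol (N - 1) / unit_ball_vol N) * (\<integral>\<^sup>+ x. \<rho> x * (G x + k x) \<partial>hausdorff N))"
proof -
  define M where "M = (hausdorff N :: 'a measure)"
  have bor: "sets borel \<subseteq> sets M" using N unfolding M_def by (intro sets_borel_le_hausdorff) simp
  have fM: "emeasure M UNIV < \<infinity>" using fin by (simp add: M_def)
  have p0: "0 < p" using p by simp
  obtain \<mu> where \<mu>: "emeasure M UNIV = ennreal \<mu>" "0 \<le> \<mu>"
    using fin unfolding M_def by (cases "emeasure (hausdorff N) (UNIV :: 'a set)") auto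
  define A where "A = 2 powr p"
  have A: "0 < A" by (simp add: A_def)
  \<comment> \<open>Splitting \<open>k\<close> into three summands by two uses of
    \<open>ennpow_add_le\<close> costs \<open>A\<close> for the first and \<open>A * A\<close> for
    the other two; each share stays within \<open>\<eta> / 3\<close>.\<close>
  define e where "e = min (\<eta> / (3 * A)) (\<eta> / (3 * A * A))"
  have e: "0 < e" "A * e \<le> \<eta> / 3" "A * (A * e) \<le> \<eta> / 3"
    using \<eta> A by (auto simp: e_def min_def field_simps)
  \<comment> \<open>Makes the \<open>p\<close>-th power of the constant \<open>3 * c\<close>
    integrate to at most \<open>e\<close>; the 1 guards against total measure zero.\<close>
  define c where "c = (e / (\<mu> + 1)) powr (1 / p) / 3"
  have c: "0 < c" using e \<mu> by (simp add: c_def)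
  have c\<mu>: "(3 * c) powr p * \<mu> \<le> e"
  proof -
    have "(3 * c) powr p = e / (\<mu> + 1)" using e \<mu> p by (simp add: c_def powr_powr)
    then have "(3 * c) powr p * (\<mu> + 1) = e" using \<mu> by simp
    moreover have "(3 * c) powr p * \<mu> \<le> (3 * c) powr p * (\<mu> + 1)" by (rule mult_left_mono) auto
    ultimately show ?thesis by simp
  qed
  define \<Gamma> where "\<Gamma> = {c. is_curve c \<and> \<not> upper_gradient_ineq u G c}"
  have "modulus p M \<Gamma> < ennreal e"
    using G(2) e by (simp add: almost_every_curve_def M_def \<Gamma>_def)
  \<comment> \<open>Modulus zero provides a density with \<open>p\<close>-integral below
    \<open>e\<close> that gives length at least 1 to every rectifiable exceptional curve.\<close>
  then obtain \<sigma> where \<sigma>: "\<sigma> \<in> borel_measurable borel" "\<And>c. c \<in> \<Gamma> \<Longrightarrow> rectifiable c \<Longrightarrow> 1 \<le> line_integral \<sigma> c"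
    and \<sigma>_int: "(\<integral>\<^sup>+ x. ennpow (\<sigma> x) p \<partial>M) < ennreal e"
    unfolding modulus_def by (auto simp: INF_less_iff)
  define f where "f = (\<lambda>x. G x + \<sigma> x)"
  have f: "f \<in> borel_measurable borel" using G(1) \<sigma>(1) unfolding f_def by measurable
  obtain g :: "nat \<Rightarrow> 'a \<Rightarrow> real" and D :: "'a \<Rightarrow> ennreal"
    where D: "D \<in> borel_measurable borel" "(\<integral>\<^sup>+x. ennpow (D x) p \<partial>M) \<le> ennreal e"
    and g: "\<And>n. \<exists>L. L-lipschitz_on UNIV (g n)" "\<And>n x. c \<le> g n x" "\<And>x. incseq (\<lambda>n. g n x)"
    and g_le: "\<And>n x. ennreal (g n x) \<le> f x + D x + ennreal (2 * c)"
    and g_sup: "\<And>x. f x + ennreal c \<le> (SUP n. ennreal (g n x))"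
    by (rule vitali_caratheodory[OF fM bor f p0 e(1) c]) (rule that)
  have g0: "0 \<le> g n x" for n x using c g(2)[of n x] by simp
  have gb: "g n \<in> borel_measurable borel" for n
    using g(1)[of n] lipschitz_on_continuous_on by (blast intro: borel_measurable_continuous_onI)
  have "\<exists>n. \<forall>x\<in>F. chain_dist (g n) (inverse (real (Suc n))) E x = 1"
  proof (rule ccontr)
    assume neg: "\<not> ?thesis"
    have chains: "\<exists>x\<in>F. \<exists>l a. chain (g n) (inverse (real (Suc n))) E x l a \<and> a \<le> 1" for n
    proof -
      obtain x where x: "x \<in> F" "chain_dist (g n) (inverse (real (Suc n))) E x \<noteq> 1" using neg by blast
      then have "chain_dist (g n) (inverse (real (Suc n))) E x < 1"
        using chain_dist_bounds(2)[where g = "g n" and x = x, OF g0] by (simp add: order_less_le)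
      from chain_dist_less_one[where g = "g n", OF g0 this] show ?thesis using x(1) by blast
    qed
    obtain \<gamma> where lc: "lipschitz_curve \<gamma> (1 / c)" and ends: "\<gamma> 0 \<in> E" "\<gamma> (1 / c) \<in> F"
      and li: "\<And>n. line_integral (\<lambda>x. ennreal (g n x)) (\<gamma>, 0, 1 / c) \<le> 1"
      using chains_limit_curve[OF X E(1) F g(1) c g(2) g(3) chains] by blast
    interpret lipschitz_curve \<gamma> "1 / c" by (rule lc)
    have "line_integral (\<lambda>x. SUP n. ennreal (g n x)) (\<gamma>, 0, 1 / c) \<le> 1"
    proof (rule line_integral_SUP_le[OF _ _ li])
      show "(\<lambda>x. ennreal (g n x)) \<in> borel_measurable borel" for n using gb[of n] by measurable
      show "incseq (\<lambda>n. ennreal (g n x))" for x using g(3)[of x] by (auto simp: incseq_def ennreal_leI)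
    qed
    moreover have "line_integral (\<lambda>x. f x + ennreal c) (\<gamma>, 0, 1 / c) \<le> line_integral (\<lambda>x. SUP n. ennreal (g n x)) (\<gamma>, 0, 1 / c)"
      unfolding line_integral_def using g_sup by (intro nn_integral_mono mult_right_mono) auto
    ultimately have le1: "line_integral f (\<gamma>, 0, 1 / c) + ennreal c * curve_length (\<gamma>, 0, 1 / c) \<le> 1"
      by (simp add: line_integral_add_const[OF f])
    have mono_f: "line_integral h (\<gamma>, 0, 1 / c) \<le> line_integral f (\<gamma>, 0, 1 / c)" if "\<And>x. h x \<le> f x" for h
      unfolding line_integral_def using that by (intro nn_integral_mono mult_right_mono) auto
    \<comment> \<open>Either \<open>G\<close> obeys the upper gradient inequality on this curve,
      along which \<open>u\<close> changes by 1, or the curve is exceptional and \<sigma>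
      compensates.\<close>
    have "1 \<le> line_integral f (\<gamma>, 0, 1 / c)"
    proof (cases "upper_gradient_ineq u G (\<gamma>, 0, 1 / c)")
      case True
      have "e2ennreal \<bar>u (\<gamma> 0) - u (\<gamma> (1 / c))\<bar> = 1"
        using u(1)[OF ends(2)] u(2)[OF ends(1)] by (simp add: one_ereal_def flip: zero_ereal_def)
      then have "1 \<le> line_integral G (\<gamma>, 0, 1 / c)"
        using True rectifiable by (simp add: upper_gradient_ineq_def)
      also have "\<dots> \<le> line_integral f (\<gamma>, 0, 1 / c)" by (rule mono_f) (simp add: f_def)
      finally show ?thesis .
    next
      case False
      then have "(\<gamma>, 0, 1 / c) \<in> \<Gamma>" using rectifiable by (simp add: \<Gamma>_def rectifiable_def)
      then have "1 \<le> line_integral \<sigma> (\<gamma>, 0, 1 / c)" using rectifiable by (rule \<sigma>(2))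
      also have "\<dots> \<le> line_integral f (\<gamma>, 0, 1 / c)" by (rule mono_f) (simp add: f_def)
      finally show ?thesis .
    qed
    \<comment> \<open>The surplus \<open>c\<close> integrates to a positive amount because
      disjointness of \<open>E\<close> and \<open>F\<close> keeps the endpoints apart.\<close>
    moreover have "0 < ennreal c * curve_length (\<gamma>, 0, 1 / c)"
    proof -
      have "0 < dist (\<gamma> 0) (\<gamma> (1 / c))" using ends EF by auto
      then have "0 < ennreal (dist (\<gamma> 0) (\<gamma> (1 / c)))" by simp
      also have "\<dots> \<le> curve_length (\<gamma>, 0, 1 / c)" using c by (intro dist_le_curve_length) simp
      finally show ?thesis using c by (simp add: ennreal_zero_less_mult_iff)
    qed
    moreover have "1 + ennreal c * curve_length (\<gamma>, 0, 1 / c) \<le> 1 + 0"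
      using order_trans[OF add_right_mono[OF \<open>1 \<le> line_integral f (\<gamma>, 0, 1 / c)\<close>] le1] by simp
    then have "ennreal c * curve_length (\<gamma>, 0, 1 / c) \<le> 0"
      by (subst (asm) ennreal_add_left_cancel_le) simp
    ultimately show False by (metis not_le)
  qed
  then obtain n where n: "\<And>x. x \<in> F \<Longrightarrow> chain_dist (g n) (inverse (real (Suc n))) E x = 1" by blast
  define \<delta> where "\<delta> = inverse (real (Suc n))"
  have \<delta>: "0 < \<delta>" by (simp add: \<delta>_def)
  define v where "v = chain_dist (g n) \<delta> E"
  obtain B where B: "\<And>x. g n x \<le> B"
  proof -
    obtain x0 where "\<forall>x\<in>UNIV. g n x \<le> g n x0"
      using continuous_attains_sup[OF X _ lipschitz_on_continuous_on] g(1)[of n] by (metis UNIV_not_empty)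
    then show thesis using that by blast
  qed
  have v_lip: "(max B (1 / \<delta>))-lipschitz_on UNIV v"
    unfolding v_def by (rule chain_dist_lipschitz[where g = "g n", OF g0 \<delta> B])
  \<comment> \<open>\<open>2 * c\<close> comes from the upper bound of the \<open>g n\<close>, one
    more \<open>c\<close> from the slicing width, taken to be \<open>c\<close> in
    \<open>coarea_frontier_le\<close>.\<close>
  define k where "k = (\<lambda>x. \<sigma> x + (D x + ennreal (3 * c)))"
  have k: "k \<in> borel_measurable borel" using \<sigma>(1) D(1) unfolding k_def by measurable
  have mM: "h \<in> borel_measurable M" if "h \<in> borel_measurable borel" for h :: "'a \<Rightarrow> ennreal"
    using borel_measurable_hausdorff[OF that] N by (simp add: M_def)
  have spM: "space M = UNIV" by (simp add: M_def)
  note [measurable] = mM[OF \<sigma>(1)] mM[OF D(1)]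
  have k_int: "(\<integral>\<^sup>+ x. ennpow (k x) p \<partial>M) \<le> ennreal \<eta>"
  proof -
    have "(\<integral>\<^sup>+ x. ennpow (k x) p \<partial>M)
        \<le> (\<integral>\<^sup>+ x. ennreal A * (ennpow (\<sigma> x) p + ennreal A * (ennpow (D x) p + ennreal ((3 * c) powr p))) \<partial>M)"
    proof (rule nn_integral_mono)
      fix x
      have "ennpow (k x) p \<le> ennreal A * (ennpow (\<sigma> x) p + ennpow (D x + ennreal (3 * c)) p)"
        unfolding k_def A_def using p by (intro ennpow_add_le) simp
      also have "ennpow (D x + ennreal (3 * c)) p \<le> ennreal A * (ennpow (D x) p + ennpow (ennreal (3 * c)) p)"
        unfolding A_def using p by (intro ennpow_add_le) simp
      also have "ennpow (ennreal (3 * c)) p = ennreal ((3 * c) powr p)"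
        using c by (intro ennpow_ennreal) simp
      finally show "ennpow (k x) p \<le> ennreal A * (ennpow (\<sigma> x) p + ennreal A * (ennpow (D x) p + ennreal ((3 * c) powr p)))"
        by (simp add: add_left_mono mult_left_mono)
    qed
    also have "\<dots> = ennreal A * ((\<integral>\<^sup>+ x. ennpow (\<sigma> x) p \<partial>M) + ennreal A * ((\<integral>\<^sup>+ x. ennpow (D x) p \<partial>M) + ennreal ((3 * c) powr p * \<mu>)))"
    proof -
      have "(\<integral>\<^sup>+ x. ennreal ((3 * c) powr p) \<partial>M) = ennreal ((3 * c) powr p * \<mu>)"
        using \<mu> by (simp add: ennreal_mult spM)
      then show ?thesis by (simp add: nn_integral_cmult nn_integral_add)
    qed
    also have "\<dots> \<le> ennreal A * (ennreal e + ennreal A * (ennreal e + ennreal e))"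
      using \<sigma>_int D(2) c\<mu> by (intro mult_left_mono add_mono) (auto intro: ennreal_leI less_imp_le)
    also have "\<dots> = ennreal (A * (e + A * (e + e)))"
      using A e(1) by (simp only: ennreal_mult ennreal_plus add_nonneg_nonneg mult_nonneg_nonneg less_imp_le)
    also have "\<dots> \<le> ennreal \<eta>"
      using e by (intro ennreal_leI) (simp add: distrib_left)
    finally show ?thesis .
  qed
  have "(\<integral>\<^sup>+ t \<in> {0..1}. (\<integral>\<^sup>+ x \<in> frontier {x. v x < t}. \<rho> x \<partial>hausdorff (N - 1)) \<partial>lebesgue)
      \<le> ennreal (2 * unit_ball_vol (N - 1) / unit_ball_vol N) * (\<integral>\<^sup>+ x. \<rho> x * (G x + k x) \<partial>hausdorff N)"
    if \<rho>: "\<rho> \<in> borel_measurable borel" for \<rho> :: "'a \<Rightarrow> ennreal"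
  proof -
    have "(\<integral>\<^sup>+ t \<in> {0..1}. (\<integral>\<^sup>+ x \<in> frontier {x. v x < t}. \<rho> x \<partial>hausdorff (N - 1)) \<partial>lebesgue)
        \<le> ennreal (2 * unit_ball_vol (N - 1) / unit_ball_vol N) * (\<integral>\<^sup>+ x. \<rho> x * (ennreal (g n x) + ennreal c) \<partial>hausdorff N)"
    proof (rule coarea_frontier_le[OF N fin gb[of n] g0[of n] \<delta> c])
      show "\<bar>v x - v y\<bar> \<le> max (g n x) (g n y) * dist x y" if "dist x y < \<delta>" for x y
        unfolding v_def by (rule chain_dist_local_lipschitz[where g = "g n", OF g0 that])
    qed (use lipschitz_on_continuous_on[OF v_lip] \<rho> in auto)
    also have "\<dots> \<le> ennreal (2 * unit_ball_vol (N - 1) / unit_ball_vol N) * (\<integral>\<^sup>+ x. \<rho> x * (G x + k x) \<partial>hausdorff N)"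
    proof (intro mult_left_mono nn_integral_mono)
      fix x
      have "ennreal (g n x) + ennreal c \<le> (f x + D x + ennreal (2 * c)) + ennreal c"
        using g_le by (rule add_right_mono)
      also have "\<dots> = f x + D x + ennreal (2 * c + c)" using c by (subst ennreal_plus) (auto simp: add.assoc)
      also have "\<dots> = G x + k x" by (simp add: f_def k_def ac_simps)
      finally show "ennreal (g n x) + ennreal c \<le> G x + k x" .
    qed auto
    finally show ?thesis .
  qed
  moreover have "\<bar>v x\<bar> \<le> 1" for x
    using chain_dist_bounds[where g = "g n" and x = x, OF g0] by (simp add: v_def)
  moreover have "\<forall>x\<in>F. v x = 1" using n by (simp add: v_def \<delta>_def)
  moreover have "\<forall>x\<in>E. v x = 0" using chain_dist_start[where g = "g n", OF g0] by (simp add: v_def)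
  ultimately show ?thesis
    using v_lip k k_int unfolding M_def
    by (intro exI[of _ v] exI[of _ k] exI[of _ "max B (1 / \<delta>)"] conjI allI impI)
qed

section \<open>Letting the accuracy tend to zero\<close>

theorem theorem1p3:
  fixes p N :: real and q :: ennreal
    and E F :: "'a::metric_space set"
    and u :: "'a \<Rightarrow> ereal" and G :: "'a \<Rightarrow> ennreal"
  assumes "1 \<le> p" and "1 < q" and "inverse (ennreal p) + inverse q = 1"
    and "1 \<le> N"
    and "compact (UNIV :: 'a set)"
    and "emeasure (hausdorff N) (UNIV :: 'a set) < \<infinity>"
    and "continuum E" and "continuum F" and "E \<inter> F = {}"
    and "u \<in> newtonian p (hausdorff N)"
    and "\<forall>x\<in>F. u x = 1" and "\<forall>x\<in>E. u x = 0"
    and "minimal_weak_upper_gradient p (hausdorff N) u G"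
  shows "\<exists>v :: nat \<Rightarrow> 'a \<Rightarrow> real.
    (\<forall>i. (\<exists>L. L-lipschitz_on UNIV (v i)) \<and>
         (\<lambda>x. ereal (v i x)) \<in> newtonian p (hausdorff N) \<and>
         (\<forall>x\<in>F. v i x = 1) \<and> (\<forall>x\<in>E. v i x = 0)) \<and>
    (\<forall>\<rho> :: 'a \<Rightarrow> ennreal.
       \<rho> \<in> borel_measurable borel \<longrightarrow>
       (\<lambda>x. enn2ereal (\<rho> x)) \<in> Lp_space q (hausdorff N) \<longrightarrow>
       limsup (\<lambda>i. \<integral>\<^sup>+ t \<in> {0..1}.
           (\<integral>\<^sup>+ x \<in> frontier {x. v i x < t}. \<rho> x \<partial>hausdorff (N - 1)) \<partial>lebesgue)
         \<le> ennreal (2 * unit_ball_vol (N - 1) / unit_ball_vol N) *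
            (\<integral>\<^sup>+ x. \<rho> x * G x \<partial>hausdorff N))"
proof -
  let ?c = "2 * unit_ball_vol (N - 1) / unit_ball_vol N"
  let ?I = "\<lambda>v \<rho>. \<integral>\<^sup>+ t \<in> {0..1}. (\<integral>\<^sup>+ x \<in> frontier {x::'a. v x < t}. \<rho> x \<partial>hausdorff (N - 1)) \<partial>lebesgue"
  have c0: "0 \<le> ?c" using assms(4) by simp
  have N0: "0 \<le> N" using assms(4) by simp
  have E: "closed E" "E \<noteq> {}" and F: "closed F"
    using assms(7,8) by (auto simp: continuum_def compact_imp_closed)
  have G: "G \<in> borel_measurable borel" "almost_every_curve p (hausdorff N) (upper_gradient_ineq u G)"
    using assms(13) by (auto simp: minimal_weak_upper_gradient_def)
  have u: "\<And>x. x \<in> F \<Longrightarrow> u x = 1" "\<And>x. x \<in> E \<Longrightarrow> u x = 0" using assms(11,12) by auto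
  \<comment> \<open>Accuracy \<open>1 / (i + 1)\<close>; \<rho> stays universally quantified inside,
    so \<open>v\<close> is chosen once for all weights.\<close>
  have "\<forall>i::nat. \<exists>(v :: 'a \<Rightarrow> real) (k :: 'a \<Rightarrow> ennreal) L. L-lipschitz_on UNIV v \<and> (\<forall>x. \<bar>v x\<bar> \<le> 1) \<and> (\<forall>x\<in>F. v x = 1) \<and> (\<forall>x\<in>E. v x = 0) \<and>
    k \<in> borel_measurable borel \<and> (\<integral>\<^sup>+ x. ennpow (k x) p \<partial>hausdorff N) \<le> ennreal (inverse (real (Suc i))) \<and>
    (\<forall>\<rho>. \<rho> \<in> borel_measurable borel \<longrightarrow> ?I v \<rho> \<le> ennreal ?c * (\<integral>\<^sup>+ x. \<rho> x * (G x + k x) \<partial>hausdorff N))"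
    by (intro allI exists_lipschitz_competitor[OF assms(1,4,5,6) E F assms(9) u G]) simp_all
  from choice[OF this] obtain v :: "nat \<Rightarrow> 'a \<Rightarrow> real" where "\<forall>i. \<exists>k L. L-lipschitz_on UNIV (v i) \<and> (\<forall>x. \<bar>v i x\<bar> \<le> 1) \<and> (\<forall>x\<in>F. v i x = 1) \<and> (\<forall>x\<in>E. v i x = 0) \<and>
    k \<in> borel_measurable borel \<and> (\<integral>\<^sup>+ x. ennpow (k x) p \<partial>hausdorff N) \<le> ennreal (inverse (real (Suc i))) \<and>
    (\<forall>\<rho>. \<rho> \<in> borel_measurable borel \<longrightarrow> ?I (v i) \<rho> \<le> ennreal ?c * (\<integral>\<^sup>+ x. \<rho> x * (G x + k x) \<partial>hausdorff N))"
    by (rule exE)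
  from choice[OF this] obtain k :: "nat \<Rightarrow> 'a \<Rightarrow> ennreal" where vk: "\<forall>i. \<exists>L. L-lipschitz_on UNIV (v i) \<and> (\<forall>x. \<bar>v i x\<bar> \<le> 1) \<and> (\<forall>x\<in>F. v i x = 1) \<and> (\<forall>x\<in>E. v i x = 0) \<and>
    k i \<in> borel_measurable borel \<and> (\<integral>\<^sup>+ x. ennpow (k i x) p \<partial>hausdorff N) \<le> ennreal (inverse (real (Suc i))) \<and>
    (\<forall>\<rho>. \<rho> \<in> borel_measurable borel \<longrightarrow> ?I (v i) \<rho> \<le> ennreal ?c * (\<integral>\<^sup>+ x. \<rho> x * (G x + k i x) \<partial>hausdorff N))"
    by (rule exE)
  then have v_lip: "\<exists>L. L-lipschitz_on UNIV (v i)" and v_bd: "\<bar>v i x\<bar> \<le> 1"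
    and v_EF: "(\<forall>x\<in>F. v i x = 1) \<and> (\<forall>x\<in>E. v i x = 0)"
    and k: "k i \<in> borel_measurable borel"
    and k_int: "(\<integral>\<^sup>+ x. ennpow (k i x) p \<partial>hausdorff N) \<le> ennreal (inverse (real (Suc i)))"
    and I_le: "\<rho> \<in> borel_measurable borel \<Longrightarrow> ?I (v i) \<rho> \<le> ennreal ?c * (\<integral>\<^sup>+ x. \<rho> x * (G x + k i x) \<partial>hausdorff N)" for i x \<rho>
    by blast+
  show ?thesis
  proof (intro exI[of _ v] conjI allI impI)
    show "\<exists>L. L-lipschitz_on UNIV (v i)" for i by (rule v_lip)
    show "(\<lambda>x. ereal (v i x)) \<in> newtonian p (hausdorff N)" for i
      by (rule exE[OF v_lip[of i]]) (rule lipschitz_in_newtonian[OF _ v_bd assms(6) N0 assms(1)])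
    show "\<forall>x\<in>F. v i x = 1" "\<forall>x\<in>E. v i x = 0" for i using v_EF by auto
    fix \<rho> :: "'a \<Rightarrow> ennreal"
    assume \<rho>: "\<rho> \<in> borel_measurable borel" and \<rho>q: "(\<lambda>x. enn2ereal (\<rho> x)) \<in> Lp_space q (hausdorff N)"
    let ?A = "\<integral>\<^sup>+ x. \<rho> x * G x \<partial>hausdorff N"
    show "limsup (\<lambda>i. ?I (v i) \<rho>) \<le> ennreal ?c * ?A"
    proof (rule ennreal_le_epsilon)
      fix e :: real assume e: "0 < e"
      \<comment> \<open>\<delta> is spent twice, once in the bound of
        \<open>integral_mult_le_Lp\<close> and once on \<open>K / (i + 1)\<close> for large
        \<open>i\<close>; after multiplication by \<open>?c\<close> both together stay within
        \<open>e\<close>.\<close>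
      define \<delta> where "\<delta> = e / (2 * (?c + 1))"
      have "0 < e / (2 * (b + 1)) \<and> b * (e / (2 * (b + 1)) + e / (2 * (b + 1))) \<le> e" if "0 \<le> b" for b
      proof -
        have "b * (e / (2 * (b + 1)) + e / (2 * (b + 1))) = e * (b / (b + 1))"
          using that by (simp add: divide_simps)
        also have "\<dots> \<le> e * 1" using e that by (intro mult_left_mono) auto
        finally show ?thesis using e that by simp
      qed
      from this[OF c0] have \<delta>: "0 < \<delta>" "?c * (\<delta> + \<delta>) \<le> e" by (simp_all only: \<delta>_def)
      obtain K where K: "0 \<le> K" "\<And>k. k \<in> borel_measurable borel \<Longrightarrow>
          (\<integral>\<^sup>+ x. \<rho> x * k x \<partial>hausdorff N) \<le> ennreal \<delta> + ennreal K * (\<integral>\<^sup>+ x. ennpow (k x) p \<partial>hausdorff N)"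
        using integral_mult_le_Lp[OF assms(1,2,3) \<delta>(1) sets_borel_le_hausdorff[OF N0] \<rho> \<rho>q] by blast
      have "(\<lambda>i. K * inverse (real (Suc i))) \<longlonglongrightarrow> K * 0"
        by (intro tendsto_mult tendsto_const LIMSEQ_inverse_real_of_nat)
      then have "\<forall>\<^sub>F i in sequentially. K * inverse (real (Suc i)) < \<delta>"
        using \<delta> by (intro order_tendstoD(2)) auto
      then have "\<forall>\<^sub>F i in sequentially. ?I (v i) \<rho> \<le> ennreal ?c * ?A + ennreal e"
      proof eventually_elim
        case (elim i)
        have "(\<integral>\<^sup>+ x. \<rho> x * k i x \<partial>hausdorff N) \<le> ennreal \<delta> + ennreal K * (\<integral>\<^sup>+ x. ennpow (k i x) p \<partial>hausdorff N)"
          by (rule K(2)[OF k])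
        also have "\<dots> \<le> ennreal \<delta> + ennreal K * ennreal (inverse (real (Suc i)))"
          by (intro add_left_mono mult_left_mono k_int) simp
        also have "ennreal K * ennreal (inverse (real (Suc i))) = ennreal (K * inverse (real (Suc i)))"
          using K(1) by (intro ennreal_mult[symmetric]) auto
        also have "\<dots> \<le> ennreal \<delta>" using elim by (intro ennreal_leI) simp
        finally have small: "(\<integral>\<^sup>+ x. \<rho> x * k i x \<partial>hausdorff N) \<le> ennreal \<delta> + ennreal \<delta>"
          by (simp add: add_left_mono)
        have "?I (v i) \<rho> \<le> ennreal ?c * (\<integral>\<^sup>+ x. \<rho> x * (G x + k i x) \<partial>hausdorff N)" by (rule I_le[OF \<rho>])
        also have "(\<integral>\<^sup>+ x. \<rho> x * (G x + k i x) \<partial>hausdorff N) = ?A + (\<integral>\<^sup>+ x. \<rho> x * k i x \<partial>hausdorff N)"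
          unfolding distrib_left using borel_measurable_hausdorff[OF \<rho> N0]
            borel_measurable_hausdorff[OF G(1) N0] borel_measurable_hausdorff[OF k N0]
          by (intro nn_integral_add borel_measurable_times_ennreal)
        also have "ennreal ?c * \<dots> \<le> ennreal ?c * (?A + (ennreal \<delta> + ennreal \<delta>))"
          using small by (intro mult_left_mono add_left_mono) auto
        also have "\<dots> = ennreal ?c * ?A + ennreal (?c * (\<delta> + \<delta>))"
        proof -
          have "ennreal \<delta> + ennreal \<delta> = ennreal (\<delta> + \<delta>)" using \<delta>(1) by (intro ennreal_plus[symmetric]) auto
          moreover have "ennreal ?c * ennreal (\<delta> + \<delta>) = ennreal (?c * (\<delta> + \<delta>))"
            using \<delta>(1) c0 by (intro ennreal_mult[symmetric]) auto
          ultimately show ?thesis by (simp only: distrib_left[of "ennreal ?c" ?A])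
        qed
        also have "\<dots> \<le> ennreal ?c * ?A + ennreal e"
          using \<delta>(2) by (intro add_left_mono ennreal_leI)
        finally show ?case .
      qed
      then show "limsup (\<lambda>i. ?I (v i) \<rho>) \<le> ennreal ?c * ?A + ennreal e"
        by (rule Limsup_bounded)
    qed
  qed
qed

end
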